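(* Let $H$ be a cocommutative Hopf algebra over $\mathbf k$, $\Gamma$ a group acting on $H$ by (Hopf algebra) automorphisms, and $\widetilde H=H\,\sharp\,\mathbf k[\Gamma]$ the smash product. A Lie $\widetilde H$-pseudoalgebra $L$ is the same as a Lie $H$-pseudoalgebra $L$ on which the group $\Gamma$ acts in a way compatible with the action of $H$, by preserving the $H$-pseudobracket: $$[ga*gb]=g\cdot[a*b]\qquad\text{for }g\in\Gamma,\ a,b\in L,$$ and satisfying the following finiteness condition: given $a,b\in L$, $[ga*b]$ is nonzero for only a finite number of $g\in\Gamma$. The $\widetilde H$-pseudobracket of $L$ is given by the formula $$[a\,\widetilde*\,b]=\sum_{g\in\Gamma}\bigl((g^{-1}\otimes1)\otimes_{\widetilde H}1\bigr)[ga*b],\qquad a,b\in L.$$ (That is, for a fixed left $\widetilde H$-module $L$, this formula defines a bijection from the set of Lie $H$-pseudobrackets on $L$ with the two stated properties onto the set of Lie $\widetilde H$-pseudobrackets on $L$.) A similar statement holds for representations, as well as for associative pseudoalgebras (with $[a*b]$ replaced by the action $a*m$, respectively the product $a*b$).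
   Context: $\mathbf k$ is an algebraically closed field of characteristic $0$; unadorned $\otimes$ is over $\mathbf k$. $\widetilde H$ is the cocommutative Hopf algebra which is $H\otimes\mathbf k[\Gamma]$ as a coalgebra, with $gfg^{-1}=g\cdot f$ for $g\in\Gamma,f\in H$. A left $\widetilde H$-module $L$ is the same as a left $H$-module with an action of $\Gamma$ compatible with that of $H$: $(g\cdot f)l=g(f(g^{-1}l))$. $\Gamma$ acts on $(H\otimes H)\otimes_HL$ by $g\cdot((f_1\otimes f_2)\otimes_Hl)=(g\cdot f_1\otimes g\cdot f_2)\otimes_Hgl$. In the formula for $[a\,\widetilde*\,b]$, $[ga*b]\in(H\otimes H)\otimes_HL$ is regarded as an element of $(\widetilde H\otimes\widetilde H)\otimes_{\widetilde H}L$ via the natural map. For a cocommutative Hopf algebra $H$, $H^{\otimes n}$ is a right $H$-module via the iterated coproduct. An $H$-pseudoalgebra is a left $H$-module $L$ with a linear map $L\otimes L\to(H\otimes H)\otimes_HL$, $a\otimes b\mapsto a*b$, with $fa*gb=((f\otimes g)\otimes_H1)(a*b)$. Compositions: if $a*b=\sum_i g_i\otimes_He_i$ and $e_i*c=\sum_j(f_{ij}\otimes g_{ij})\otimes_He_{ij}$, then $(a*b)*c=\sum(g_i\otimes1)(\Delta(f_{ij})\otimes g_{ij})\otimes_He_{ij}$; if $b*c=\sum_i h_i\otimes_Hd_i$ and $a*d_i=\sum_j(h_{ij}\otimes l_{ij})\otimes_Hd_{ij}$, then $a*(b*c)=\sum(1\otimes h_i)(h_{ij}\otimes\Delta(l_{ij}))\otimes_Hd_{ij}$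 (in $H^{\otimes3}\otimes_HL$). It is associative if $a*(b*c)=(a*b)*c$. It is a Lie pseudoalgebra (pseudoproduct written $[a*b]$) if $[b*a]=-(\sigma\otimes_H\mathrm{id})[a*b]$ ($\sigma$ the flip) and $[a*[b*c]]-((\sigma\otimes\mathrm{id})\otimes_H\mathrm{id})[b*[a*c]]=[[a*b]*c]$. A representation of a Lie (associative) pseudoalgebra $L$ is a left $H$-module $M$ with an $H\otimes H$-linear map $L\otimes M\to(H\otimes H)\otimes_HM$, $a\otimes m\mapsto a*m$, satisfying $a*(b*m)-((\sigma\otimes\mathrm{id})\otimes_H\mathrm{id})(b*(a*m))=[a*b]*m$ (respectively $a*(b*m)=(a*b)*m$). *)

theory Defs
  imports "HOL-Library.Poly_Mapping" "HOL-Computational_Algebra.Polynomial"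
begin

section \<open>Quotients of abelian groups and tensor products\<close>

inductive_set gen_subgroup :: "'a::ab_group_add set \<Rightarrow> 'a set" for S :: "'a set" where
  zero: "0 \<in> gen_subgroup S"
| gen: "x \<in> S \<Longrightarrow> x \<in> gen_subgroup S"
| diff: "x \<in> gen_subgroup S \<Longrightarrow> y \<in> gen_subgroup S \<Longrightarrow> x - y \<in> gen_subgroup S"

definition coset :: "'a::ab_group_add set \<Rightarrow> 'a \<Rightarrow> 'a set" where
  "coset N x = {y. y - x \<in> N}"

definition quot :: "'a::ab_group_add set \<Rightarrow> 'a set set" where
  "quot N = range (coset N)"

text \<open>
  Maps out of a quotient are written by choosing a representative of the argument.  Every map
  below that is written in this way sends representatives of the same class to the same class
  (under the axioms for the structures concerned), so the choice is immaterial.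
\<close>

definition rep :: "'a set \<Rightarrow> 'a" where
  "rep X = (SOME x. x \<in> X)"

text \<open>
  \<open>tensor_rel N ra la\<close> is the subgroup of relations of a tensor product over a (not necessarily
  commutative) ring with elements in \<^typ>\<open>'r\<close>: the right module is the group \<^typ>\<open>'a\<close> modulo its
  subgroup \<open>N\<close>, with right action \<open>ra\<close>, and the left module is \<^typ>\<open>'b\<close> with left action \<open>la\<close>.
  The tensor product itself is \<open>quot (tensor_rel N ra la)\<close>, and \<open>a \<otimes> b\<close> is the coset
  of \<open>frag_of (a, b)\<close>.
\<close>

definition tensor_rel ::
  "'a::ab_group_add set \<Rightarrow> ('a \<Rightarrow> 'r \<Rightarrow> 'a) \<Rightarrow> ('r \<Rightarrow> 'b::ab_group_add \<Rightarrow> 'b) \<Rightarrow> ('a \<times> 'b \<Rightarrow>\<^sub>0 int) set"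
where
  "tensor_rel N ra la = gen_subgroup
     ({frag_of (a + a', b) - frag_of (a, b) - frag_of (a', b) | a a' b. True}
    \<union> {frag_of (a, b + b') - frag_of (a, b) - frag_of (a, b') | a b b'. True}
    \<union> {frag_of (ra a r, b) - frag_of (a, la r b) | a r b. True}
    \<union> {frag_of (a, b) | a b. a \<in> N})"

definition tmap :: "('a \<Rightarrow> 'c) \<Rightarrow> ('b \<Rightarrow> 'd) \<Rightarrow> ('a \<times> 'b \<Rightarrow>\<^sub>0 int) \<Rightarrow> ('c \<times> 'd \<Rightarrow>\<^sub>0 int)" where
  "tmap \<phi> \<psi> = frag_extend (\<lambda>(a, b). frag_of (\<phi> a, \<psi> b))"


section \<open>Cocommutative Hopf algebras\<close>

text \<open>
  The base field is the type \<^typ>\<open>'k\<close>, and the additive group of the Hopf algebra is the type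
  \<^typ>\<open>'h\<close>; the remaining operations are explicit, since the multiplication of a smash product
  depends on the group action.  The value \<open>comul H h\<close> is an element of \<open>H \<otimes> H\<close>, i.e. a coset.
\<close>

record ('k, 'h) hopf_data =
  smul :: "'k \<Rightarrow> 'h \<Rightarrow> 'h"
  hmul :: "'h \<Rightarrow> 'h \<Rightarrow> 'h"
  hone :: "'h"
  comul :: "'h \<Rightarrow> ('h \<times> 'h \<Rightarrow>\<^sub>0 int) set"
  counit :: "'h \<Rightarrow> 'k"
  antip :: "'h \<Rightarrow> 'h"

definition T2 :: "('k::field, 'h::ab_group_add) hopf_data \<Rightarrow> ('h \<times> 'h \<Rightarrow>\<^sub>0 int) set" where
  "T2 H = tensor_rel {0} (\<lambda>a c. smul H c a) (smul H)"

definition T3 :: "('k::field, 'h::ab_group_add) hopf_data \<Rightarrow> ('h \<times> 'h \<times> 'h \<Rightarrow>\<^sub>0 int) set" where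
  "T3 H = gen_subgroup
     ({frag_of (a + a', b, d) - frag_of (a, b, d) - frag_of (a', b, d) | a a' b d. True}
    \<union> {frag_of (a, b + b', d) - frag_of (a, b, d) - frag_of (a, b', d) | a b b' d. True}
    \<union> {frag_of (a, b, d + d') - frag_of (a, b, d) - frag_of (a, b, d') | a b d d'. True}
    \<union> {frag_of (smul H c a, b, d) - frag_of (a, smul H c b, d) | c a b d. True}
    \<union> {frag_of (a, smul H c b, d) - frag_of (a, b, smul H c d) | c a b d. True})"

definition cop :: "('k, 'h) hopf_data \<Rightarrow> 'h \<Rightarrow> ('h \<times> 'h \<Rightarrow>\<^sub>0 int)" where
  "cop H h = rep (comul H h)"

definition tmul2 ::
  "('k, 'h) hopf_data \<Rightarrow> ('h \<times> 'h \<Rightarrow>\<^sub>0 int) \<Rightarrow> ('h \<times> 'h \<Rightarrow>\<^sub>0 int) \<Rightarrow> ('h \<times> 'h \<Rightarrow>\<^sub>0 int)"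
where
  "tmul2 H x y =
     frag_extend (\<lambda>(a, b). frag_extend (\<lambda>(a', b'). frag_of (hmul H a a', hmul H b b')) y) x"

definition tmul3 ::
  "('k, 'h) hopf_data \<Rightarrow> ('h \<times> 'h \<times> 'h \<Rightarrow>\<^sub>0 int) \<Rightarrow> ('h \<times> 'h \<times> 'h \<Rightarrow>\<^sub>0 int) \<Rightarrow> ('h \<times> 'h \<times> 'h \<Rightarrow>\<^sub>0 int)"
where
  "tmul3 H x y =
     frag_extend (\<lambda>(a, b, d).
       frag_extend (\<lambda>(a', b', d'). frag_of (hmul H a a', hmul H b b', hmul H d d')) y) x"

definition cop_id :: "('k, 'h) hopf_data \<Rightarrow> ('h \<times> 'h \<Rightarrow>\<^sub>0 int) \<Rightarrow> ('h \<times> 'h \<times> 'h \<Rightarrow>\<^sub>0 int)" where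
  "cop_id H = frag_extend (\<lambda>(f, g). frag_extend (\<lambda>(f1, f2). frag_of (f1, f2, g)) (cop H f))"

definition id_cop :: "('k, 'h) hopf_data \<Rightarrow> ('h \<times> 'h \<Rightarrow>\<^sub>0 int) \<Rightarrow> ('h \<times> 'h \<times> 'h \<Rightarrow>\<^sub>0 int)" where
  "id_cop H = frag_extend (\<lambda>(f, g). frag_extend (\<lambda>(g1, g2). frag_of (f, g1, g2)) (cop H g))"

definition swap2 :: "('a \<times> 'a \<Rightarrow>\<^sub>0 int) \<Rightarrow> ('a \<times> 'a \<Rightarrow>\<^sub>0 int)" where
  "swap2 = frag_extend (\<lambda>(a, b). frag_of (b, a))"

definition swap12 :: "('a \<times> 'a \<times> 'a \<Rightarrow>\<^sub>0 int) \<Rightarrow> ('a \<times> 'a \<times> 'a \<Rightarrow>\<^sub>0 int)" where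
  "swap12 = frag_extend (\<lambda>(a, b, c). frag_of (b, a, c))"

text \<open>The linear map \<open>H \<otimes> H \<rightarrow> H\<close> induced by a bilinear map \<open>\<phi>\<close>.\<close>

definition tensor_eval ::
  "('k::field, 'h::ab_group_add) hopf_data \<Rightarrow> ('h \<Rightarrow> 'h \<Rightarrow> 'h) \<Rightarrow> ('h \<times> 'h \<Rightarrow>\<^sub>0 int) \<Rightarrow> 'h"
where
  "tensor_eval H \<phi> x =
     (\<Sum>(a, b)\<in>Poly_Mapping.keys x. smul H (of_int (Poly_Mapping.lookup x (a, b))) (\<phi> a b))"

locale cocommutative_hopf_algebra =
  fixes H :: "('k::field, 'h::ab_group_add) hopf_data"
  assumes vector_space: "vector_space (smul H)"
    and mul_add_left: "hmul H (a + b) c = hmul H a c + hmul H b c"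
    and mul_add_right: "hmul H a (b + c) = hmul H a b + hmul H a c"
    and mul_smul_left: "hmul H (smul H t a) b = smul H t (hmul H a b)"
    and mul_smul_right: "hmul H a (smul H t b) = smul H t (hmul H a b)"
    and mul_assoc: "hmul H (hmul H a b) c = hmul H a (hmul H b c)"
    and mul_one_left: "hmul H (hone H) a = a"
    and mul_one_right: "hmul H a (hone H) = a"
    and comul_in: "comul H a \<in> quot (T2 H)"
    and comul_add: "comul H (a + b) = coset (T2 H) (cop H a + cop H b)"
    and comul_smul: "comul H (smul H t a) = coset (T2 H) (tmap (smul H t) id (cop H a))"
    and counit_linear: "Vector_Spaces.linear (smul H) (*) (counit H)"
    and coassoc: "coset (T3 H) (cop_id H (cop H a)) = coset (T3 H) (id_cop H (cop H a))"
    and counit_left: "tensor_eval H (\<lambda>b c. smul H (counit H b) c) (cop H a) = a"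
    and counit_right: "tensor_eval H (\<lambda>b c. smul H (counit H c) b) (cop H a) = a"
    and comul_mul: "comul H (hmul H a b) = coset (T2 H) (tmul2 H (cop H a) (cop H b))"
    and comul_one: "comul H (hone H) = coset (T2 H) (frag_of (hone H, hone H))"
    and counit_mul: "counit H (hmul H a b) = counit H a * counit H b"
    and counit_one: "counit H (hone H) = 1"
    and antip_linear: "Vector_Spaces.linear (smul H) (smul H) (antip H)"
    and antip_left:
      "tensor_eval H (\<lambda>b c. hmul H (antip H b) c) (cop H a) = smul H (counit H a) (hone H)"
    and antip_right:
      "tensor_eval H (\<lambda>b c. hmul H b (antip H c)) (cop H a) = smul H (counit H a) (hone H)"
    and cocomm: "comul H a = coset (T2 H) (swap2 (cop H a))"


section \<open>Group actions and smash products\<close>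

text \<open>
  The group \<open>\<Gamma>\<close> is a type of class \<^class>\<open>group_add\<close>, which is not assumed commutative: the product
  of \<open>g\<close> and \<open>h\<close> is written \<open>g + h\<close>, the inverse of \<open>g\<close> is \<open>- g\<close> and the identity is \<open>0\<close>.
\<close>

locale hopf_action =
  fixes H :: "('k::field, 'h::ab_group_add) hopf_data"
    and \<alpha> :: "'g::group_add \<Rightarrow> 'h \<Rightarrow> 'h"
  assumes act_zero: "\<alpha> 0 f = f"
    and act_plus: "\<alpha> (g + h) f = \<alpha> g (\<alpha> h f)"
    and act_linear: "Vector_Spaces.linear (smul H) (smul H) (\<alpha> g)"
    and act_mul: "\<alpha> g (hmul H f f') = hmul H (\<alpha> g f) (\<alpha> g f')"
    and act_one: "\<alpha> g (hone H) = hone H"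
    and act_comul: "comul H (\<alpha> g f) = coset (T2 H) (tmap (\<alpha> g) (\<alpha> g) (cop H f))"
    and act_counit: "counit H (\<alpha> g f) = counit H f"
    and act_antip: "antip H (\<alpha> g f) = \<alpha> g (antip H f)"

text \<open>
  \<open>H \<otimes> \<k>[\<Gamma>]\<close> is the direct sum of copies of \<open>H\<close> indexed by \<open>\<Gamma>\<close>: \<open>f \<otimes> g\<close> (written \<open>f g\<close> in the
  smash product) is \<open>Poly_Mapping.single g f\<close>.  The relation \<open>g f g\<inverse> = g \<cdot> f\<close> gives
  \<open>(f g) (f' g') = f (g \<cdot> f') g g'\<close> and \<open>S (f g) = g\<inverse> S f = (g\<inverse> \<cdot> S f) g\<inverse>\<close>.
\<close>

definition smash ::
  "('k::field, 'h::ab_group_add) hopf_data \<Rightarrow> ('g::group_add \<Rightarrow> 'h \<Rightarrow> 'h) \<Rightarrow> ('k, 'g \<Rightarrow>\<^sub>0 'h) hopf_data"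
where
  "smash H \<alpha> =
     (let S = (\<lambda>t x. Poly_Mapping.map (smul H t) x) in
      \<lparr> smul = S,
        hmul = (\<lambda>x y. \<Sum>g\<in>Poly_Mapping.keys x. \<Sum>h\<in>Poly_Mapping.keys y.
          Poly_Mapping.single (g + h)
            (hmul H (Poly_Mapping.lookup x g) (\<alpha> g (Poly_Mapping.lookup y h)))),
        hone = Poly_Mapping.single 0 (hone H),
        comul = (\<lambda>x. coset (tensor_rel {0} (\<lambda>a t. S t a) S)
          (\<Sum>g\<in>Poly_Mapping.keys x.
            tmap (Poly_Mapping.single g) (Poly_Mapping.single g)
              (cop H (Poly_Mapping.lookup x g)))),
        counit = (\<lambda>x. \<Sum>g\<in>Poly_Mapping.keys x. counit H (Poly_Mapping.lookup x g)),
        antip = (\<lambda>x. \<Sum>g\<in>Poly_Mapping.keys x.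
          Poly_Mapping.single (- g) (\<alpha> (- g) (antip H (Poly_Mapping.lookup x g)))) \<rparr>)"


section \<open>Modules, pseudoproducts and their compositions\<close>

locale left_module =
  fixes H :: "('k::field, 'h::ab_group_add) hopf_data"
    and act :: "'h \<Rightarrow> 'l::ab_group_add \<Rightarrow> 'l"
  assumes act_add_left: "act (f + f') l = act f l + act f' l"
    and act_add_right: "act f (l + l') = act f l + act f l'"
    and act_mul: "act (hmul H f f') l = act f (act f' l)"
    and act_one: "act (hone H) l = l"

text \<open>The relations of \<open>(H \<otimes> H) \<otimes>\<^sub>H L\<close> and of \<open>(H \<otimes> H \<otimes> H) \<otimes>\<^sub>H L\<close>.\<close>

definition P2 :: "('k::field, 'h::ab_group_add) hopf_data \<Rightarrow> ('h \<Rightarrow> 'l::ab_group_add \<Rightarrow> 'l)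
    \<Rightarrow> (('h \<times> 'h \<Rightarrow>\<^sub>0 int) \<times> 'l \<Rightarrow>\<^sub>0 int) set" where
  "P2 H act = tensor_rel (T2 H) (\<lambda>x h. tmul2 H x (cop H h)) act"

definition P3 :: "('k::field, 'h::ab_group_add) hopf_data \<Rightarrow> ('h \<Rightarrow> 'l::ab_group_add \<Rightarrow> 'l)
    \<Rightarrow> (('h \<times> 'h \<times> 'h \<Rightarrow>\<^sub>0 int) \<times> 'l \<Rightarrow>\<^sub>0 int) set" where
  "P3 H act = tensor_rel (T3 H) (\<lambda>x h. tmul3 H x (cop_id H (cop H h))) act"

type_synonym ('h, 'l) frag2 = "('h \<times> 'h \<Rightarrow>\<^sub>0 int) \<times> 'l \<Rightarrow>\<^sub>0 int"
type_synonym ('h, 'l) frag3 = "('h \<times> 'h \<times> 'h \<Rightarrow>\<^sub>0 int) \<times> 'l \<Rightarrow>\<^sub>0 int"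

text \<open>
  A pseudoproduct \<open>L \<otimes> M \<rightarrow> (H \<otimes> H) \<otimes>\<^sub>H M\<close>; linearity over the base field is the case
  of scalar multiples of \<open>1\<close> in \<open>bilin\<close>.  Pseudoalgebras are the case \<open>M = L\<close>.
\<close>

locale pseudoproduct =
  fixes H :: "('k::field, 'h::ab_group_add) hopf_data"
    and actL :: "'h \<Rightarrow> 'l::ab_group_add \<Rightarrow> 'l"
    and actM :: "'h \<Rightarrow> 'm::ab_group_add \<Rightarrow> 'm"
    and p :: "'l \<Rightarrow> 'm \<Rightarrow> ('h, 'm) frag2 set"
  assumes module_L: "left_module H actL"
    and module_M: "left_module H actM"
    and prod_in: "p a m \<in> quot (P2 H actM)"
    and prod_add_left: "p (a + a') m = coset (P2 H actM) (rep (p a m) + rep (p a' m))"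
    and prod_add_right: "p a (m + m') = coset (P2 H actM) (rep (p a m) + rep (p a m'))"
    and bilin: "p (actL f a) (actM g m) =
      coset (P2 H actM) (tmap (tmul2 H (frag_of (f, g))) id (rep (p a m)))"

text \<open>
  \<open>comp_left H X q\<close> represents \<open>(a * b) * c\<close> if \<open>X = a * b\<close> and \<open>q e = e * c\<close>;
  \<open>comp_right H q X\<close> represents \<open>a * (b * c)\<close> if \<open>q d = a * d\<close> and \<open>X = b * c\<close>.
\<close>

definition comp_left :: "('k, 'h) hopf_data \<Rightarrow> ('h, 'l) frag2 set \<Rightarrow> ('l \<Rightarrow> ('h, 'm) frag2 set)
    \<Rightarrow> ('h, 'm) frag3" where
  "comp_left H X q =
     frag_extend (\<lambda>(g, e). tmap
       (\<lambda>x. tmul3 H (frag_extend (\<lambda>(g1, g2). frag_of (g1, g2, hone H)) g) (cop_id H x)) id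
       (rep (q e))) (rep X)"

definition comp_right :: "('k, 'h) hopf_data \<Rightarrow> ('l \<Rightarrow> ('h, 'm) frag2 set) \<Rightarrow> ('h, 'l) frag2 set
    \<Rightarrow> ('h, 'm) frag3" where
  "comp_right H q X =
     frag_extend (\<lambda>(h, d). tmap
       (\<lambda>x. tmul3 H (frag_extend (\<lambda>(h1, h2). frag_of (hone H, h1, h2)) h) (id_cop H x)) id
       (rep (q d))) (rep X)"

definition jacobi_id :: "('k::field, 'h::ab_group_add) hopf_data \<Rightarrow> ('h \<Rightarrow> 'm::ab_group_add \<Rightarrow> 'm)
    \<Rightarrow> ('l \<Rightarrow> 'l \<Rightarrow> ('h, 'l) frag2 set) \<Rightarrow> ('l \<Rightarrow> 'm \<Rightarrow> ('h, 'm) frag2 set) \<Rightarrow> bool" where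
  "jacobi_id H actM br p \<longleftrightarrow> (\<forall>a b m.
     coset (P3 H actM)
       (comp_right H (p a) (p b m) - tmap swap12 id (comp_right H (p b) (p a m))) =
     coset (P3 H actM) (comp_left H (br a b) (\<lambda>e. p e m)))"

definition assoc_id :: "('k::field, 'h::ab_group_add) hopf_data \<Rightarrow> ('h \<Rightarrow> 'm::ab_group_add \<Rightarrow> 'm)
    \<Rightarrow> ('l \<Rightarrow> 'l \<Rightarrow> ('h, 'l) frag2 set) \<Rightarrow> ('l \<Rightarrow> 'm \<Rightarrow> ('h, 'm) frag2 set) \<Rightarrow> bool" where
  "assoc_id H actM pr p \<longleftrightarrow> (\<forall>a b m.
     coset (P3 H actM) (comp_right H (p a) (p b m)) =
     coset (P3 H actM) (comp_left H (pr a b) (\<lambda>e. p e m)))"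

definition lie_pseudoalgebra :: "('k::field, 'h::ab_group_add) hopf_data
    \<Rightarrow> ('h \<Rightarrow> 'l::ab_group_add \<Rightarrow> 'l) \<Rightarrow> ('l \<Rightarrow> 'l \<Rightarrow> ('h, 'l) frag2 set) \<Rightarrow> bool" where
  "lie_pseudoalgebra H act br \<longleftrightarrow>
     pseudoproduct H act act br \<and>
     (\<forall>a b. br b a = coset (P2 H act) (- tmap swap2 id (rep (br a b)))) \<and>
     jacobi_id H act br br"

definition assoc_pseudoalgebra :: "('k::field, 'h::ab_group_add) hopf_data
    \<Rightarrow> ('h \<Rightarrow> 'l::ab_group_add \<Rightarrow> 'l) \<Rightarrow> ('l \<Rightarrow> 'l \<Rightarrow> ('h, 'l) frag2 set) \<Rightarrow> bool" where
  "assoc_pseudoalgebra H act pr \<longleftrightarrow> pseudoproduct H act act pr \<and> assoc_id H act pr pr"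

definition lie_representation :: "('k::field, 'h::ab_group_add) hopf_data
    \<Rightarrow> ('h \<Rightarrow> 'l::ab_group_add \<Rightarrow> 'l) \<Rightarrow> ('l \<Rightarrow> 'l \<Rightarrow> ('h, 'l) frag2 set)
    \<Rightarrow> ('h \<Rightarrow> 'm::ab_group_add \<Rightarrow> 'm) \<Rightarrow> ('l \<Rightarrow> 'm \<Rightarrow> ('h, 'm) frag2 set) \<Rightarrow> bool" where
  "lie_representation H actL br actM p \<longleftrightarrow>
     lie_pseudoalgebra H actL br \<and> pseudoproduct H actL actM p \<and> jacobi_id H actM br p"

definition assoc_representation :: "('k::field, 'h::ab_group_add) hopf_data
    \<Rightarrow> ('h \<Rightarrow> 'l::ab_group_add \<Rightarrow> 'l) \<Rightarrow> ('l \<Rightarrow> 'l \<Rightarrow> ('h, 'l) frag2 set)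
    \<Rightarrow> ('h \<Rightarrow> 'm::ab_group_add \<Rightarrow> 'm) \<Rightarrow> ('l \<Rightarrow> 'm \<Rightarrow> ('h, 'm) frag2 set) \<Rightarrow> bool" where
  "assoc_representation H actL pr actM p \<longleftrightarrow>
     assoc_pseudoalgebra H actL pr \<and> pseudoproduct H actL actM p \<and> assoc_id H actM pr p"


section \<open>From \<open>H\<close>-pseudoproducts to pseudoproducts over the smash product\<close>

definition act_H :: "(('g::group_add \<Rightarrow>\<^sub>0 'h::ab_group_add) \<Rightarrow> 'l \<Rightarrow> 'l) \<Rightarrow> 'h \<Rightarrow> 'l \<Rightarrow> 'l" where
  "act_H act f = act (Poly_Mapping.single 0 f)"

definition act_G :: "('k, 'h::ab_group_add) hopf_data
    \<Rightarrow> (('g::group_add \<Rightarrow>\<^sub>0 'h) \<Rightarrow> 'l \<Rightarrow> 'l) \<Rightarrow> 'g \<Rightarrow> 'l \<Rightarrow> 'l" where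
  "act_G H act g = act (Poly_Mapping.single g (hone H))"

definition G_equivariant :: "('k::field, 'h::ab_group_add) hopf_data
    \<Rightarrow> ('g::group_add \<Rightarrow> 'h \<Rightarrow> 'h)
    \<Rightarrow> (('g \<Rightarrow>\<^sub>0 'h) \<Rightarrow> 'l::ab_group_add \<Rightarrow> 'l) \<Rightarrow> (('g \<Rightarrow>\<^sub>0 'h) \<Rightarrow> 'm::ab_group_add \<Rightarrow> 'm)
    \<Rightarrow> ('l \<Rightarrow> 'm \<Rightarrow> ('h, 'm) frag2 set) \<Rightarrow> bool" where
  "G_equivariant H \<alpha> actL actM p \<longleftrightarrow> (\<forall>g a m.
     p (act_G H actL g a) (act_G H actM g m) =
     coset (P2 H (act_H actM)) (tmap (tmap (\<alpha> g) (\<alpha> g)) (act_G H actM g) (rep (p a m))))"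

definition G_support :: "('k::field, 'h::ab_group_add) hopf_data
    \<Rightarrow> (('g::group_add \<Rightarrow>\<^sub>0 'h) \<Rightarrow> 'l::ab_group_add \<Rightarrow> 'l)
    \<Rightarrow> (('g \<Rightarrow>\<^sub>0 'h) \<Rightarrow> 'm::ab_group_add \<Rightarrow> 'm)
    \<Rightarrow> ('l \<Rightarrow> 'm \<Rightarrow> ('h, 'm) frag2 set) \<Rightarrow> 'l \<Rightarrow> 'm \<Rightarrow> 'g set" where
  "G_support H actL actM p a m = {g. p (act_G H actL g a) m \<noteq> coset (P2 H (act_H actM)) 0}"

definition G_finite :: "('k::field, 'h::ab_group_add) hopf_data
    \<Rightarrow> (('g::group_add \<Rightarrow>\<^sub>0 'h) \<Rightarrow> 'l::ab_group_add \<Rightarrow> 'l)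
    \<Rightarrow> (('g \<Rightarrow>\<^sub>0 'h) \<Rightarrow> 'm::ab_group_add \<Rightarrow> 'm)
    \<Rightarrow> ('l \<Rightarrow> 'm \<Rightarrow> ('h, 'm) frag2 set) \<Rightarrow> bool" where
  "G_finite H actL actM p \<longleftrightarrow> (\<forall>a m. finite (G_support H actL actM p a m))"

text \<open>
  The natural map \<open>(H \<otimes> H) \<otimes>\<^sub>H M \<rightarrow> (K \<otimes> K) \<otimes>\<^sub>K M\<close>, where \<open>K\<close> is the smash product.
\<close>

definition nat_map :: "('h::ab_group_add, 'm) frag2 \<Rightarrow> ('g::group_add \<Rightarrow>\<^sub>0 'h, 'm) frag2" where
  "nat_map = tmap (tmap (Poly_Mapping.single 0) (Poly_Mapping.single 0)) id"

text \<open>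
  The sum over \<open>\<Gamma>\<close> runs over the terms with \<open>[g a * m] \<noteq> 0\<close>.
\<close>

definition smash_prod :: "('k::field, 'h::ab_group_add) hopf_data
    \<Rightarrow> ('g::group_add \<Rightarrow> 'h \<Rightarrow> 'h)
    \<Rightarrow> (('g \<Rightarrow>\<^sub>0 'h) \<Rightarrow> 'l::ab_group_add \<Rightarrow> 'l) \<Rightarrow> (('g \<Rightarrow>\<^sub>0 'h) \<Rightarrow> 'm::ab_group_add \<Rightarrow> 'm)
    \<Rightarrow> ('l \<Rightarrow> 'm \<Rightarrow> ('h, 'm) frag2 set) \<Rightarrow> 'l \<Rightarrow> 'm \<Rightarrow> ('g \<Rightarrow>\<^sub>0 'h, 'm) frag2 set" where
  "smash_prod H \<alpha> actL actM p a m =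
     coset (P2 (smash H \<alpha>) actM)
       (\<Sum>g\<in>G_support H actL actM p a m.
         tmap (tmul2 (smash H \<alpha>)
             (frag_of (Poly_Mapping.single (- g) (hone H), Poly_Mapping.single 0 (hone H)))) id
           (nat_map (rep (p (act_G H actL g a) m))))"

end

theory Submission
  imports Defs
begin

text \<open>
  Write \<open>K\<close> for the smash product; in the comments the group \<open>\<Gamma>\<close> is written multiplicatively,
  with identity \<open>1\<close>.  Since \<open>f g \<otimes> f' h = (f g h\<inverse> \<otimes> f') \<Delta>(h)\<close> for \<open>f, f' \<in> H\<close> and
  \<open>g, h \<in> \<Gamma>\<close>, every element of \<open>(K \<otimes> K) \<otimes>\<^sub>K M\<close> is a sum of elements
  \<open>(f \<gamma> \<otimes> f') \<otimes> m\<close>, and the degree \<open>\<gamma> = g h\<inverse>\<close> does not change under the relations.  Therefore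
  \<open>(K \<otimes> K) \<otimes>\<^sub>K M\<close> is a direct sum, over \<open>\<gamma> \<in> \<Gamma>\<close>, of copies of \<open>(H \<otimes> H) \<otimes>\<^sub>H M\<close>: the inclusions
  are \<open>iota2 \<gamma>\<close>, which is left multiplication by \<open>\<gamma> \<otimes> 1\<close>, and the projections are \<open>pi2 \<gamma>\<close>.
  In the same way \<open>(K \<otimes> K \<otimes> K) \<otimes>\<^sub>K M\<close> is a direct sum of copies of \<open>(H \<otimes> H \<otimes> H) \<otimes>\<^sub>H M\<close> indexed
  by two degrees, with projections \<open>pi3 \<gamma> \<delta>\<close>.  An identity over \<open>K\<close> thus holds if and only if
  all its components hold over \<open>H\<close> (\<open>pi2_eqv_iff\<close>, \<open>pi3_eqv_iff\<close>).

  The formula for the product \<open>p'\<close> over \<open>K\<close> says exactly that the component of \<open>p'(a, m)\<close> of degree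
  \<open>\<gamma>\<close> is \<open>p(\<gamma>\<inverse> a, m)\<close> (\<open>corresponding\<close>).  Only finitely many components of an element are nonzero,
  which is the finiteness condition; and bilinearity of \<open>p'\<close> over \<open>K\<close> amounts to bilinearity of \<open>p\<close>
  over \<open>H\<close> together with equivariance, because of the rule \<open>pi2_left_mult\<close> for the components of a
  multiple.  So the component of degree \<open>1\<close> is inverse to the construction
  (\<open>bij_betw_pseudoproducts\<close>).

  The axioms are then compared one component at a time.  The component of degree \<open>(\<gamma>, \<delta>)\<close> of
  \<open>a * (b * m)\<close> is \<open>(\<gamma>\<inverse> a) * ((\<delta>\<inverse> b) * m)\<close> formed over \<open>H\<close>, and that of \<open>(a * b) * m\<close> is
  \<open>((\<gamma>\<inverse> a) * (\<delta>\<inverse> b)) * m\<close> (\<open>pi3_comp_right\<close>, \<open>pi3_comp_left\<close>); the flip of the first two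
  factors exchanges \<open>\<gamma>\<close> and \<open>\<delta>\<close>.  Hence the associativity or Jacobi identity for \<open>a, b, m\<close> over \<open>K\<close> is
  the collection of the same identities over \<open>H\<close> for all translates \<open>\<gamma>\<inverse> a, \<delta>\<inverse> b, m\<close>, and the
  two are equivalent when all arguments are allowed.  Skew-symmetry is similar (\<open>skew_iff\<close>).

  All groups here are quotients of groups of formal sums, and \<open>rep\<close> picks representatives without
  being additive.  The computations therefore take place on formal sums, modulo the subgroups of
  relations, and well-definedness of a map on a tensor product is the universal property in
  \<open>hom_mod_P2\<close> and \<open>hom_mod_P3\<close>.
\<close>

section \<open>Congruence modulo a subgroup\<close>

text \<open>
  Congruence is taken modulo the subgroup generated by \<open>N\<close>, so that it is an equivalence relation
  compatible with addition for every set \<open>N\<close>.  For the relation subgroups \<open>T2\<close>, \<open>T3\<close>, \<open>P2\<close>,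
  \<open>P3\<close> it is equality of cosets.
\<close>

definition eqv :: "'a::ab_group_add \<Rightarrow> 'a set \<Rightarrow> 'a \<Rightarrow> bool"
    ("(_/ \<simeq>[_] _)" [51, 0, 51] 50) where
  "x \<simeq>[N] y \<longleftrightarrow> x - y \<in> gen_subgroup N"

lemma gen_subgroup_minus: "x \<in> gen_subgroup N \<Longrightarrow> - x \<in> gen_subgroup N"
  using gen_subgroup.diff[OF gen_subgroup.zero] by fastforce

lemma gen_subgroup_add: "x \<in> gen_subgroup N \<Longrightarrow> y \<in> gen_subgroup N \<Longrightarrow> x + y \<in> gen_subgroup N"
  using gen_subgroup.diff[OF _ gen_subgroup_minus] by fastforce

lemma gen_subgroup_idem [simp]: "gen_subgroup (gen_subgroup N) = gen_subgroup N"
proof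
  show "gen_subgroup (gen_subgroup N) \<subseteq> gen_subgroup N"
  proof
    fix x assume "x \<in> gen_subgroup (gen_subgroup N)"
    then show "x \<in> gen_subgroup N"
      by induction (auto intro: gen_subgroup.intros)
  qed
qed (auto intro: gen_subgroup.gen)

lemma eqv_refl [simp, intro]: "x \<simeq>[N] x"
  by (simp add: eqv_def gen_subgroup.zero)

lemma eqv_sym: "x \<simeq>[N] y \<Longrightarrow> y \<simeq>[N] x"
  unfolding eqv_def using gen_subgroup_minus by fastforce

lemma eqv_trans [trans]: "x \<simeq>[N] y \<Longrightarrow> y \<simeq>[N] z \<Longrightarrow> x \<simeq>[N] z"
  unfolding eqv_def using gen_subgroup_add by fastforce

lemma eqv_add: "x \<simeq>[N] y \<Longrightarrow> x' \<simeq>[N] y' \<Longrightarrow> x + x' \<simeq>[N] y + y'"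
  unfolding eqv_def using gen_subgroup_add[of "x - y" N "x' - y'"] by (simp add: algebra_simps)

lemma eqv_minus: "x \<simeq>[N] y \<Longrightarrow> - x \<simeq>[N] - y"
  unfolding eqv_def using gen_subgroup_minus[of "x - y" N] by (simp add: algebra_simps)

lemma eqv_diff: "x \<simeq>[N] y \<Longrightarrow> x' \<simeq>[N] y' \<Longrightarrow> x - x' \<simeq>[N] y - y'"
  using eqv_add[OF _ eqv_minus] by fastforce

lemma eqv_sum: "(\<And>i. i \<in> S \<Longrightarrow> f i \<simeq>[N] g i) \<Longrightarrow> sum f S \<simeq>[N] sum g S"
  by (induction S rule: infinite_finite_induct) (auto intro: eqv_add)

lemma eqv_diff_zero: "x \<simeq>[N] y \<longleftrightarrow> x - y \<simeq>[N] 0"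
  by (simp add: eqv_def)

lemma eqv_self_add: "x \<simeq>[N] x + x \<Longrightarrow> x \<simeq>[N] 0"
  unfolding eqv_def using gen_subgroup_minus[of "x - (x + x)" N] by simp

lemma coset_eq_iff:
  assumes N: "gen_subgroup N = N"
  shows "coset N x = coset N y \<longleftrightarrow> x \<simeq>[N] y"
proof
  assume "coset N x = coset N y"
  moreover have "x \<in> coset N x"
    using gen_subgroup.zero[of N] unfolding N by (simp add: coset_def)
  ultimately have "x - y \<in> N"
    unfolding coset_def by blast
  then show "x \<simeq>[N] y"
    unfolding eqv_def N .
next
  assume xy: "x \<simeq>[N] y"
  have coset: "coset N z = {w. w \<simeq>[N] z}" for z
    unfolding coset_def eqv_def N ..
  show "coset N x = coset N y"
    unfolding coset using eqv_trans[OF _ xy] eqv_trans[OF _ eqv_sym[OF xy]] by blast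
qed

lemma rep_coset: "gen_subgroup N = N \<Longrightarrow> rep (coset N x) \<simeq>[N] x"
proof -
  assume N: "gen_subgroup N = N"
  have "x \<in> coset N x"
    using gen_subgroup.zero[of N] by (simp add: coset_def N)
  then have "rep (coset N x) \<in> coset N x"
    unfolding rep_def by (rule someI)
  then show ?thesis
    by (simp add: coset_def eqv_def N)
qed

lemma coset_rep: "gen_subgroup N = N \<Longrightarrow> X \<in> quot N \<Longrightarrow> coset N (rep X) = X"
  by (metis coset_eq_iff imageE quot_def rep_coset)

lemma coset_in_quot [simp]: "coset N x \<in> quot N"
  by (simp add: quot_def)

lemma gen_subgroup_tensor_rel [simp]: "gen_subgroup (tensor_rel N ra la) = tensor_rel N ra la"
  by (simp add: tensor_rel_def)

lemma gen_subgroup_T2 [simp]: "gen_subgroup (T2 H) = T2 H"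
  by (simp add: T2_def)

lemma gen_subgroup_T3 [simp]: "gen_subgroup (T3 H) = T3 H"
  by (simp add: T3_def)

lemma gen_subgroup_P2 [simp]: "gen_subgroup (P2 H act) = P2 H act"
  by (simp add: P2_def)

lemma gen_subgroup_P3 [simp]: "gen_subgroup (P3 H act) = P3 H act"
  by (simp add: P3_def)

lemma gen_subgroup_zero [simp]: "gen_subgroup {0} = {0}"
proof
  show "gen_subgroup {0} \<subseteq> {0}"
  proof
    fix x assume "x \<in> gen_subgroup {0}" then show "x \<in> {0}"
      by induction auto
  qed
qed (auto intro: gen_subgroup.zero)

lemma eqv_zero_eq [simp]: "x \<simeq>[{0}] y \<longleftrightarrow> x = y"
  by (simp add: eqv_def)

subsection \<open>Homomorphisms and maps that are additive modulo a subgroup\<close>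

text \<open>
  A homomorphism between quotients, given by a map of representatives that is additive on the nose.
\<close>

definition hom_mod :: "'a::ab_group_add set \<Rightarrow> 'b::ab_group_add set \<Rightarrow> ('a \<Rightarrow> 'b) \<Rightarrow> bool" where
  "hom_mod N N' F \<longleftrightarrow> additive F \<and> (\<forall>x\<in>N. F x \<simeq>[N'] 0)"

lemma hom_mod_additive: "hom_mod N N' F \<Longrightarrow> additive F"
  by (simp add: hom_mod_def)

lemma hom_mod_gen: "additive F \<Longrightarrow> (\<And>x. x \<in> S \<Longrightarrow> F x \<simeq>[N'] 0) \<Longrightarrow> hom_mod (gen_subgroup S) N' F"
proof -
  assume F: "additive F" and S: "\<And>x. x \<in> S \<Longrightarrow> F x \<simeq>[N'] 0"
  have "F x \<simeq>[N'] 0" if "x \<in> gen_subgroup S" for x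
    using that
  proof induction
    case (diff x y)
    then show ?case using eqv_diff[of "F x" N' 0 "F y" 0] by (simp add: additive.diff[OF F])
  qed (auto simp: S additive.zero[OF F])
  then show ?thesis using F by (simp add: hom_mod_def)
qed

lemma hom_modD: "hom_mod N N' F \<Longrightarrow> x \<simeq>[N] y \<Longrightarrow> F x \<simeq>[N'] F y"
proof -
  assume F: "hom_mod N N' F" and xy: "x \<simeq>[N] y"
  have "hom_mod (gen_subgroup N) N' F"
    using F by (intro hom_mod_gen) (auto simp: hom_mod_def)
  then have "F (x - y) \<simeq>[N'] 0"
    using xy by (simp add: hom_mod_def eqv_def)
  then show ?thesis
    using F by (simp add: additive.diff hom_mod_def eqv_def)
qed

lemma hom_mod_comp: "hom_mod N N' F \<Longrightarrow> hom_mod N' N'' G \<Longrightarrow> hom_mod N N'' (\<lambda>x. G (F x))"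
proof -
  assume F: "hom_mod N N' F" and G: "hom_mod N' N'' G"
  have "G (F x) \<simeq>[N''] 0" if "x \<in> N" for x
    using hom_modD[OF G, of "F x" 0] F that by (simp add: hom_mod_def G[THEN hom_mod_additive, THEN additive.zero])
  then show ?thesis
    using F G by (simp add: hom_mod_def additive_def)
qed

text \<open>
  The weaker notion, additivity only up to the relations, is the one satisfied by maps into a
  group of formal sums such as \<open>a \<mapsto> frag_of (a, b)\<close>.
\<close>

definition additive_mod :: "'b::ab_group_add set \<Rightarrow> ('a::ab_group_add \<Rightarrow> 'b) \<Rightarrow> bool" where
  "additive_mod N f \<longleftrightarrow> (\<forall>x y. f (x + y) \<simeq>[N] f x + f y)"

lemma additive_mod_add: "additive_mod N f \<Longrightarrow> f (x + y) \<simeq>[N] f x + f y"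
  by (simp add: additive_mod_def)

lemma additive_mod_zero: "additive_mod N f \<Longrightarrow> f 0 \<simeq>[N] 0"
  unfolding additive_mod_def by (metis add_0 eqv_self_add)

lemma additive_mod_minus: "additive_mod N f \<Longrightarrow> f (- x) \<simeq>[N] - f x"
proof -
  assume f: "additive_mod N f"
  have "f (- x) + f x \<simeq>[N] f (- x + x)"
    using f by (blast intro: additive_mod_add eqv_sym)
  also have "f (- x + x) \<simeq>[N] 0"
    using additive_mod_zero[OF f] by simp
  finally show ?thesis by (simp add: eqv_def)
qed

lemma additive_mod_diff: "additive_mod N f \<Longrightarrow> f (x - y) \<simeq>[N] f x - f y"
  using eqv_trans[OF additive_mod_add[of N f x "- y"] eqv_add[OF eqv_refl additive_mod_minus[of N f y]]] by simp

lemma hom_mod_additive_mod: "hom_mod N N' F \<Longrightarrow> additive_mod N f \<Longrightarrow> additive_mod N' (\<lambda>x. F (f x))"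
  unfolding additive_mod_def using hom_modD by (metis additive.add hom_mod_def)

lemma additive_mod_additive: "additive_mod N f \<Longrightarrow> additive g \<Longrightarrow> additive_mod N (\<lambda>x. f (g x))"
  by (simp add: additive_mod_def additive.add)

lemma additive_mod_eqv: "additive_mod N f \<Longrightarrow> (\<And>x. f x \<simeq>[N] g x) \<Longrightarrow> additive_mod N g"
proof -
  assume f: "additive_mod N f" and e: "\<And>x. f x \<simeq>[N] g x"
  have "g (x + y) \<simeq>[N] g x + g y" for x y
    using eqv_trans[OF eqv_sym[OF e] eqv_trans[OF additive_mod_add[OF f] eqv_add[OF e e]]] .
  then show ?thesis by (simp add: additive_mod_def)
qed

section \<open>Formal sums of pairs and triples\<close>

definition ext2 :: "('a \<Rightarrow> 'b \<Rightarrow> ('x \<Rightarrow>\<^sub>0 int)) \<Rightarrow> ('a \<times> 'b \<Rightarrow>\<^sub>0 int) \<Rightarrow> ('x \<Rightarrow>\<^sub>0 int)" where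
  "ext2 f = frag_extend (\<lambda>(a, b). f a b)"

definition ext3 :: "('a \<Rightarrow> 'b \<Rightarrow> 'c \<Rightarrow> ('x \<Rightarrow>\<^sub>0 int)) \<Rightarrow> ('a \<times> 'b \<times> 'c \<Rightarrow>\<^sub>0 int) \<Rightarrow> ('x \<Rightarrow>\<^sub>0 int)" where
  "ext3 f = frag_extend (\<lambda>(a, b, c). f a b c)"

lemma frag_induct [case_names zero one diff]:
  assumes "P 0" "\<And>x. P (frag_of x)" "\<And>a b. P a \<Longrightarrow> P b \<Longrightarrow> P (a - b)"
  shows "P c"
  by (rule frag_induction[where S = UNIV]) (use assms in auto)

lemma additive_frag_extend: "additive (frag_extend f)"
  by (simp add: additive_def frag_extend_add)

lemma additive_ext2 [simp, intro]: "additive (ext2 f)"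
  by (simp add: ext2_def additive_frag_extend)

lemma additive_ext3 [simp, intro]: "additive (ext3 f)"
  by (simp add: ext3_def additive_frag_extend)

lemma ext2_simps [simp]:
  "ext2 f 0 = 0" "ext2 f (frag_of (a, b)) = f a b" "ext2 f (x + y) = ext2 f x + ext2 f y"
  "ext2 f (x - y) = ext2 f x - ext2 f y" "ext2 f (- x) = - ext2 f x"
  "ext2 f (sum g I) = (\<Sum>i\<in>I. ext2 f (g i))"
  by (simp_all add: ext2_def frag_extend_add frag_extend_diff frag_extend_minus
      additive.sum[OF additive_frag_extend])

lemma ext3_simps [simp]:
  "ext3 f 0 = 0" "ext3 f (frag_of (a, b, c)) = f a b c" "ext3 f (x + y) = ext3 f x + ext3 f y"
  "ext3 f (x - y) = ext3 f x - ext3 f y" "ext3 f (- x) = - ext3 f x"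
  "ext3 f (sum g I) = (\<Sum>i\<in>I. ext3 f (g i))"
  by (simp_all add: ext3_def frag_extend_add frag_extend_diff frag_extend_minus
      additive.sum[OF additive_frag_extend])

lemma additive_apply_ext2: "additive F \<Longrightarrow> F (ext2 f x) = ext2 (\<lambda>a b. F (f a b)) x"
  by (induction x rule: frag_induct) (auto simp: additive.zero additive.diff)

lemma additive_apply_ext3: "additive F \<Longrightarrow> F (ext3 f x) = ext3 (\<lambda>a b c. F (f a b c)) x"
  by (induction x rule: frag_induct) (auto simp: additive.zero additive.diff)

lemma ext2_cong: "(\<And>a b. f a b \<simeq>[N] g a b) \<Longrightarrow> ext2 f x \<simeq>[N] ext2 g x"
  by (induction x rule: frag_induct) (auto intro: eqv_diff)

lemma ext3_cong: "(\<And>a b c. f a b c \<simeq>[N] g a b c) \<Longrightarrow> ext3 f x \<simeq>[N] ext3 g x"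
  by (induction x rule: frag_induct) (auto intro: eqv_diff)

lemma ext2_plus: "ext2 (\<lambda>a b. f a b + g a b) x = ext2 f x + ext2 g x"
  by (induction x rule: frag_induct) auto

lemma ext3_plus: "ext3 (\<lambda>a b c. f a b c + g a b c) x = ext3 f x + ext3 g x"
  by (induction x rule: frag_induct) auto

lemma ext2_const_zero [simp]: "ext2 (\<lambda>a b. 0) x = 0"
  by (induction x rule: frag_induct) auto

lemma ext2_minus: "ext2 (\<lambda>a b. f a b - g a b) x = ext2 f x - ext2 g x"
  by (induction x rule: frag_induct) auto

lemma ext2_commute:
  "ext2 (\<lambda>a b. ext2 (f a b) y) x = ext2 (\<lambda>c d. ext2 (\<lambda>a b. f a b c d) x) y"
  by (induction x rule: frag_induct) (auto simp: ext2_minus)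

lemma additive_mod_ext2: "(\<And>a b. additive_mod N (\<lambda>x. f x a b)) \<Longrightarrow> additive_mod N (\<lambda>x. ext2 (f x) z)"
  unfolding additive_mod_def by (simp flip: ext2_plus add: ext2_cong)

lemma additive_mod_ext3: "(\<And>a b c. additive_mod N (\<lambda>x. f x a b c)) \<Longrightarrow> additive_mod N (\<lambda>x. ext3 (f x) z)"
  unfolding additive_mod_def by (simp flip: ext3_plus add: ext3_cong)

lemma tmap_ext2: "tmap \<phi> \<psi> = ext2 (\<lambda>a b. frag_of (\<phi> a, \<psi> b))"
  by (simp add: tmap_def ext2_def)

lemma tmul2_ext2:
  "tmul2 H x y = ext2 (\<lambda>a b. ext2 (\<lambda>a' b'. frag_of (hmul H a a', hmul H b b')) y) x"
  by (simp add: tmul2_def ext2_def)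

lemma tmul3_ext3:
  "tmul3 H x y = ext3 (\<lambda>a b c. ext3 (\<lambda>a' b' c'. frag_of (hmul H a a', hmul H b b', hmul H c c')) y) x"
  by (simp add: tmul3_def ext3_def)

lemma cop_id_ext2: "cop_id H = ext2 (\<lambda>f g. ext2 (\<lambda>f1 f2. frag_of (f1, f2, g)) (cop H f))"
  by (simp add: cop_id_def ext2_def)

lemma id_cop_ext2: "id_cop H = ext2 (\<lambda>f g. ext2 (\<lambda>g1 g2. frag_of (f, g1, g2)) (cop H g))"
  by (simp add: id_cop_def ext2_def)

lemma swap2_ext2: "swap2 = ext2 (\<lambda>a b. frag_of (b, a))"
  by (simp add: swap2_def ext2_def)

lemma swap12_ext3: "swap12 = ext3 (\<lambda>a b c. frag_of (b, a, c))"
  by (simp add: swap12_def ext3_def)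

lemma ext2_comps [simp]:
  "ext2 f (ext2 g x) = ext2 (\<lambda>a b. ext2 f (g a b)) x"
  "ext2 f (ext3 g' y) = ext3 (\<lambda>a b c. ext2 f (g' a b c)) y"
  "ext3 f' (ext2 g'' x) = ext2 (\<lambda>a b. ext3 f' (g'' a b)) x"
  "ext3 f' (ext3 g''' y) = ext3 (\<lambda>a b c. ext3 f' (g''' a b c)) y"
  by (simp_all add: additive_apply_ext2 additive_apply_ext3)

lemma ext2_tmap [simp]: "ext2 f (tmap \<phi> \<psi> x) = ext2 (\<lambda>a b. f (\<phi> a) (\<psi> b)) x"
  by (simp add: tmap_ext2)

lemma ext2_swap2 [simp]: "ext2 f (swap2 x) = ext2 (\<lambda>a b. f b a) x"
  by (simp add: swap2_ext2)

lemma ext3_cop_id [simp]: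
  "ext3 f (cop_id H x) = ext2 (\<lambda>h c. ext2 (\<lambda>a b. f a b c) (cop H h)) x"
  by (simp add: cop_id_ext2)

lemma ext3_id_cop [simp]:
  "ext3 f (id_cop H x) = ext2 (\<lambda>a h. ext2 (\<lambda>b c. f a b c) (cop H h)) x"
  by (simp add: id_cop_ext2)

subsection \<open>Balanced maps\<close>

definition biadd :: "'x::ab_group_add set \<Rightarrow> ('a::ab_group_add \<Rightarrow> 'b::ab_group_add \<Rightarrow> 'x) \<Rightarrow> bool" where
  "biadd N f \<longleftrightarrow> (\<forall>b. additive_mod N (\<lambda>a. f a b)) \<and> (\<forall>a. additive_mod N (\<lambda>b. f a b))"

definition triadd :: "'x::ab_group_add set
    \<Rightarrow> ('a::ab_group_add \<Rightarrow> 'b::ab_group_add \<Rightarrow> 'c::ab_group_add \<Rightarrow> 'x) \<Rightarrow> bool" where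
  "triadd N f \<longleftrightarrow> (\<forall>b c. additive_mod N (\<lambda>a. f a b c)) \<and> (\<forall>a c. additive_mod N (\<lambda>b. f a b c)) \<and>
     (\<forall>a b. additive_mod N (\<lambda>c. f a b c))"

text \<open>
  The maps \<open>H \<times> H \<rightarrow> X / N\<close> that factor through \<open>H \<otimes> H\<close>.
\<close>

definition balanced2 :: "('k::field, 'h::ab_group_add) hopf_data \<Rightarrow> ('x \<Rightarrow>\<^sub>0 int) set
    \<Rightarrow> ('h \<Rightarrow> 'h \<Rightarrow> 'x \<Rightarrow>\<^sub>0 int) \<Rightarrow> bool" where
  "balanced2 H N f \<longleftrightarrow> biadd N f \<and> (\<forall>t a b. f (smul H t a) b \<simeq>[N] f a (smul H t b))"

definition balanced3 :: "('k::field, 'h::ab_group_add) hopf_data \<Rightarrow> ('x \<Rightarrow>\<^sub>0 int) set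
    \<Rightarrow> ('h \<Rightarrow> 'h \<Rightarrow> 'h \<Rightarrow> 'x \<Rightarrow>\<^sub>0 int) \<Rightarrow> bool" where
  "balanced3 H N f \<longleftrightarrow> triadd N f
     \<and> (\<forall>t a b c. f (smul H t a) b c \<simeq>[N] f a (smul H t b) c)
     \<and> (\<forall>t a b c. f a (smul H t b) c \<simeq>[N] f a b (smul H t c))"

lemma balanced2_biadd: "balanced2 H N f \<Longrightarrow> biadd N f"
  by (simp add: balanced2_def)

lemma balanced3_triadd: "balanced3 H N f \<Longrightarrow> triadd N f"
  by (simp add: balanced3_def)

text \<open>
  The universal property of a tensor product: the four conditions are its four kinds of relations.
\<close>

lemma hom_mod_tensor_rel:
  fixes F :: "('a::ab_group_add \<times> 'b::ab_group_add \<Rightarrow>\<^sub>0 int) \<Rightarrow> 'c::ab_group_add"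
  assumes F: "additive F"
    and left: "\<And>b. additive_mod N' (\<lambda>a. F (frag_of (a, b)))"
    and right: "\<And>a. additive_mod N' (\<lambda>b. F (frag_of (a, b)))"
    and middle: "\<And>a r b. F (frag_of (ra a r, b)) \<simeq>[N'] F (frag_of (a, la r b))"
    and zero: "\<And>a b. a \<in> N \<Longrightarrow> F (frag_of (a, b)) \<simeq>[N'] 0"
  shows "hom_mod (tensor_rel N ra la) N' F"
  unfolding tensor_rel_def
proof (rule hom_mod_gen[OF F])
  have "F (u - v - w) \<simeq>[N'] 0" if "F u \<simeq>[N'] F v + F w" for u v w
    using that by (simp add: additive.diff[OF F] additive.add[OF F] diff_diff_eq flip: eqv_diff_zero)
  moreover have "F (u - v) \<simeq>[N'] 0" if "F u \<simeq>[N'] F v" for u v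
    using that by (simp add: additive.diff[OF F] flip: eqv_diff_zero)
  ultimately show "F x \<simeq>[N'] 0"
    if "x \<in> {frag_of (a + a', b) - frag_of (a, b) - frag_of (a', b) | a a' b. True}
      \<union> {frag_of (a, b + b') - frag_of (a, b) - frag_of (a, b') | a b b'. True}
      \<union> {frag_of (ra a r, b) - frag_of (a, la r b) | a r b. True}
      \<union> {frag_of (a, b) | a b. a \<in> N}" for x
    using that additive_mod_add[OF left] additive_mod_add[OF right] middle zero by blast
qed

lemma hom_mod_T2: "balanced2 H N f \<Longrightarrow> hom_mod (T2 H) N (ext2 f)"
  unfolding T2_def
  by (rule hom_mod_tensor_rel)
    (auto simp: balanced2_def biadd_def intro: additive_mod_zero[of N "\<lambda>a. f a b" for b])

lemma hom_mod_T3: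
  assumes f: "balanced3 H N f"
  shows "hom_mod (T3 H) N (ext3 f)"
  unfolding T3_def
  using f by (intro hom_mod_gen)
    (auto simp: balanced3_def triadd_def additive_mod_def diff_diff_eq simp flip: eqv_diff_zero)

lemmas eqv_T2 = hom_mod_T2[THEN hom_modD]
lemmas eqv_T3 = hom_mod_T3[THEN hom_modD]

lemma biadd_hom:
  assumes "biadd N f" "hom_mod N N' F"
  shows "biadd N' (\<lambda>a b. F (f a b))"
  using assms(1) unfolding biadd_def
  by (auto intro: hom_mod_additive_mod[OF assms(2), of "\<lambda>a. f a b" for b]
      hom_mod_additive_mod[OF assms(2), of "f a" for a])

lemma triadd_hom:
  assumes "triadd N f" "hom_mod N N' F"
  shows "triadd N' (\<lambda>a b c. F (f a b c))"
  using assms(1) unfolding triadd_def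
  by (auto intro: hom_mod_additive_mod[OF assms(2), of "\<lambda>a. f a b c" for b c]
      hom_mod_additive_mod[OF assms(2), of "\<lambda>b. f a b c" for a c]
      hom_mod_additive_mod[OF assms(2), of "f a b" for a b])

lemma balanced2_hom: "balanced2 H N f \<Longrightarrow> hom_mod N N' F \<Longrightarrow> balanced2 H N' (\<lambda>a b. F (f a b))"
  by (auto simp: balanced2_def biadd_hom hom_modD)

lemma balanced3_hom: "balanced3 H N f \<Longrightarrow> hom_mod N N' F \<Longrightarrow> balanced3 H N' (\<lambda>a b c. F (f a b c))"
  by (auto simp: balanced3_def triadd_hom hom_modD)

lemma tensor_rel_generators:
  "frag_of (a + a', b) - frag_of (a, b) - frag_of (a', b) \<in> tensor_rel N ra la"
  "frag_of (a, b + b') - frag_of (a, b) - frag_of (a, b') \<in> tensor_rel N ra la"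
  "frag_of (ra a r, b) - frag_of (a, la r b) \<in> tensor_rel N ra la"
  "a \<in> N \<Longrightarrow> frag_of (a, b) \<in> tensor_rel N ra la"
  unfolding tensor_rel_def by (rule gen_subgroup.gen, blast)+

text \<open>
  The universal balanced map; all others that are needed arise from it by substitution.
\<close>

lemma balanced2_T2_frag_of: "balanced2 H (T2 H) (\<lambda>a b. frag_of (a, b))"
  unfolding balanced2_def biadd_def additive_mod_def eqv_def T2_def gen_subgroup_tensor_rel diff_diff_eq[symmetric]
  by (intro conjI allI tensor_rel_generators(1,2)
      tensor_rel_generators(3)[where ra = "\<lambda>a c. smul H c a" and la = "smul H"])

lemma T3_generators:
  "frag_of (a + a', b, d) - frag_of (a, b, d) - frag_of (a', b, d) \<in> T3 H"
  "frag_of (a, b + b', d) - frag_of (a, b, d) - frag_of (a, b', d) \<in> T3 H"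
  "frag_of (a, b, d + d') - frag_of (a, b, d) - frag_of (a, b, d') \<in> T3 H"
  "frag_of (smul H c a, b, d) - frag_of (a, smul H c b, d) \<in> T3 H"
  "frag_of (a, smul H c b, d) - frag_of (a, b, smul H c d) \<in> T3 H"
  unfolding T3_def by (rule gen_subgroup.gen, blast)+

lemma balanced3_T3_frag_of: "balanced3 H (T3 H) (\<lambda>a b c. frag_of (a, b, c))"
  unfolding balanced3_def triadd_def additive_mod_def eqv_def gen_subgroup_T3 diff_diff_eq[symmetric]
  by (intro conjI allI T3_generators)

section \<open>Tensor products over a Hopf algebra\<close>

lemma additive_mod_frag_of_left: "additive_mod (tensor_rel N ra la) (\<lambda>X. frag_of (X, m))"
  unfolding additive_mod_def eqv_def gen_subgroup_tensor_rel diff_diff_eq[symmetric]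
  by (intro allI tensor_rel_generators(1))

lemma additive_mod_frag_of_right: "additive_mod (tensor_rel N ra la) (\<lambda>m. frag_of (X, m))"
  unfolding additive_mod_def eqv_def gen_subgroup_tensor_rel diff_diff_eq[symmetric]
  by (intro allI tensor_rel_generators(2))

lemma frag_of_tensor_cong:
  assumes "x \<simeq>[N] y" "gen_subgroup N = N"
  shows "frag_of (x, m) \<simeq>[tensor_rel N ra la] frag_of (y, m)"
proof -
  have "frag_of (x - y, m) \<simeq>[tensor_rel N ra la] 0"
    using assms by (simp add: eqv_def tensor_rel_generators(4))
  then have "frag_of (x, m) - frag_of (y, m) \<simeq>[tensor_rel N ra la] 0"
    using eqv_trans[OF eqv_sym[OF additive_mod_diff[OF additive_mod_frag_of_left]]] by blast
  then show ?thesis by (simp add: eqv_diff_zero[symmetric])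
qed

lemma frag_of_tensor_act:
  "frag_of (ra X r, m) \<simeq>[tensor_rel N ra la] frag_of (X, la r m)"
  using tensor_rel_generators(3)[where ra = ra and la = la] by (simp add: eqv_def)

lemma additive_mod_frag_extend:
  assumes "additive_mod N F"
  shows "F (frag_extend z X) \<simeq>[N] frag_extend (\<lambda>t. F (z t)) X"
proof (induction X rule: frag_induct)
  case (diff a b)
  then show ?case
    using eqv_trans[OF additive_mod_diff[OF assms] eqv_diff[OF diff]] by (simp add: frag_extend_diff)
qed (auto simp: additive_mod_zero[OF assms])

lemma additive_mod_apply_ext2: "additive_mod N F \<Longrightarrow> F (ext2 z X) \<simeq>[N] ext2 (\<lambda>a b. F (z a b)) X"
  unfolding ext2_def using additive_mod_frag_extend[of N F "\<lambda>(a, b). z a b" X] by (simp add: split_def)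

lemma additive_mod_apply_ext3: "additive_mod N F \<Longrightarrow> F (ext3 z X) \<simeq>[N] ext3 (\<lambda>a b c. F (z a b c)) X"
  unfolding ext3_def using additive_mod_frag_extend[of N F "\<lambda>(a, b, c). z a b c" X] by (simp add: split_def)

lemma additive_mod_ext2_self: "additive_mod N F \<Longrightarrow> F X \<simeq>[N] ext2 (\<lambda>a b. F (frag_of (a, b))) X"
  unfolding ext2_def using additive_mod_frag_extend[of N F frag_of X] by (simp add: split_def flip: frag_expansion)

lemma additive_mod_ext3_self: "additive_mod N F \<Longrightarrow> F X \<simeq>[N] ext3 (\<lambda>a b c. F (frag_of (a, b, c))) X"
  unfolding ext3_def using additive_mod_frag_extend[of N F frag_of X] by (simp add: split_def flip: frag_expansion)

text \<open>
  Representatives of elements of \<open>(H \<otimes> H) \<otimes>\<^sub>H M\<close> are formal sums of pairs \<open>(X, m)\<close> in which \<open>X\<close> is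
  again a formal sum; \<open>lift2 f\<close> extends \<open>f\<close> additively at both levels.
\<close>

definition lift2 where "lift2 f = ext2 (\<lambda>X m. ext2 (\<lambda>a b. f a b m) X)"
definition lift3 where "lift3 f = ext2 (\<lambda>X m. ext3 (\<lambda>a b c. f a b c m) X)"

definition pure2 where "pure2 a b m = frag_of (frag_of (a, b), m)"
definition pure3 where "pure3 a b c m = frag_of (frag_of (a, b, c), m)"

lemma lift2_simps [simp]:
  "lift2 f 0 = 0" "lift2 f (pure2 a b m) = f a b m" "lift2 f (x + y) = lift2 f x + lift2 f y"
  "lift2 f (x - y) = lift2 f x - lift2 f y" "lift2 f (- x) = - lift2 f x"
  "lift2 f (sum g I) = (\<Sum>i\<in>I. lift2 f (g i))"
  by (simp_all add: lift2_def pure2_def)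

lemma lift3_simps [simp]:
  "lift3 f 0 = 0" "lift3 f (pure3 a b c m) = f a b c m" "lift3 f (x + y) = lift3 f x + lift3 f y"
  "lift3 f (x - y) = lift3 f x - lift3 f y" "lift3 f (- x) = - lift3 f x"
  "lift3 f (sum g I) = (\<Sum>i\<in>I. lift3 f (g i))"
  by (simp_all add: lift3_def pure3_def)

lemma additive_lift2 [simp, intro]: "additive (lift2 f)"
  by (simp add: lift2_def)

lemma additive_lift3 [simp, intro]: "additive (lift3 f)"
  by (simp add: lift3_def)

lemma additive_apply_lift2: "additive F \<Longrightarrow> F (lift2 f x) = lift2 (\<lambda>a b m. F (f a b m)) x"
  by (simp add: lift2_def additive_apply_ext2)

lemma additive_apply_lift3: "additive F \<Longrightarrow> F (lift3 f x) = lift3 (\<lambda>a b c m. F (f a b c m)) x"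
  by (simp add: lift3_def additive_apply_ext2 additive_apply_ext3)

lemma lift2_cong: "(\<And>a b m. f a b m \<simeq>[N] g a b m) \<Longrightarrow> lift2 f x \<simeq>[N] lift2 g x"
  by (simp add: lift2_def ext2_cong)

lemma lift3_cong: "(\<And>a b c m. f a b c m \<simeq>[N] g a b c m) \<Longrightarrow> lift3 f x \<simeq>[N] lift3 g x"
  by (simp add: lift3_def ext2_cong ext3_cong)

lemma additive_mod_lift2: "(\<And>a b m. additive_mod N (\<lambda>x. f x a b m)) \<Longrightarrow> additive_mod N (\<lambda>x. lift2 (f x) z)"
  unfolding lift2_def by (intro additive_mod_ext2)

lemma lift2_ext2:
  "lift2 (\<lambda>a b m. ext2 (\<lambda>c d. f c d a b m) y) x = ext2 (\<lambda>c d. lift2 (f c d) x) y"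
  unfolding lift2_def by (subst (2) ext2_commute, subst ext2_commute) simp

text \<open>
  The maps \<open>H \<times> H \<times> M \<rightarrow> X / N\<close> that factor through \<open>(H \<otimes> H) \<otimes>\<^sub>H M\<close>: the last condition says
  \<open>(a \<otimes> b) \<otimes> h m = (a \<otimes> b) \<Delta>(h) \<otimes> m\<close>.
\<close>

definition balanced_mod2 :: "('k::field, 'h::ab_group_add) hopf_data \<Rightarrow> ('h \<Rightarrow> 'm::ab_group_add \<Rightarrow> 'm)
    \<Rightarrow> ('x \<Rightarrow>\<^sub>0 int) set \<Rightarrow> ('h \<Rightarrow> 'h \<Rightarrow> 'm \<Rightarrow> 'x \<Rightarrow>\<^sub>0 int) \<Rightarrow> bool" where
  "balanced_mod2 H act N f \<longleftrightarrow> (\<forall>m. balanced2 H N (\<lambda>a b. f a b m)) \<and> (\<forall>a b. additive_mod N (f a b)) \<and>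
     (\<forall>a b h m. f a b (act h m) \<simeq>[N] ext2 (\<lambda>h1 h2. f (hmul H a h1) (hmul H b h2) m) (cop H h))"

text \<open>
  The nested sum in the last condition runs over the iterated coproduct
  \<open>(\<Delta> \<otimes> id) \<Delta>(h) = h1 \<otimes> h2 \<otimes> h3\<close>, through which \<open>H\<close> acts on \<open>H \<otimes> H \<otimes> H\<close>.
\<close>

definition balanced_mod3 :: "('k::field, 'h::ab_group_add) hopf_data \<Rightarrow> ('h \<Rightarrow> 'm::ab_group_add \<Rightarrow> 'm)
    \<Rightarrow> ('x \<Rightarrow>\<^sub>0 int) set \<Rightarrow> ('h \<Rightarrow> 'h \<Rightarrow> 'h \<Rightarrow> 'm \<Rightarrow> 'x \<Rightarrow>\<^sub>0 int) \<Rightarrow> bool" where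
  "balanced_mod3 H act N f \<longleftrightarrow>
     (\<forall>m. balanced3 H N (\<lambda>a b c. f a b c m)) \<and> (\<forall>a b c. additive_mod N (f a b c)) \<and>
     (\<forall>a b c h m. f a b c (act h m) \<simeq>[N]
       ext2 (\<lambda>h' h3. ext2 (\<lambda>h1 h2. f (hmul H a h1) (hmul H b h2) (hmul H c h3) m) (cop H h'))
         (cop H h))"

lemma hom_mod_P2:
  assumes f: "balanced_mod2 H act N f"
  shows "hom_mod (P2 H act) N (lift2 f)"
proof -
  have b: "balanced2 H N (\<lambda>a b. f a b m)" for m
    using f by (simp add: balanced_mod2_def)
  have "ext2 (\<lambda>c d. f c d (act r m)) x \<simeq>[N]
      ext2 (\<lambda>c d. ext2 (\<lambda>h1 h2. f (hmul H c h1) (hmul H d h2) m) (cop H r)) x" for x r m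
    using f by (intro ext2_cong) (simp add: balanced_mod2_def)
  moreover have "additive_mod N (\<lambda>m. ext2 (\<lambda>a b. f a b m) x)" for x
    using f by (intro additive_mod_ext2) (simp add: balanced_mod2_def)
  ultimately show ?thesis
    unfolding P2_def lift2_def using hom_modD[OF hom_mod_T2[OF b], of _ 0]
    by (intro hom_mod_tensor_rel)
      (auto simp: additive_mod_def tmul2_ext2 eqv_def[of _ "T2 H"] gen_subgroup.gen intro: eqv_sym)
qed

lemma hom_mod_P3:
  assumes f: "balanced_mod3 H act N f"
  shows "hom_mod (P3 H act) N (lift3 f)"
proof -
  have b: "balanced3 H N (\<lambda>a b c. f a b c m)" for m
    using f by (simp add: balanced_mod3_def)
  have "ext3 (\<lambda>c d e. f c d e (act r m)) x \<simeq>[N]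
      ext3 (\<lambda>c d e. ext2 (\<lambda>h' h3. ext2 (\<lambda>h1 h2. f (hmul H c h1) (hmul H d h2) (hmul H e h3) m)
        (cop H h')) (cop H r)) x" for x r m
    using f by (intro ext3_cong) (simp add: balanced_mod3_def)
  moreover have "additive_mod N (\<lambda>m. ext3 (\<lambda>a b c. f a b c m) x)" for x
    using f by (intro additive_mod_ext3) (simp add: balanced_mod3_def)
  ultimately show ?thesis
    unfolding P3_def lift3_def using hom_modD[OF hom_mod_T3[OF b], of _ 0]
    by (intro hom_mod_tensor_rel)
      (auto simp: additive_mod_def tmul3_ext3 eqv_def[of _ "T3 H"] gen_subgroup.gen intro: eqv_sym)
qed

text \<open>
  The universal example.  It is used to reduce the condition on an arbitrary map built from
  \<open>pure2\<close> to a computation in the factors.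
\<close>

lemma balanced_mod2_pure2: "balanced_mod2 H act (P2 H act) pure2"
proof -
  have "hom_mod (T2 H) (P2 H act) (\<lambda>X. ext2 (\<lambda>a b. pure2 a b m) X)" for m
  proof -
    have "ext2 (\<lambda>a b. pure2 a b m) x \<simeq>[P2 H act] 0" if "x \<in> T2 H" for x
    proof -
      have "ext2 (\<lambda>a b. pure2 a b m) x \<simeq>[P2 H act] frag_of (x, m)"
        using additive_mod_ext2_self[OF additive_mod_frag_of_left, THEN eqv_sym] by (simp add: pure2_def P2_def)
      also have "\<dots> \<simeq>[P2 H act] frag_of (0, m)"
        unfolding P2_def using that by (intro frag_of_tensor_cong) (auto simp: eqv_def)
      also have "\<dots> \<simeq>[P2 H act] 0"
        unfolding P2_def using additive_mod_frag_of_left by (rule additive_mod_zero)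
      finally show ?thesis .
    qed
    then show ?thesis by (simp add: hom_mod_def)
  qed
  from balanced2_hom[OF balanced2_T2_frag_of this]
  have "balanced2 H (P2 H act) (\<lambda>a b. pure2 a b m)" for m by simp
  moreover have "additive_mod (P2 H act) (pure2 a b)" for a b
    using additive_mod_frag_of_right by (simp add: pure2_def[abs_def] P2_def)
  moreover have "pure2 a b (act h m) \<simeq>[P2 H act]
      ext2 (\<lambda>h1 h2. pure2 (hmul H a h1) (hmul H b h2) m) (cop H h)" for a b h m
  proof -
    have "pure2 a b (act h m) \<simeq>[P2 H act] frag_of (tmul2 H (frag_of (a, b)) (cop H h), m)"
      unfolding pure2_def P2_def by (rule eqv_sym, rule frag_of_tensor_act)
    also have "\<dots> = frag_of (ext2 (\<lambda>h1 h2. frag_of (hmul H a h1, hmul H b h2)) (cop H h), m)"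
      by (simp add: tmul2_ext2)
    also have "\<dots> \<simeq>[P2 H act] ext2 (\<lambda>h1 h2. pure2 (hmul H a h1) (hmul H b h2) m) (cop H h)"
      unfolding pure2_def P2_def by (rule additive_mod_apply_ext2[OF additive_mod_frag_of_left])
    finally show ?thesis .
  qed
  ultimately show ?thesis by (simp add: balanced_mod2_def)
qed

lemma balanced_mod3_pure3: "balanced_mod3 H act (P3 H act) pure3"
proof -
  have "hom_mod (T3 H) (P3 H act) (\<lambda>X. ext3 (\<lambda>a b c. pure3 a b c m) X)" for m
  proof -
    have "ext3 (\<lambda>a b c. pure3 a b c m) x \<simeq>[P3 H act] 0" if "x \<in> T3 H" for x
    proof -
      have "ext3 (\<lambda>a b c. pure3 a b c m) x \<simeq>[P3 H act] frag_of (x, m)"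
        using additive_mod_ext3_self[OF additive_mod_frag_of_left, THEN eqv_sym] by (simp add: pure3_def P3_def)
      also have "\<dots> \<simeq>[P3 H act] frag_of (0, m)"
        unfolding P3_def using that by (intro frag_of_tensor_cong) (auto simp: eqv_def)
      also have "\<dots> \<simeq>[P3 H act] 0"
        unfolding P3_def using additive_mod_frag_of_left by (rule additive_mod_zero)
      finally show ?thesis .
    qed
    then show ?thesis by (simp add: hom_mod_def)
  qed
  from balanced3_hom[OF balanced3_T3_frag_of this]
  have "balanced3 H (P3 H act) (\<lambda>a b c. pure3 a b c m)" for m by simp
  moreover have "additive_mod (P3 H act) (pure3 a b c)" for a b c
    using additive_mod_frag_of_right by (simp add: pure3_def[abs_def] P3_def)
  moreover have "pure3 a b c (act h m) \<simeq>[P3 H act]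
      ext2 (\<lambda>h' h3. ext2 (\<lambda>h1 h2. pure3 (hmul H a h1) (hmul H b h2) (hmul H c h3) m) (cop H h'))
        (cop H h)" for a b c h m
  proof -
    have "pure3 a b c (act h m) \<simeq>[P3 H act]
        frag_of (tmul3 H (frag_of (a, b, c)) (cop_id H (cop H h)), m)"
      unfolding pure3_def P3_def by (rule eqv_sym, rule frag_of_tensor_act)
    also have "\<dots> = frag_of (ext3 (\<lambda>h1 h2 h3. frag_of (hmul H a h1, hmul H b h2, hmul H c h3))
        (cop_id H (cop H h)), m)"
      by (simp add: tmul3_ext3 del: ext3_cop_id)
    also have "\<dots> \<simeq>[P3 H act]
        ext3 (\<lambda>h1 h2 h3. pure3 (hmul H a h1) (hmul H b h2) (hmul H c h3) m) (cop_id H (cop H h))"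
      unfolding pure3_def P3_def by (rule additive_mod_apply_ext3[OF additive_mod_frag_of_left])
    finally show ?thesis by simp
  qed
  ultimately show ?thesis by (simp add: balanced_mod3_def)
qed

lemma lift2_pure2: "lift2 pure2 x \<simeq>[P2 H act] x"
proof (induction x rule: frag_induct)
  case (one x)
  obtain X m where "x = (X, m)" by fastforce
  then show ?case
    using additive_mod_ext2_self[OF additive_mod_frag_of_left, THEN eqv_sym] by (simp add: lift2_def pure2_def P2_def)
qed (auto intro: eqv_diff)

lemma lift3_pure3: "lift3 pure3 x \<simeq>[P3 H act] x"
proof (induction x rule: frag_induct)
  case (one x)
  obtain X m where "x = (X, m)" by fastforce
  then show ?case
    using additive_mod_ext3_self[OF additive_mod_frag_of_left, THEN eqv_sym] by (simp add: lift3_def pure3_def P3_def)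
qed (auto intro: eqv_diff)

text \<open>
  A homomorphism is determined, modulo the relations, by its values on pure tensors.
\<close>

lemma lift2_eqv_hom:
  assumes "hom_mod (P2 H act) N F" and "\<And>a b m. f a b m \<simeq>[N] F (pure2 a b m)"
  shows "lift2 f x \<simeq>[N] F x"
proof -
  have "lift2 f x \<simeq>[N] lift2 (\<lambda>a b m. F (pure2 a b m)) x"
    using assms(2) by (rule lift2_cong)
  also have "\<dots> = F (lift2 pure2 x)"
    by (simp add: additive_apply_lift2 hom_mod_additive[OF assms(1)])
  also have "\<dots> \<simeq>[N] F x"
    by (rule hom_modD[OF assms(1) lift2_pure2])
  finally show ?thesis .
qed

lemma lift3_eqv_hom:
  assumes "hom_mod (P3 H act) N F" and "\<And>a b c m. f a b c m \<simeq>[N] F (pure3 a b c m)"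
  shows "lift3 f x \<simeq>[N] F x"
proof -
  have "lift3 f x \<simeq>[N] lift3 (\<lambda>a b c m. F (pure3 a b c m)) x"
    using assms(2) by (rule lift3_cong)
  also have "\<dots> = F (lift3 pure3 x)"
    by (simp add: additive_apply_lift3 hom_mod_additive[OF assms(1)])
  also have "\<dots> \<simeq>[N] F x"
    by (rule hom_modD[OF assms(1) lift3_pure3])
  finally show ?thesis .
qed

text \<open>
  Here \<open>tmap \<phi> \<psi>\<close> sends a generator \<open>(X, m)\<close>, where \<open>X\<close> is itself a formal sum, to the single
  generator \<open>(\<phi> X, \<psi> m)\<close>; the relations allow \<open>X\<close> to be expanded first.
\<close>

lemma tmap_eqv_ext2:
  assumes "additive \<phi>"
  shows "tmap \<phi> \<psi> x \<simeq>[tensor_rel N ra la]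
    ext2 (\<lambda>X m. ext2 (\<lambda>a b. frag_of (\<phi> (frag_of (a, b)), \<psi> m)) X) x"
  unfolding tmap_ext2
  by (intro ext2_cong additive_mod_ext2_self[of _ "\<lambda>X. frag_of (\<phi> X, y)" for y])
    (auto simp: assms intro!: additive_mod_additive[OF additive_mod_frag_of_left])

lemma tmap_eqv_ext3:
  assumes "additive \<phi>"
  shows "tmap \<phi> \<psi> x \<simeq>[tensor_rel N ra la]
    ext2 (\<lambda>X m. ext3 (\<lambda>a b c. frag_of (\<phi> (frag_of (a, b, c)), \<psi> m)) X) x"
  unfolding tmap_ext2
  by (intro ext2_cong additive_mod_ext3_self[of _ "\<lambda>X. frag_of (\<phi> X, y)" for y])
    (auto simp: assms intro!: additive_mod_additive[OF additive_mod_frag_of_left])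

lemma tmap_eqv_lift2:
  assumes "additive \<phi>" "\<And>a b. \<phi> (frag_of (a, b)) = frag_of (u a, v b)"
  shows "tmap \<phi> \<psi> x \<simeq>[P2 H act] lift2 (\<lambda>a b m. pure2 (u a) (v b) (\<psi> m)) x"
  using tmap_eqv_ext2[OF assms(1)] by (simp add: lift2_def pure2_def P2_def assms(2))

section \<open>Comultiplications\<close>

text \<open>
  The properties of multiplication and comultiplication that make the maps below balanced.  They
  hold both for \<open>H\<close> and for the smash product, so that the lemmas of this locale serve both.
\<close>

locale prebialgebra =
  fixes H :: "('k::field, 'h::ab_group_add) hopf_data"
  assumes hmul_add_left: "hmul H (a + b) c = hmul H a c + hmul H b c"
    and hmul_add_right: "hmul H a (b + c) = hmul H a b + hmul H a c"
    and hmul_smul_left: "hmul H (smul H t a) b = smul H t (hmul H a b)"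
    and hmul_smul_right: "hmul H a (smul H t b) = smul H t (hmul H a b)"
    and cop_add: "cop H (a + b) \<simeq>[T2 H] cop H a + cop H b"
    and cop_smul: "cop H (smul H t a) \<simeq>[T2 H] tmap (smul H t) id (cop H a)"
begin

lemma balanced2_mul_left:
  "balanced2 H N f \<Longrightarrow> balanced2 H N (\<lambda>a b. f (hmul H u a) (hmul H v b))"
  by (simp add: balanced2_def biadd_def additive_mod_def hmul_add_right hmul_smul_right)

lemma balanced3_mul_left:
  "balanced3 H N f \<Longrightarrow> balanced3 H N (\<lambda>a b c. f (hmul H u a) (hmul H v b) (hmul H w c))"
  by (simp add: balanced3_def triadd_def additive_mod_def hmul_add_right hmul_smul_right)

lemma additive_mod_ext2_cop: "balanced2 H N f \<Longrightarrow> additive_mod N (\<lambda>h. ext2 f (cop H h))"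
  unfolding additive_mod_def ext2_simps(3)[symmetric] by (intro allI eqv_T2[OF _ cop_add])

text \<open>
  A coproduct may be substituted into a trilinear map: \<open>h \<otimes> c \<mapsto> f(h1, h2, c)\<close> is again balanced,
  since the scalar can be moved from \<open>h\<close> through \<open>h1\<close> and \<open>h2\<close> to \<open>c\<close>.
\<close>

lemma balanced2_cop_left:
  assumes f: "balanced3 H N f"
  shows "balanced2 H N (\<lambda>h c. ext2 (\<lambda>a b. f a b c) (cop H h))"
proof -
  have f2: "balanced2 H N (\<lambda>a b. f a b c)" for c
    using f by (simp add: balanced2_def balanced3_def biadd_def triadd_def)
  have "ext2 (\<lambda>a b. f a b c) (cop H (smul H t h)) \<simeq>[N] ext2 (\<lambda>a b. f a b (smul H t c)) (cop H h)"
    for t h c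
  proof -
    have "ext2 (\<lambda>a b. f a b c) (cop H (smul H t h)) \<simeq>[N] ext2 (\<lambda>a b. f (smul H t a) b c) (cop H h)"
      using eqv_T2[OF f2 cop_smul] by simp
    also have "\<dots> \<simeq>[N] ext2 (\<lambda>a b. f a b (smul H t c)) (cop H h)"
      using f by (intro ext2_cong) (unfold balanced3_def, blast intro: eqv_trans)
    finally show ?thesis .
  qed
  moreover have "additive_mod N (\<lambda>c. ext2 (\<lambda>a b. f a b c) (cop H h))" for h
    using f by (intro additive_mod_ext2) (simp add: balanced3_def triadd_def)
  ultimately show ?thesis
    using additive_mod_ext2_cop[OF f2] by (simp add: balanced2_def biadd_def)
qed

lemma balanced2_cop_right:
  assumes f: "balanced3 H N f"
  shows "balanced2 H N (\<lambda>a h. ext2 (\<lambda>b c. f a b c) (cop H h))"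
proof -
  have f2: "balanced2 H N (\<lambda>b c. f a b c)" for a
    using f by (simp add: balanced2_def balanced3_def biadd_def triadd_def)
  have "ext2 (\<lambda>b c. f (smul H t a) b c) (cop H h) \<simeq>[N] ext2 (\<lambda>b c. f a b c) (cop H (smul H t h))"
    for t h a
  proof -
    have "ext2 (\<lambda>b c. f (smul H t a) b c) (cop H h) \<simeq>[N] ext2 (\<lambda>b c. f a (smul H t b) c) (cop H h)"
      using f by (intro ext2_cong) (simp add: balanced3_def)
    also have "\<dots> \<simeq>[N] ext2 (\<lambda>b c. f a b c) (cop H (smul H t h))"
      using eqv_T2[OF f2 cop_smul, THEN eqv_sym] by simp
    finally show ?thesis .
  qed
  moreover have "additive_mod N (\<lambda>a. ext2 (\<lambda>b c. f a b c) (cop H h))" for h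
    using f by (intro additive_mod_ext2) (simp add: balanced3_def triadd_def)
  ultimately show ?thesis
    using additive_mod_ext2_cop[OF f2] by (simp add: balanced2_def biadd_def)
qed

end

abbreviation sg where "sg \<equiv> Poly_Mapping.single"
abbreviation lookup where "lookup \<equiv> Poly_Mapping.lookup"
abbreviation keys where "keys \<equiv> Poly_Mapping.keys"

section \<open>Maps given on homogeneous elements\<close>

text \<open>
  An element of \<open>H \<otimes> \<k>[\<Gamma>]\<close> is a sum of homogeneous elements \<open>sg g a\<close>, where \<open>sg g a\<close> stands for
  \<open>a \<otimes> g\<close>, and \<open>graded_sum F\<close> extends the prescription \<open>sg g a \<mapsto> F g a\<close> additively.
\<close>

definition graded_sum :: "('g \<Rightarrow> 'h::zero \<Rightarrow> 'b::comm_monoid_add) \<Rightarrow> ('g \<Rightarrow>\<^sub>0 'h) \<Rightarrow> 'b" where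
  "graded_sum F x = (\<Sum>g\<in>keys x. F g (lookup x g))"

text \<open>
  Outside the support the summand is \<open>F g 0\<close>, which vanishes only modulo \<open>N\<close>; enlarging the range
  of summation is therefore harmless only up to congruence.
\<close>

lemma graded_sum_superset:
  assumes "\<And>g. additive_mod N (F g)" "finite S" "keys x \<subseteq> S"
  shows "graded_sum F x \<simeq>[N] (\<Sum>g\<in>S. F g (lookup x g))"
proof -
  have "(\<Sum>g\<in>S. F g (lookup x g)) = graded_sum F x +
      (\<Sum>g\<in>S - keys x. F g (lookup x g))"
    using assms(2,3) unfolding graded_sum_def by (simp add: sum.subset_diff add.commute)
  also have "\<dots> \<simeq>[N] graded_sum F x + (\<Sum>g\<in>S - keys x. 0)"
    using additive_mod_zero[OF assms(1)] by (intro eqv_add eqv_refl eqv_sum) (simp add: in_keys_iff)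
  finally show ?thesis by (simp add: eqv_sym)
qed

lemma additive_mod_graded_sum:
  assumes "\<And>g. additive_mod N (F g)"
  shows "additive_mod N (graded_sum F :: ('g \<Rightarrow>\<^sub>0 'h::ab_group_add) \<Rightarrow> 'b::ab_group_add)"
  unfolding additive_mod_def
proof (intro allI)
  fix x y :: "'g \<Rightarrow>\<^sub>0 'h"
  let ?S = "keys x \<union> keys y"
  have "graded_sum F (x + y) \<simeq>[N] (\<Sum>g\<in>?S. F g (lookup (x + y) g))"
    using Poly_Mapping.keys_add[of x y] by (intro graded_sum_superset assms) auto
  also have "\<dots> \<simeq>[N] (\<Sum>g\<in>?S. F g (lookup x g) + F g (lookup y g))"
    using assms by (intro eqv_sum) (simp add: lookup_add additive_mod_def)
  also have "\<dots> = (\<Sum>g\<in>?S. F g (lookup x g)) + (\<Sum>g\<in>?S. F g (lookup y g))"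
    by (rule sum.distrib)
  also have "\<dots> \<simeq>[N] graded_sum F x + graded_sum F y"
    by (intro eqv_add eqv_sym[OF graded_sum_superset] assms) auto
  finally show "graded_sum F (x + y) \<simeq>[N] graded_sum F x + graded_sum F y" .
qed

lemma graded_sum_single:
  assumes "\<And>g. additive_mod N (F g)"
  shows "graded_sum F (sg g a) \<simeq>[N] F g a"
  using graded_sum_superset[where F = F and S = "{g}" and x = "sg g a", OF assms]
  by (simp add: lookup_single)

lemma graded_sum_cong: "(\<And>g a. F g a \<simeq>[N] G g a) \<Longrightarrow> graded_sum F x \<simeq>[N] graded_sum G x"
  unfolding graded_sum_def by (intro eqv_sum)

lemma additive_mod_graded_sum_param:
  assumes "\<And>g a. additive_mod N (\<lambda>m. F m g a)"
  shows "additive_mod N (\<lambda>m. graded_sum (F m) x)"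
  unfolding additive_mod_def
proof (intro allI)
  fix m m'
  have "graded_sum (F (m + m')) x \<simeq>[N] graded_sum (\<lambda>g a. F m g a + F m' g a) x"
    using assms by (intro graded_sum_cong) (simp add: additive_mod_def)
  then show "graded_sum (F (m + m')) x \<simeq>[N] graded_sum (F m) x + graded_sum (F m') x"
    by (simp add: graded_sum_def sum.distrib)
qed

lemma single_induct [case_names zero single add]:
  assumes "P 0" "\<And>g a. P (sg g a)" "\<And>x y. P x \<Longrightarrow> P y \<Longrightarrow> P (x + y)"
  shows "P (x :: 'g \<Rightarrow>\<^sub>0 'h::ab_group_add)"
proof -
  have "P (\<Sum>g\<in>S. sg g (lookup x g))" if "finite S" for S
    using that by induction (auto intro: assms)
  moreover have "(\<Sum>g\<in>keys x. sg g (lookup x g)) = x"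
    by (rule poly_mapping_eqI)
      (auto simp: lookup_sum lookup_single when_def in_keys_iff sum.delta)
  ultimately show ?thesis by (metis finite_keys)
qed

lemma additive_mod_ext_single:
  fixes f g :: "('g \<Rightarrow>\<^sub>0 'h::ab_group_add) \<Rightarrow> 'b::ab_group_add"
  assumes "additive_mod N f" "additive_mod N g"
    and "\<And>s a. f (sg s a) \<simeq>[N] g (sg s a)"
  shows "f x \<simeq>[N] g x"
proof (induction x rule: single_induct)
  case zero
  show ?case
    by (rule eqv_trans[OF additive_mod_zero[OF assms(1)] eqv_sym[OF additive_mod_zero[OF assms(2)]]])
next
  case (add x y)
  have "f (x + y) \<simeq>[N] f x + f y" using assms(1) by (simp add: additive_mod_def)
  also have "\<dots> \<simeq>[N] g x + g y" by (rule eqv_add[OF add])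
  also have "\<dots> \<simeq>[N] g (x + y)" using assms(2) by (simp add: additive_mod_def eqv_sym)
  finally show ?case .
qed (rule assms(3))

lemma biadd_ext_single:
  fixes f g :: "('g \<Rightarrow>\<^sub>0 'h::ab_group_add) \<Rightarrow> ('g \<Rightarrow>\<^sub>0 'h) \<Rightarrow> 'x::ab_group_add"
  assumes "biadd N f" "biadd N g"
    and "\<And>s a t b. f (sg s a) (sg t b)
      \<simeq>[N] g (sg s a) (sg t b)"
  shows "f x y \<simeq>[N] g x y"
proof -
  have "f (sg s a) y \<simeq>[N] g (sg s a) y" for s a
    using assms unfolding biadd_def
    by (intro additive_mod_ext_single[of N "f (sg s a)" "g (sg s a)" y]) auto
  then show ?thesis
    using assms(1,2) unfolding biadd_def
    by (intro additive_mod_ext_single[of N "\<lambda>x. f x y" "\<lambda>x. g x y" x]) auto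
qed

lemma triadd_ext_single:
  fixes f g :: "('g \<Rightarrow>\<^sub>0 'h::ab_group_add) \<Rightarrow> ('g \<Rightarrow>\<^sub>0 'h) \<Rightarrow> ('g \<Rightarrow>\<^sub>0 'h) \<Rightarrow> 'x::ab_group_add"
  assumes "triadd N f" "triadd N g"
    and "\<And>s a t b u c. f (sg s a) (sg t b) (sg u c)
      \<simeq>[N] g (sg s a) (sg t b) (sg u c)"
  shows "f x y z \<simeq>[N] g x y z"
proof -
  have "f (sg s a) y z \<simeq>[N] g (sg s a) y z" for s a
    using assms unfolding triadd_def
    by (intro biadd_ext_single[of N "f (sg s a)" "g (sg s a)" y z])
      (auto simp: biadd_def)
  then show ?thesis
    using assms(1,2) unfolding triadd_def
    by (intro additive_mod_ext_single[of N "\<lambda>x. f x y z" "\<lambda>x. g x y z" x]) auto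
qed

section \<open>The smash product\<close>

locale smash_setting =
  hopf: cocommutative_hopf_algebra H + action: hopf_action H \<alpha>
  for H :: "('k::field, 'h::ab_group_add) hopf_data" and \<alpha> :: "'g::group_add \<Rightarrow> 'h \<Rightarrow> 'h"
begin

abbreviation K where "K \<equiv> smash H \<alpha>"
abbreviation one where "one \<equiv> hone H"
abbreviation mul (infixl "\<cdot>" 70) where "a \<cdot> b \<equiv> hmul H a b"

lemmas mul_simps [simp] = hopf.mul_one_left hopf.mul_one_right action.act_zero action.act_one

lemma alpha_add [simp]: "\<alpha> g (a + b) = \<alpha> g a + \<alpha> g b"
  using action.act_linear[of g] by (simp add: module_hom_iff_linear[symmetric] module_hom.add)

lemma alpha_additive: "additive (\<alpha> g)"
  by (simp add: additive_def)

lemma alpha_zero [simp]: "\<alpha> g 0 = 0"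
  by (rule additive.zero[OF alpha_additive])

lemma alpha_smul [simp]: "\<alpha> g (smul H t a) = smul H t (\<alpha> g a)"
  using action.act_linear[of g] by (simp add: module_hom_iff_linear[symmetric] module_hom.scale)

lemma alpha_alpha [simp]: "\<alpha> g (\<alpha> h a) = \<alpha> (g + h) a"
  by (simp add: action.act_plus)

lemma alpha_mul [simp]: "\<alpha> g (a \<cdot> b) = \<alpha> g a \<cdot> \<alpha> g b"
  by (rule action.act_mul)

lemmas smul_H_rules = vector_space.vector_space_assms[OF hopf.vector_space]

lemma smul_H_add: "smul H t (a + b) = smul H t a + smul H t b"
  by (simp add: smul_H_rules)

lemma smul_H_zero [simp]: "smul H t 0 = 0"
  using smul_H_add[of t 0 0] by simp

lemma smul_H_commute: "smul H t (smul H s a) = smul H s (smul H t a)"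
  by (simp add: smul_H_rules mult.commute)

lemma mul_zero [simp]: "0 \<cdot> a = 0" "a \<cdot> 0 = 0"
  using hopf.mul_add_left[of 0 0 a] hopf.mul_add_right[of a 0 0] by simp_all

lemma cop_eqvI: "comul A a = coset (T2 A) z \<Longrightarrow> cop A a \<simeq>[T2 A] z"
  by (simp add: cop_def rep_coset)

sublocale Hb: prebialgebra H
proof
  show "cop H (a + b) \<simeq>[T2 H] cop H a + cop H b" for a b
    by (rule cop_eqvI[OF hopf.comul_add])
  show "cop H (smul H t a) \<simeq>[T2 H] tmap (smul H t) id (cop H a)" for t a
    by (rule cop_eqvI[OF hopf.comul_smul])
qed (auto simp: hopf.mul_add_left hopf.mul_add_right hopf.mul_smul_left hopf.mul_smul_right)

lemma ext2_cop_swap: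
  assumes "balanced2 H N f"
  shows "ext2 f (cop H a) \<simeq>[N] ext2 (\<lambda>x y. f y x) (cop H a)"
proof -
  have "cop H a \<simeq>[T2 H] swap2 (cop H a)"
    by (rule cop_eqvI[OF hopf.cocomm])
  from eqv_T2[OF assms this] show ?thesis by simp
qed

lemma ext2_cop_mul:
  assumes "balanced2 H N f"
  shows "ext2 f (cop H (a \<cdot> b)) \<simeq>[N]
    ext2 (\<lambda>a1 a2. ext2 (\<lambda>b1 b2. f (a1 \<cdot> b1) (a2 \<cdot> b2)) (cop H b)) (cop H a)"
proof -
  have "cop H (a \<cdot> b) \<simeq>[T2 H] tmul2 H (cop H a) (cop H b)"
    by (rule cop_eqvI[OF hopf.comul_mul])
  from eqv_T2[OF assms this] show ?thesis by (simp add: tmul2_ext2)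
qed

lemma ext2_cop_alpha:
  assumes "balanced2 H N f"
  shows "ext2 f (cop H (\<alpha> g a)) \<simeq>[N] ext2 (\<lambda>x y. f (\<alpha> g x) (\<alpha> g y)) (cop H a)"
proof -
  have "cop H (\<alpha> g a) \<simeq>[T2 H] tmap (\<alpha> g) (\<alpha> g) (cop H a)"
    by (rule cop_eqvI[OF action.act_comul])
  from eqv_T2[OF assms this] show ?thesis by simp
qed

lemma ext2_coassoc:
  assumes "balanced3 H N f"
  shows "ext2 (\<lambda>h c. ext2 (\<lambda>a b. f a b c) (cop H h)) (cop H x) \<simeq>[N]
    ext2 (\<lambda>a h. ext2 (\<lambda>b c. f a b c) (cop H h)) (cop H x)"
proof -
  have "cop_id H (cop H x) \<simeq>[T3 H] id_cop H (cop H x)"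
    using hopf.coassoc[of x] by (simp add: coset_eq_iff)
  from eqv_T3[OF assms this] show ?thesis by simp
qed

subsection \<open>The operations of the smash product\<close>

lemma lookup_smul_K: "lookup (smul K t x) g = smul H t (lookup x g)"
  by (simp add: smash_def Let_def Poly_Mapping.map.rep_eq when_def)

lemma smul_K_add: "smul K t (x + y) = smul K t x + smul K t y"
  by (rule poly_mapping_eqI) (simp add: lookup_smul_K lookup_add smul_H_add)

lemma smul_K_single: "smul K t (sg g a) = sg g (smul H t a)"
  by (rule poly_mapping_eqI) (simp add: lookup_smul_K lookup_single when_def)

lemma smul_K_commute: "smul K t (smul K s x) = smul K s (smul K t x)"
  by (rule poly_mapping_eqI) (simp add: lookup_smul_K smul_H_commute)

lemma hmul_K_graded_sum: "hmul K x y = graded_sum (\<lambda>g a. graded_sum (\<lambda>h b. sg (g + h) (a \<cdot> \<alpha> g b)) y) x"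
  by (simp add: smash_def Let_def graded_sum_def)

lemma biadd_graded_sum2:
  assumes "\<And>g h. biadd N (F g h)"
  shows "biadd N (\<lambda>x y. graded_sum (\<lambda>g a. graded_sum (\<lambda>h b. F g h a b) y) x)"
  using assms unfolding biadd_def by (auto intro!: additive_mod_graded_sum additive_mod_graded_sum_param)

lemma graded_sum2_single:
  assumes "\<And>g h. biadd N (F g h)"
  shows "graded_sum (\<lambda>g a. graded_sum (\<lambda>h b. F g h a b) (sg h b)) (sg g a) \<simeq>[N] F g h a b"
proof -
  have "graded_sum (\<lambda>g a. graded_sum (\<lambda>h b. F g h a b) (sg h b)) (sg g a) \<simeq>[N] graded_sum (\<lambda>h b. F g h a b) (sg h b)"
    using assms unfolding biadd_def
    by (intro graded_sum_single[where F = "\<lambda>g a. graded_sum (\<lambda>h b. F g h a b) (sg h b)"])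
      (auto intro!: additive_mod_graded_sum_param)
  also have "\<dots> \<simeq>[N] F g h a b"
    using assms unfolding biadd_def by (intro graded_sum_single[where F = "\<lambda>h b. F g h a b"]) auto
  finally show ?thesis .
qed

lemma biadd_single_mul: "biadd {0} (\<lambda>a b. sg (g + h) (a \<cdot> \<alpha> g b))"
  by (simp add: biadd_def additive_mod_def single_add hopf.mul_add_left hopf.mul_add_right)

lemma biadd_hmul_K: "biadd {0} (hmul K)"
  unfolding hmul_K_graded_sum[abs_def] by (intro biadd_graded_sum2 biadd_single_mul)

lemma hmul_K_single [simp]: "hmul K (sg g a) (sg h b) = sg (g + h) (a \<cdot> \<alpha> g b)"
  using graded_sum2_single[of "{0}" "\<lambda>g h a b. sg (g + h) (a \<cdot> \<alpha> g b)", OF biadd_single_mul]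
  by (simp add: hmul_K_graded_sum)

lemma hmul_K_add: "hmul K (x + y) z = hmul K x z + hmul K y z" "hmul K x (y + z) = hmul K x y + hmul K x z"
  using biadd_hmul_K by (simp_all add: biadd_def additive_mod_def)

lemma balanced2_single: "balanced2 K N f \<Longrightarrow> balanced2 H N (\<lambda>a b. f (sg g a) (sg h b))"
  unfolding balanced2_def biadd_def additive_mod_def by (simp add: single_add flip: smul_K_single)

lemma balanced3_single: "balanced3 K N f \<Longrightarrow> balanced3 H N (\<lambda>a b c. f (sg g a) (sg h b) (sg i c))"
  unfolding balanced3_def triadd_def additive_mod_def by (simp add: single_add flip: smul_K_single)

lemma additive_mod_tmap_single_cop: "additive_mod (T2 K) (\<lambda>a. tmap (sg g) (sg g) (cop H a))"
  unfolding tmap_ext2 by (intro Hb.additive_mod_ext2_cop balanced2_single balanced2_T2_frag_of)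

lemma cop_K_graded_sum: "cop K x \<simeq>[T2 K] graded_sum (\<lambda>g a. tmap (sg g) (sg g) (cop H a)) x"
proof -
  have "comul K x = coset (T2 K) (graded_sum (\<lambda>g a. tmap (sg g) (sg g) (cop H a)) x)"
    by (simp add: smash_def Let_def graded_sum_def T2_def)
  then show ?thesis by (rule cop_eqvI)
qed

lemma cop_K_single: "cop K (sg g a) \<simeq>[T2 K] tmap (sg g) (sg g) (cop H a)"
  using eqv_trans[OF cop_K_graded_sum graded_sum_single[OF additive_mod_tmap_single_cop]] .

lemma additive_mod_cop_K: "additive_mod (T2 K) (cop K)"
  by (rule additive_mod_eqv[OF additive_mod_graded_sum[OF additive_mod_tmap_single_cop] eqv_sym[OF cop_K_graded_sum]])

lemma balanced2_smul_left:
  "balanced2 K N f \<Longrightarrow> balanced2 K N (\<lambda>a b. f (smul K t a) b)"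
  by (simp add: balanced2_def biadd_def additive_mod_def smul_K_add smul_K_commute[of t])

sublocale Kb: prebialgebra K
proof
  fix a b c and t :: 'k
  show "hmul K (a + b) c = hmul K a c + hmul K b c" "hmul K a (b + c) = hmul K a b + hmul K a c"
    by (rule hmul_K_add)+
  show "cop K (a + b) \<simeq>[T2 K] cop K a + cop K b"
    using additive_mod_cop_K by (simp add: additive_mod_def)
  have "hmul K (smul K t a) b \<simeq>[{0}] smul K t (hmul K a b)"
    by (rule biadd_ext_single[where f = "\<lambda>a b. hmul K (smul K t a) b"])
      (simp_all add: biadd_def additive_mod_def smul_K_add hmul_K_add smul_K_single hopf.mul_smul_left)
  then show "hmul K (smul K t a) b = smul K t (hmul K a b)" by simp
  have "hmul K a (smul K t b) \<simeq>[{0}] smul K t (hmul K a b)"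
    by (rule biadd_ext_single[where f = "\<lambda>a b. hmul K a (smul K t b)"])
      (simp_all add: biadd_def additive_mod_def smul_K_add hmul_K_add smul_K_single hopf.mul_smul_right)
  then show "hmul K a (smul K t b) = smul K t (hmul K a b)" by simp
  show "cop K (smul K t a) \<simeq>[T2 K] tmap (smul K t) id (cop K a)"
  proof (rule additive_mod_ext_single[where f = "\<lambda>a. cop K (smul K t a)"])
    have f: "balanced2 K (T2 K) (\<lambda>a b. frag_of (smul K t a, b))"
      by (rule balanced2_smul_left[OF balanced2_T2_frag_of])
    show "additive_mod (T2 K) (\<lambda>a. cop K (smul K t a))"
      using additive_mod_cop_K by (simp add: additive_mod_def smul_K_add)
    show "additive_mod (T2 K) (\<lambda>a. tmap (smul K t) id (cop K a))"
      unfolding tmap_ext2 additive_mod_def ext2_simps(3)[symmetric] id_apply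
      using additive_mod_cop_K by (intro allI eqv_T2[OF f]) (simp add: additive_mod_def)
    fix s x
    have "cop K (smul K t (sg s x)) \<simeq>[T2 K] tmap (sg s) (sg s) (cop H (smul H t x))"
      unfolding smul_K_single by (rule cop_K_single)
    also have "\<dots> \<simeq>[T2 K] tmap (sg s) (sg s) (tmap (smul H t) id (cop H x))"
      unfolding tmap_ext2[of "sg s"]
      by (intro eqv_T2[OF _ Hb.cop_smul] balanced2_single balanced2_T2_frag_of)
    also have "\<dots> = tmap (smul K t) id (tmap (sg s) (sg s) (cop H x))"
      by (simp add: tmap_ext2 smul_K_single)
    also have "\<dots> \<simeq>[T2 K] tmap (smul K t) id (cop K (sg s x))"
      unfolding tmap_ext2[of "smul K t"] id_apply
      by (rule eqv_T2[OF f eqv_sym[OF cop_K_single]])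
    finally show "cop K (smul K t (sg s x)) \<simeq>[T2 K] tmap (smul K t) id (cop K (sg s x))" .
  qed
qed

text \<open>
  Elements of \<open>\<Gamma>\<close> are grouplike: \<open>\<Delta>(a g) = a1 g \<otimes> a2 g\<close>.
\<close>

lemma ext2_cop_K_single:
  assumes "balanced2 K N f"
  shows "ext2 f (cop K (sg g a)) \<simeq>[N] ext2 (\<lambda>x y. f (sg g x) (sg g y)) (cop H a)"
  using eqv_T2[OF assms cop_K_single] by simp

lemma ext2_cop_cop_K_single:
  assumes f: "balanced3 K N f"
  shows "ext2 (\<lambda>h c. ext2 (\<lambda>a b. f a b c) (cop K h)) (cop K (sg g x)) \<simeq>[N]
    ext2 (\<lambda>h c. ext2 (\<lambda>a b. f (sg g a) (sg g b) (sg g c)) (cop H h)) (cop H x)"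
proof -
  have f2: "balanced2 K N (\<lambda>a b. f a b c)" for c
    using f by (simp add: balanced2_def balanced3_def biadd_def triadd_def)
  have "ext2 (\<lambda>h c. ext2 (\<lambda>a b. f a b c) (cop K h)) (cop K (sg g x)) \<simeq>[N]
      ext2 (\<lambda>h c. ext2 (\<lambda>a b. f a b (sg g c)) (cop K (sg g h))) (cop H x)"
    by (rule ext2_cop_K_single[OF Kb.balanced2_cop_left[OF f]])
  also have "\<dots> \<simeq>[N] ext2 (\<lambda>h c. ext2 (\<lambda>a b. f (sg g a) (sg g b) (sg g c)) (cop H h)) (cop H x)"
    by (intro ext2_cong ext2_cop_K_single[OF f2])
  finally show ?thesis .
qed

subsection \<open>Modules over the smash product\<close>

abbreviation gact where "gact \<equiv> act_G H"

lemma act_single_single: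
  "left_module K act \<Longrightarrow> act (sg g a) (act (sg h b) m) = act (sg (g + h) (a \<cdot> \<alpha> g b)) m"
  using left_module.act_mul[of K act "sg g a" "sg h b" m] by simp

lemma gact_zero [simp]: "left_module K act \<Longrightarrow> gact act 0 m = m"
  using left_module.act_one[of K act m] by (simp add: act_G_def smash_def Let_def)

lemma gact_gact [simp]: "left_module K act \<Longrightarrow> gact act g (gact act h m) = gact act (g + h) m"
  by (simp add: act_G_def act_single_single)

lemma gact_act [simp]: "left_module K act \<Longrightarrow> gact act g (act (sg h a) m) = act (sg (g + h) (\<alpha> g a)) m"
  by (simp add: act_G_def act_single_single)

lemma gact_act_H: "left_module K act \<Longrightarrow> gact act g (act_H act h m) = act_H act (\<alpha> g h) (gact act g m)"
  by (simp add: act_G_def act_H_def act_single_single)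

lemma act_single: "left_module K act \<Longrightarrow> act (sg g a) m = act_H act a (gact act g m)"
  by (simp add: act_G_def act_H_def act_single_single)

lemma gact_add: "left_module K act \<Longrightarrow> gact act g (m + m') = gact act g m + gact act g m'"
  by (simp add: act_G_def left_module.act_add_right)

lemma left_module_act_H: "left_module K act \<Longrightarrow> left_module H (act_H act)"
proof
  assume M: "left_module K act"
  show "act_H act (f + f') l = act_H act f l + act_H act f' l" for f f' l
    by (simp add: act_H_def single_add left_module.act_add_left[OF M])
  show "act_H act f (l + l') = act_H act f l + act_H act f l'" for f l l'
    by (simp add: act_H_def left_module.act_add_right[OF M])
  show "act_H act (f \<cdot> f') l = act_H act f (act_H act f' l)" for f f' l
    by (simp add: act_H_def act_single_single[OF M])
  show "act_H act one l = l" for l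
    using gact_zero[OF M, of l] by (simp add: act_H_def act_G_def)
qed

end

section \<open>Linear substitutions and graded maps\<close>

definition linear_map :: "('k, 'h::ab_group_add) hopf_data \<Rightarrow> ('k, 'h'::ab_group_add) hopf_data \<Rightarrow> ('h \<Rightarrow> 'h') \<Rightarrow> bool"
  where "linear_map A B \<phi> \<longleftrightarrow> additive \<phi> \<and> (\<forall>t a. \<phi> (smul A t a) = smul B t (\<phi> a))"

lemma balanced2_linear_map:
  "balanced2 B N f \<Longrightarrow> linear_map A B \<phi> \<Longrightarrow> linear_map A B \<psi> \<Longrightarrow> balanced2 A N (\<lambda>a b. f (\<phi> a) (\<psi> b))"
  by (simp add: balanced2_def biadd_def additive_mod_def linear_map_def additive_def)

lemma balanced3_linear_map:
  "balanced3 B N f \<Longrightarrow> linear_map A B \<phi> \<Longrightarrow> linear_map A B \<psi> \<Longrightarrow> linear_map A B \<chi> \<Longrightarrow>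
    balanced3 A N (\<lambda>a b c. f (\<phi> a) (\<psi> b) (\<chi> c))"
  by (simp add: balanced3_def triadd_def additive_mod_def linear_map_def additive_def)

lemma linear_map_comp: "linear_map A B \<phi> \<Longrightarrow> linear_map B C \<psi> \<Longrightarrow> linear_map A C (\<lambda>a. \<psi> (\<phi> a))"
  by (simp add: linear_map_def additive_def)

lemma linear_map_id [simp, intro]: "linear_map A A (\<lambda>a. a)"
  by (simp add: linear_map_def additive_def)

lemma balanced2_zero [simp]: "balanced2 A N (\<lambda>a b. 0)"
  by (simp add: balanced2_def biadd_def additive_mod_def)

lemma balanced3_zero [simp]: "balanced3 A N (\<lambda>a b c. 0)"
  by (simp add: balanced3_def triadd_def additive_mod_def)

lemma balanced2_pure2: "balanced2 A (P2 A act) (\<lambda>a b. pure2 a b m)"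
  using balanced_mod2_pure2[of A act] by (simp add: balanced_mod2_def)

lemma balanced3_pure3: "balanced3 A (P3 A act) (\<lambda>a b c. pure3 a b c m)"
  using balanced_mod3_pure3[of A act] by (simp add: balanced_mod3_def)

lemma additive_mod_pure2: "additive_mod (P2 A act) (pure2 a b)"
  using balanced_mod2_pure2[of A act] by (simp add: balanced_mod2_def)

lemma additive_mod_pure3: "additive_mod (P3 A act) (pure3 a b c)"
  using balanced_mod3_pure3[of A act] by (simp add: balanced_mod3_def)

lemma pure2_act:
  "pure2 a b (act h m) \<simeq>[P2 A act] ext2 (\<lambda>h1 h2. pure2 (hmul A a h1) (hmul A b h2) m) (cop A h)"
  using balanced_mod2_pure2[of A act] unfolding balanced_mod2_def by blast

lemma pure3_act:
  "pure3 a b c (act h m) \<simeq>[P3 A act]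
    ext2 (\<lambda>h' h3. ext2 (\<lambda>h1 h2. pure3 (hmul A a h1) (hmul A b h2) (hmul A c h3) m) (cop A h')) (cop A h)"
  using balanced_mod3_pure3[of A act] unfolding balanced_mod3_def by blast

definition bigraded_sum where
  "bigraded_sum F x y = graded_sum (\<lambda>g a. graded_sum (\<lambda>h b. F g h a b) y) x"

definition trigraded_sum where
  "trigraded_sum F x y z = graded_sum (\<lambda>g a. bigraded_sum (\<lambda>h i b c. F g h i a b c) y z) x"

definition left_mult where "left_mult A f g = lift2 (\<lambda>a b m. pure2 (hmul A f a) (hmul A g b) m)"

definition flip2 where "flip2 = lift2 (\<lambda>a b m. pure2 b a m)"

definition flip12 where "flip12 = lift3 (\<lambda>a b c m. pure3 b a c m)"

context smash_setting begin

lemma linear_map_alpha: "linear_map H H (\<alpha> g)"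
  by (simp add: linear_map_def additive_def)

lemma linear_map_sg: "linear_map H K (sg g)"
  by (simp add: linear_map_def additive_def single_add smul_K_single)

subsection \<open>Balanced maps on the smash product\<close>

lemma biadd_bigraded_sum: "(\<And>g h. biadd N (F g h)) \<Longrightarrow> biadd N (bigraded_sum F)"
  unfolding bigraded_sum_def[abs_def] by (rule biadd_graded_sum2)

lemma bigraded_sum_single: "(\<And>g h. biadd N (F g h)) \<Longrightarrow> bigraded_sum F (sg g a) (sg h b) \<simeq>[N] F g h a b"
  unfolding bigraded_sum_def by (rule graded_sum2_single)

lemma additive_mod_bigraded_sum:
  "(\<And>g h a b. additive_mod N (\<lambda>m. F m g h a b)) \<Longrightarrow> additive_mod N (\<lambda>m. bigraded_sum (F m) x y)"
  unfolding bigraded_sum_def by (intro additive_mod_graded_sum_param)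

lemma triadd_trigraded_sum: "(\<And>g h i. triadd N (F g h i)) \<Longrightarrow> triadd N (trigraded_sum F)"
proof -
  assume F: "\<And>g h i. triadd N (F g h i)"
  have 1: "biadd N (bigraded_sum (\<lambda>h i b c. F g h i a b c))" for g a
    using F by (intro biadd_bigraded_sum) (simp add: triadd_def biadd_def)
  have 2: "additive_mod N (\<lambda>a. bigraded_sum (\<lambda>h i b c. F g h i a b c) y z)" for g y z
    using F by (intro additive_mod_bigraded_sum) (simp add: triadd_def)
  show ?thesis
    unfolding triadd_def trigraded_sum_def
    using 1 2 by (auto simp: biadd_def intro!: additive_mod_graded_sum additive_mod_graded_sum_param)
qed

lemma trigraded_sum_single:
  assumes F: "\<And>g h i. triadd N (F g h i)"
  shows "trigraded_sum F (sg g a) (sg h b) (sg i c) \<simeq>[N] F g h i a b c"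
proof -
  have "trigraded_sum F (sg g a) (sg h b) (sg i c) \<simeq>[N] bigraded_sum (\<lambda>h i b c. F g h i a b c) (sg h b) (sg i c)"
    unfolding trigraded_sum_def using F
    by (intro graded_sum_single[where F = "\<lambda>g a. bigraded_sum (\<lambda>h i b c. F g h i a b c) (sg h b) (sg i c)"]
        additive_mod_bigraded_sum)
      (simp add: triadd_def)
  also have "\<dots> \<simeq>[N] F g h i a b c"
    using F by (intro bigraded_sum_single) (simp add: triadd_def biadd_def)
  finally show ?thesis .
qed

lemma additive_mod_trigraded_sum:
  "(\<And>g h i a b c. additive_mod N (\<lambda>m. F m g h i a b c)) \<Longrightarrow> additive_mod N (\<lambda>m. trigraded_sum (F m) x y z)"
  unfolding trigraded_sum_def by (intro additive_mod_graded_sum_param additive_mod_bigraded_sum)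

lemma balanced2_bigraded_sum:
  assumes F: "\<And>g h. balanced2 H N (F g h)"
  shows "balanced2 K N (bigraded_sum F)"
proof -
  have b: "biadd N (F g h)" for g h using F by (rule balanced2_biadd)
  note b2 = biadd_bigraded_sum[of N F, OF b]
  have "bigraded_sum F (smul K t x) y \<simeq>[N] bigraded_sum F x (smul K t y)" for t x y
  proof (rule biadd_ext_single[where f = "\<lambda>x y. bigraded_sum F (smul K t x) y"])
    fix g a h b
    have "bigraded_sum F (sg g (smul H t a)) (sg h b) \<simeq>[N] F g h (smul H t a) b"
      by (rule bigraded_sum_single[OF b])
    also have "\<dots> \<simeq>[N] F g h a (smul H t b)" using F by (simp add: balanced2_def)
    also have "\<dots> \<simeq>[N] bigraded_sum F (sg g a) (sg h (smul H t b))"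
      by (rule eqv_sym[OF bigraded_sum_single[OF b]])
    finally show "bigraded_sum F (smul K t (sg g a)) (sg h b) \<simeq>[N] bigraded_sum F (sg g a) (smul K t (sg h b))"
      by (simp add: smul_K_single)
  qed (use b2 in \<open>simp_all add: biadd_def additive_mod_def smul_K_add\<close>)
  then show ?thesis using b2 by (simp add: balanced2_def)
qed

lemma balanced3_trigraded_sum:
  assumes F: "\<And>g h i. balanced3 H N (F g h i)"
  shows "balanced3 K N (trigraded_sum F)"
proof -
  have b: "triadd N (F g h i)" for g h i using F by (rule balanced3_triadd)
  note b3 = triadd_trigraded_sum[of N F, OF b]
  have "trigraded_sum F (smul K t x) y z \<simeq>[N] trigraded_sum F x (smul K t y) z" for t x y z
  proof (rule triadd_ext_single[where f = "\<lambda>x y z. trigraded_sum F (smul K t x) y z"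
        and g = "\<lambda>x y z. trigraded_sum F x (smul K t y) z"])
    fix g a h b i c
    have "trigraded_sum F (sg g (smul H t a)) (sg h b) (sg i c) \<simeq>[N] F g h i (smul H t a) b c"
      by (rule trigraded_sum_single[OF b])
    also have "\<dots> \<simeq>[N] F g h i a (smul H t b) c" using F by (simp add: balanced3_def)
    also have "\<dots> \<simeq>[N] trigraded_sum F (sg g a) (sg h (smul H t b)) (sg i c)"
      by (rule eqv_sym[OF trigraded_sum_single[OF b]])
    finally show "trigraded_sum F (smul K t (sg g a)) (sg h b) (sg i c) \<simeq>[N]
        trigraded_sum F (sg g a) (smul K t (sg h b)) (sg i c)"
      by (simp add: smul_K_single)
  qed (use b3 in \<open>simp_all add: triadd_def additive_mod_def smul_K_add\<close>)
  moreover have "trigraded_sum F x (smul K t y) z \<simeq>[N] trigraded_sum F x y (smul K t z)" for t x y z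
  proof (rule triadd_ext_single[where f = "\<lambda>x y z. trigraded_sum F x (smul K t y) z"
        and g = "\<lambda>x y z. trigraded_sum F x y (smul K t z)"])
    fix g a h b i c
    have "trigraded_sum F (sg g a) (sg h (smul H t b)) (sg i c) \<simeq>[N] F g h i a (smul H t b) c"
      by (rule trigraded_sum_single[OF b])
    also have "\<dots> \<simeq>[N] F g h i a b (smul H t c)" using F by (simp add: balanced3_def)
    also have "\<dots> \<simeq>[N] trigraded_sum F (sg g a) (sg h b) (sg i (smul H t c))"
      by (rule eqv_sym[OF trigraded_sum_single[OF b]])
    finally show "trigraded_sum F (sg g a) (smul K t (sg h b)) (sg i c) \<simeq>[N]
        trigraded_sum F (sg g a) (sg h b) (smul K t (sg i c))"
      by (simp add: smul_K_single)
  qed (use b3 in \<open>simp_all add: triadd_def additive_mod_def smul_K_add\<close>)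
  ultimately show ?thesis using b3 by (simp add: balanced3_def)
qed

text \<open>
  Linearity over the smash product only has to be checked on homogeneous elements \<open>a g\<close>, \<open>b h\<close>
  and \<open>u t\<close>, for which \<open>(a g) (h1 t) = a (g \<cdot> h1) g t\<close>: both sides of the condition are additive in
  all arguments.
\<close>

lemma balanced_mod2_bigraded_sum:
  assumes M: "left_module K act"
    and F: "\<And>g h m. balanced2 H N (\<lambda>a b. F g h a b m)"
    and Fm: "\<And>g h a b. additive_mod N (\<lambda>m. F g h a b m)"
    and act: "\<And>g h t a b u m. F g h a b (act (sg t u) m) \<simeq>[N]
      ext2 (\<lambda>h1 h2. F (g + t) (h + t) (a \<cdot> \<alpha> g h1) (b \<cdot> \<alpha> h h2) m) (cop H u)"
  shows "balanced_mod2 K act N (\<lambda>x y m. bigraded_sum (\<lambda>g h a b. F g h a b m) x y)"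
  unfolding balanced_mod2_def
proof (intro conjI allI)
  let ?F = "\<lambda>m. bigraded_sum (\<lambda>g h a b. F g h a b m)"
  have b: "biadd N (\<lambda>a b. F g h a b m)" for g h m using F by (rule balanced2_biadd)
  have B2: "balanced2 K N (?F m)" for m by (rule balanced2_bigraded_sum[OF F])
  then show "balanced2 K N (\<lambda>a b. ?F m a b)" for m .
  have b2: "biadd N (?F m)" for m using B2 by (rule balanced2_biadd)
  have mm: "additive_mod N (\<lambda>m. ?F m x y)" for x y by (rule additive_mod_bigraded_sum[OF Fm])
  then show "additive_mod N (\<lambda>m. ?F m x y)" for x y .
  fix x y k m
  show "?F (act k m) x y \<simeq>[N] ext2 (\<lambda>k1 k2. ?F m (hmul K x k1) (hmul K y k2)) (cop K k)"
  proof (rule triadd_ext_single[where f = "\<lambda>x y k. ?F (act k m) x y"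
        and g = "\<lambda>x y k. ext2 (\<lambda>k1 k2. ?F m (hmul K x k1) (hmul K y k2)) (cop K k)"])
    show "triadd N (\<lambda>x y k. ?F (act k m) x y)"
      using b2 mm by (simp add: triadd_def biadd_def additive_mod_def left_module.act_add_left[OF M])
    have "additive_mod N (\<lambda>x. ext2 (\<lambda>k1 k2. ?F m (hmul K x k1) (hmul K y k2)) z)"
        "additive_mod N (\<lambda>y. ext2 (\<lambda>k1 k2. ?F m (hmul K x k1) (hmul K y k2)) z)" for x y z
      by (intro additive_mod_ext2; use b2[of m] in \<open>simp add: biadd_def additive_mod_def hmul_K_add\<close>)+
    moreover have "additive_mod N (\<lambda>k. ext2 (\<lambda>k1 k2. ?F m (hmul K x k1) (hmul K y k2)) (cop K k))" for x y
      by (intro Kb.additive_mod_ext2_cop Kb.balanced2_mul_left B2)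
    ultimately show "triadd N (\<lambda>x y k. ext2 (\<lambda>k1 k2. ?F m (hmul K x k1) (hmul K y k2)) (cop K k))"
      by (simp add: triadd_def)
    fix s a t b r u
    have "?F (act (sg r u) m) (sg s a) (sg t b) \<simeq>[N] F s t a b (act (sg r u) m)"
      by (rule bigraded_sum_single[OF b])
    also note act
    also have "ext2 (\<lambda>h1 h2. F (s + r) (t + r) (a \<cdot> \<alpha> s h1) (b \<cdot> \<alpha> t h2) m) (cop H u) \<simeq>[N]
        ext2 (\<lambda>h1 h2. ?F m (hmul K (sg s a) (sg r h1)) (hmul K (sg t b) (sg r h2))) (cop H u)"
      by (intro ext2_cong) (unfold hmul_K_single, rule eqv_sym[OF bigraded_sum_single[OF b]])
    also have "\<dots> \<simeq>[N] ext2 (\<lambda>k1 k2. ?F m (hmul K (sg s a) k1) (hmul K (sg t b) k2)) (cop K (sg r u))"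
      by (rule eqv_sym[OF ext2_cop_K_single[OF Kb.balanced2_mul_left[OF B2]]])
    finally show "?F (act (sg r u) m) (sg s a) (sg t b) \<simeq>[N]
      ext2 (\<lambda>k1 k2. ?F m (hmul K (sg s a) k1) (hmul K (sg t b) k2)) (cop K (sg r u))" .
  qed
qed

lemma quadadd_ext_single:
  fixes f :: "('g \<Rightarrow>\<^sub>0 'h) \<Rightarrow> ('g \<Rightarrow>\<^sub>0 'h) \<Rightarrow> ('g \<Rightarrow>\<^sub>0 'h) \<Rightarrow> ('g \<Rightarrow>\<^sub>0 'h) \<Rightarrow> 'x::ab_group_add"
  assumes "\<And>w. triadd N (\<lambda>x y z. f x y z w)" "\<And>w. triadd N (\<lambda>x y z. g x y z w)"
    and "\<And>x y z. additive_mod N (f x y z)" "\<And>x y z. additive_mod N (g x y z)"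
    and "\<And>s a t b u c v d. f (sg s a) (sg t b) (sg u c) (sg v d) \<simeq>[N] g (sg s a) (sg t b) (sg u c) (sg v d)"
  shows "f x y z w \<simeq>[N] g x y z w"
proof -
  have "f x y z (sg v d) \<simeq>[N] g x y z (sg v d)" for v d
    by (rule triadd_ext_single[where f = "\<lambda>x y z. f x y z (sg v d)" and g = "\<lambda>x y z. g x y z (sg v d)",
        OF assms(1,2,5)])
  then show ?thesis
    by (rule additive_mod_ext_single[where f = "f x y z" and g = "g x y z", OF assms(3,4)])
qed

lemma balanced_mod3_trigraded_sum:
  assumes M: "left_module K act"
    and F: "\<And>g h i m. balanced3 H N (\<lambda>a b c. F g h i a b c m)"
    and Fm: "\<And>g h i a b c. additive_mod N (\<lambda>m. F g h i a b c m)"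
    and act: "\<And>g h i t a b c u m. F g h i a b c (act (sg t u) m) \<simeq>[N]
      ext2 (\<lambda>h' h3. ext2 (\<lambda>h1 h2. F (g + t) (h + t) (i + t) (a \<cdot> \<alpha> g h1) (b \<cdot> \<alpha> h h2) (c \<cdot> \<alpha> i h3) m)
        (cop H h')) (cop H u)"
  shows "balanced_mod3 K act N (\<lambda>x y z m. trigraded_sum (\<lambda>g h i a b c. F g h i a b c m) x y z)"
  unfolding balanced_mod3_def
proof (intro conjI allI)
  let ?F = "\<lambda>m. trigraded_sum (\<lambda>g h i a b c. F g h i a b c m)"
  let ?G = "\<lambda>m x y z. \<lambda>k1 k2 k3. ?F m (hmul K x k1) (hmul K y k2) (hmul K z k3)"
  have b: "triadd N (\<lambda>a b c. F g h i a b c m)" for g h i m using F by (rule balanced3_triadd)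
  have B3: "balanced3 K N (?F m)" for m by (rule balanced3_trigraded_sum[OF F])
  then show "balanced3 K N (\<lambda>a b c. ?F m a b c)" for m .
  have b3: "triadd N (?F m)" for m using B3 by (rule balanced3_triadd)
  have mm: "additive_mod N (\<lambda>m. ?F m x y z)" for x y z by (rule additive_mod_trigraded_sum[OF Fm])
  then show "additive_mod N (\<lambda>m. ?F m x y z)" for x y z .
  have G3: "balanced3 K N (?G m x y z)" for m x y z by (rule Kb.balanced3_mul_left[OF B3])
  fix x y z k m
  show "?F (act k m) x y z \<simeq>[N]
    ext2 (\<lambda>k' k3. ext2 (\<lambda>k1 k2. ?G m x y z k1 k2 k3) (cop K k')) (cop K k)"
  proof (rule quadadd_ext_single[where f = "\<lambda>x y z k. ?F (act k m) x y z"
        and g = "\<lambda>x y z k. ext2 (\<lambda>k' k3. ext2 (\<lambda>k1 k2. ?G m x y z k1 k2 k3) (cop K k')) (cop K k)"])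
    show "triadd N (\<lambda>x y z. ?F (act k m) x y z)" for k by (rule b3)
    show "additive_mod N (\<lambda>k. ?F (act k m) x y z)" for x y z
      using mm by (simp add: additive_mod_def left_module.act_add_left[OF M])
    show "triadd N (\<lambda>x y z. ext2 (\<lambda>k' k3. ext2 (\<lambda>k1 k2. ?G m x y z k1 k2 k3) (cop K k')) (cop K k))" for k
      unfolding triadd_def
      by (intro conjI allI additive_mod_ext2) (use b3[of m] in \<open>simp_all add: triadd_def additive_mod_def hmul_K_add\<close>)
    show "additive_mod N (\<lambda>k. ext2 (\<lambda>k' k3. ext2 (\<lambda>k1 k2. ?G m x y z k1 k2 k3) (cop K k')) (cop K k))" for x y z
      by (intro Kb.additive_mod_ext2_cop Kb.balanced2_cop_left G3)
    fix s a t b v c r u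
    have "?F (act (sg r u) m) (sg s a) (sg t b) (sg v c) \<simeq>[N] F s t v a b c (act (sg r u) m)"
      by (rule trigraded_sum_single[OF b])
    also note act
    also have "ext2 (\<lambda>h' h3. ext2 (\<lambda>h1 h2. F (s + r) (t + r) (v + r) (a \<cdot> \<alpha> s h1) (b \<cdot> \<alpha> t h2) (c \<cdot> \<alpha> v h3) m)
          (cop H h')) (cop H u) \<simeq>[N]
        ext2 (\<lambda>h' h3. ext2 (\<lambda>h1 h2. ?G m (sg s a) (sg t b) (sg v c) (sg r h1) (sg r h2) (sg r h3))
          (cop H h')) (cop H u)"
      by (intro ext2_cong) (unfold hmul_K_single, rule eqv_sym[OF trigraded_sum_single[OF b]])
    also have "\<dots> \<simeq>[N]
        ext2 (\<lambda>k' k3. ext2 (\<lambda>k1 k2. ?G m (sg s a) (sg t b) (sg v c) k1 k2 k3) (cop K k')) (cop K (sg r u))"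
      by (rule eqv_sym[OF ext2_cop_cop_K_single[OF G3]])
    finally show "?F (act (sg r u) m) (sg s a) (sg t b) (sg v c) \<simeq>[N]
        ext2 (\<lambda>k' k3. ext2 (\<lambda>k1 k2. ?G m (sg s a) (sg t b) (sg v c) k1 k2 k3) (cop K k')) (cop K (sg r u))" .
  qed
qed

end

section \<open>Sums of components\<close>

text \<open>
  The endomorphisms \<open>E s\<close> will be the projections onto the summands of a direct sum, and the
  statement is that \<open>x\<close> is the sum of its finitely many components.
\<close>

definition decomposed :: "'b::ab_group_add set \<Rightarrow> ('s \<Rightarrow> 'b \<Rightarrow> 'b) \<Rightarrow> 'b \<Rightarrow> bool" where
  "decomposed N E x \<longleftrightarrow> (\<exists>S. finite S \<and> (\<forall>s. s \<notin> S \<longrightarrow> E s x \<simeq>[N] 0) \<and> x \<simeq>[N] (\<Sum>s\<in>S. E s x))"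

lemma decomposed_superset:
  assumes "finite T" "S \<subseteq> T" "\<And>s. s \<notin> S \<Longrightarrow> E s x \<simeq>[N] 0" "x \<simeq>[N] (\<Sum>s\<in>S. E s x)"
  shows "x \<simeq>[N] (\<Sum>s\<in>T. E s x)"
proof -
  have "(\<Sum>s\<in>T - S. E s x) \<simeq>[N] (\<Sum>s\<in>T - S. 0)"
    using assms(3) by (intro eqv_sum) auto
  then have "x + 0 \<simeq>[N] (\<Sum>s\<in>S. E s x) + (\<Sum>s\<in>T - S. E s x)"
    by (intro eqv_add assms(4)) (simp add: eqv_sym)
  then show ?thesis
    using assms(1,2) by (simp add: sum.subset_diff[OF assms(2,1)] add.commute)
qed

lemma decomposed_diff:
  assumes E: "\<And>s. additive (E s)" and "decomposed N E x" "decomposed N E y"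
  shows "decomposed N E (x - y)"
proof -
  obtain S T where S: "finite S" "\<And>s. s \<notin> S \<Longrightarrow> E s x \<simeq>[N] 0" "x \<simeq>[N] (\<Sum>s\<in>S. E s x)"
    and T: "finite T" "\<And>s. s \<notin> T \<Longrightarrow> E s y \<simeq>[N] 0" "y \<simeq>[N] (\<Sum>s\<in>T. E s y)"
    using assms(2,3) unfolding decomposed_def by auto
  have "x \<simeq>[N] (\<Sum>s\<in>S \<union> T. E s x)" "y \<simeq>[N] (\<Sum>s\<in>S \<union> T. E s y)"
    using S T by (intro decomposed_superset[of "S \<union> T" S] decomposed_superset[of "S \<union> T" T]; simp)+
  then have "x - y \<simeq>[N] (\<Sum>s\<in>S \<union> T. E s (x - y))"
    unfolding additive.diff[OF E] sum_subtractf by (rule eqv_diff)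
  moreover have "E s (x - y) \<simeq>[N] 0" if "s \<notin> S \<union> T" for s
    using eqv_diff[OF S(2) T(2), of s s] that by (simp add: additive.diff[OF E])
  ultimately show ?thesis
    using S(1) T(1) unfolding decomposed_def by (intro exI[of _ "S \<union> T"]) simp
qed

lemma decomposed_eqv:
  assumes E: "\<And>s. hom_mod N N (E s)" and xy: "x \<simeq>[N] y" and "decomposed N E x"
  shows "decomposed N E y"
proof -
  obtain S where S: "finite S" "\<And>s. s \<notin> S \<Longrightarrow> E s x \<simeq>[N] 0" "x \<simeq>[N] (\<Sum>s\<in>S. E s x)"
    using assms(3) unfolding decomposed_def by auto
  have e: "E s y \<simeq>[N] E s x" for s
    by (rule hom_modD[OF E eqv_sym[OF xy]])
  have "y \<simeq>[N] (\<Sum>s\<in>S. E s y)"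
    by (rule eqv_trans[OF eqv_sym[OF xy] eqv_trans[OF S(3) eqv_sum[OF eqv_sym[OF e]]]])
  then show ?thesis
    using S(1) eqv_trans[OF e S(2)] unfolding decomposed_def by blast
qed

lemma decomposed_single:
  assumes "\<And>s. E s x \<simeq>[N] (if s = r then x else 0)"
  shows "decomposed N E x"
proof -
  have "E s x \<simeq>[N] 0" if "s \<notin> {r}" for s
    using assms[of s] that by simp
  moreover have "x \<simeq>[N] (\<Sum>s\<in>{r}. E s x)"
    using assms[of r] by (simp add: eqv_sym)
  ultimately show ?thesis
    unfolding decomposed_def by blast
qed

lemma decomposed_eqv_zero:
  assumes "decomposed N E x" "\<And>s. E s x \<simeq>[N] 0"
  shows "x \<simeq>[N] 0"
proof -
  obtain S where "x \<simeq>[N] (\<Sum>s\<in>S. E s x)" using assms(1) unfolding decomposed_def by auto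
  also have "\<dots> \<simeq>[N] (\<Sum>s\<in>S. 0)" by (intro eqv_sum assms(2))
  finally show ?thesis by simp
qed

lemma additive_mod_induct_single:
  fixes f :: "('g \<Rightarrow>\<^sub>0 'h::ab_group_add) \<Rightarrow> 'b::ab_group_add"
  assumes P: "\<And>x y. x \<simeq>[N] y \<Longrightarrow> P x \<Longrightarrow> P y" "\<And>x y. P x \<Longrightarrow> P y \<Longrightarrow> P (x - y)"
    and f: "additive_mod N f" "\<And>g a. P (f (sg g a))"
  shows "P (f x)"
proof (induction x rule: single_induct)
  case zero
  have "P (f (sg undefined 0))" by (rule f(2))
  then show ?case by simp
next
  case (add x y)
  have "P (0 - f y)"
    using P(2)[OF P(2)[OF add(2) add(2)] add(2)] by simp
  from P(2)[OF add(1) this] have "P (f x + f y)" by simp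
  then show ?case by (rule P(1)[OF eqv_sym[OF additive_mod_add[OF f(1)]]])
qed (rule f(2))

text \<open>
  Elements \<open>(a g \<otimes> b h) \<otimes> m\<close> generate, so a property that respects the relations and
  differences only has to be checked on them.
\<close>

lemma frag2_induct_single:
  fixes x :: "(('g \<Rightarrow>\<^sub>0 'h::ab_group_add), 'm::ab_group_add) frag2"
  assumes P: "\<And>x y. x \<simeq>[P2 A act] y \<Longrightarrow> P x \<Longrightarrow> P y" "\<And>x y. P x \<Longrightarrow> P y \<Longrightarrow> P (x - y)"
    and s: "\<And>g a h b m. P (pure2 (sg g a) (sg h b) m)"
  shows "P x"
proof -
  have b: "additive_mod (P2 A act) (\<lambda>a. pure2 a b m)" "additive_mod (P2 A act) (\<lambda>b. pure2 a b m)" for a b m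
    using balanced2_pure2[of A act m] by (auto simp: balanced2_def biadd_def)
  have p: "P (pure2 a (sg h b) m)" for a h b m
    by (rule additive_mod_induct_single[of "P2 A act" P "\<lambda>a. pure2 a (sg h b) m", OF P b(1) s])
  have pure: "P (pure2 a b m)" for a b m
    by (rule additive_mod_induct_single[of "P2 A act" P "\<lambda>b. pure2 a b m", OF P b(2) p])
  have zero: "P 0"
    using P(2)[OF pure pure] by (metis diff_self)
  have "P (lift2 pure2 x)"
  proof (induction x rule: frag_induct)
    case (one x)
    obtain X m where x: "x = (X, m)" by fastforce
    have "P (ext2 (\<lambda>a b. pure2 a b m) X)"
      by (induction X rule: frag_induct) (auto simp: zero pure P(2))
    then show ?case by (simp add: x lift2_def)
  qed (auto simp: zero P(2))
  then show ?thesis by (rule P(1)[OF lift2_pure2])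
qed

lemma frag3_induct_single:
  fixes x :: "(('g \<Rightarrow>\<^sub>0 'h::ab_group_add), 'm::ab_group_add) frag3"
  assumes P: "\<And>x y. x \<simeq>[P3 A act] y \<Longrightarrow> P x \<Longrightarrow> P y" "\<And>x y. P x \<Longrightarrow> P y \<Longrightarrow> P (x - y)"
    and s: "\<And>g a h b i c m.
      P (pure3 (sg g a) (sg h b) (sg i c) m)"
  shows "P x"
proof -
  have b: "additive_mod (P3 A act) (\<lambda>a. pure3 a b c m)" "additive_mod (P3 A act) (\<lambda>b. pure3 a b c m)"
      "additive_mod (P3 A act) (\<lambda>c. pure3 a b c m)" for a b c m
    using balanced3_pure3[of A act m] by (auto simp: balanced3_def triadd_def)
  have p: "P (pure3 a (sg h b) (sg i c) m)" for a h b i c m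
    by (rule additive_mod_induct_single[of "P3 A act" P
        "\<lambda>a. pure3 a (sg h b) (sg i c) m", OF P b(1) s])
  have q: "P (pure3 a b (sg i c) m)" for a b i c m
    by (rule additive_mod_induct_single[of "P3 A act" P "\<lambda>b. pure3 a b (sg i c) m", OF P b(2) p])
  have pure: "P (pure3 a b c m)" for a b c m
    by (rule additive_mod_induct_single[of "P3 A act" P "\<lambda>c. pure3 a b c m", OF P b(3) q])
  have zero: "P 0"
    using P(2)[OF pure pure] by (metis diff_self)
  have "P (lift3 pure3 x)"
  proof (induction x rule: frag_induct)
    case (one x)
    obtain X m where x: "x = (X, m)" by fastforce
    have "P (ext3 (\<lambda>a b c. pure3 a b c m) X)"
      by (induction X rule: frag_induct) (auto simp: zero pure P(2))
    then show ?case by (simp add: x lift3_def)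
  qed (auto simp: zero P(2))
  then show ?thesis by (rule P(1)[OF lift3_pure3])
qed

lemma left_diff_eq: "s + g = (c::'a::group_add) \<longleftrightarrow> g = - s + c"
  by (metis add_minus_cancel minus_add_cancel)

context smash_setting begin

abbreviation PH where "PH act \<equiv> P2 H (act_H act)"
abbreviation PK where "PK act \<equiv> P2 K act"
abbreviation QH where "QH act \<equiv> P3 H (act_H act)"
abbreviation QK where "QK act \<equiv> P3 K act"

lemmas group_simps = add.assoc minus_add left_diff_eq

lemma ext2_cop_one:
  assumes "balanced2 H N f"
  shows "ext2 f (cop H one) \<simeq>[N] f one one"
  using eqv_T2[OF assms cop_eqvI[OF hopf.comul_one]] by simp

lemma ext2_cop_cop_one:
  assumes f: "balanced3 H N f"
  shows "ext2 (\<lambda>h c. ext2 (\<lambda>a b. f a b c) (cop H h)) (cop H one) \<simeq>[N] f one one one"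
proof -
  have "balanced2 H N (\<lambda>a b. f a b c)" for c
    using f by (simp add: balanced2_def balanced3_def biadd_def triadd_def)
  from eqv_trans[OF ext2_cop_one[OF Hb.balanced2_cop_left[OF f]] ext2_cop_one[OF this]] show ?thesis .
qed

text \<open>
  Moving \<open>t \<in> \<Gamma>\<close> across the tensor product multiplies both factors by \<open>t\<close>, since \<open>\<Delta>(t) = t \<otimes> t\<close>.
\<close>

lemma pure2_gact:
  assumes "left_module K act"
  shows "pure2 (sg g a) (sg h b) (gact act t m) \<simeq>[PK act] pure2 (sg (g + t) a) (sg (h + t) b) m"
proof -
  let ?f = "\<lambda>x y. pure2 (hmul K (sg g a) x) (hmul K (sg h b) y) m"
  have f: "balanced2 K (PK act) ?f" by (rule Kb.balanced2_mul_left[OF balanced2_pure2])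
  have "pure2 (sg g a) (sg h b) (gact act t m) \<simeq>[PK act] ext2 ?f (cop K (sg t one))"
    unfolding act_G_def by (rule pure2_act)
  also have "\<dots> \<simeq>[PK act] ext2 (\<lambda>x y. ?f (sg t x) (sg t y)) (cop H one)"
    by (rule ext2_cop_K_single[OF f])
  also have "\<dots> \<simeq>[PK act] ?f (sg t one) (sg t one)"
    by (rule ext2_cop_one[OF balanced2_single[OF f]])
  finally show ?thesis by simp
qed

lemma pure3_gact:
  assumes "left_module K act"
  shows "pure3 (sg g a) (sg h b) (sg i c) (gact act t m) \<simeq>[QK act]
    pure3 (sg (g + t) a) (sg (h + t) b) (sg (i + t) c) m"
proof -
  let ?f = "\<lambda>x y z. pure3 (hmul K (sg g a) x) (hmul K (sg h b) y) (hmul K (sg i c) z) m"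
  have f: "balanced3 K (QK act) ?f" by (rule Kb.balanced3_mul_left[OF balanced3_pure3])
  have "pure3 (sg g a) (sg h b) (sg i c) (gact act t m) \<simeq>[QK act]
      ext2 (\<lambda>h' h3. ext2 (\<lambda>h1 h2. ?f h1 h2 h3) (cop K h')) (cop K (sg t one))"
    unfolding act_G_def by (rule pure3_act)
  also have "\<dots> \<simeq>[QK act]
      ext2 (\<lambda>h' h3. ext2 (\<lambda>h1 h2. ?f (sg t h1) (sg t h2) (sg t h3)) (cop H h')) (cop H one)"
    by (rule ext2_cop_cop_K_single[OF f])
  also have "\<dots> \<simeq>[QK act] ?f (sg t one) (sg t one) (sg t one)"
    by (rule ext2_cop_cop_one[OF balanced3_single[OF f]])
  finally show ?thesis by simp
qed

section \<open>Homogeneous components\<close>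

text \<open>
  The component of degree \<open>\<gamma>\<close>: if \<open>g = \<gamma> h\<close> then
  \<open>(a g \<otimes> b h) \<otimes> m = (a \<gamma> \<otimes> b) \<otimes> h m = (\<gamma> \<otimes> 1) ((\<gamma>\<inverse> \<cdot> a \<otimes> b) \<otimes> h m)\<close>, and the factor
  \<open>\<gamma> \<otimes> 1\<close> is dropped.
\<close>

definition pi2 where
  "pi2 act \<gamma> = lift2 (\<lambda>x y m. bigraded_sum (\<lambda>g h a b.
     if g = \<gamma> + h then pure2 (\<alpha> (- \<gamma>) a) b (gact act h m) else 0) x y)"

text \<open>
  As for two factors, normalised so that the last factor has trivial degree.
\<close>

definition pi3 where
  "pi3 act \<gamma> \<delta> = lift3 (\<lambda>x y z m. trigraded_sum (\<lambda>g h i a b c.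
     if g = \<gamma> + i \<and> h = \<delta> + i then pure3 (\<alpha> (- \<gamma>) a) (\<alpha> (- \<delta>) b) c (gact act i m) else 0) x y z)"

text \<open>
  Left multiplication by \<open>\<gamma> \<otimes> 1\<close>, using \<open>\<gamma> a = (\<gamma> \<cdot> a) \<gamma>\<close>.
\<close>

definition iota2 where
  "iota2 \<gamma> = lift2 (\<lambda>a b m. pure2 (sg \<gamma> (\<alpha> \<gamma> a)) (sg 0 b) m)"

definition iota3 where
  "iota3 \<gamma> \<delta> = lift3 (\<lambda>a b c m. pure3 (sg \<gamma> (\<alpha> \<gamma> a)) (sg \<delta> (\<alpha> \<delta> b)) (sg 0 c) m)"

lemma additive_pi2: "additive (pi2 act \<gamma>)"
  unfolding pi2_def by (rule additive_lift2)

lemma additive_pi3: "additive (pi3 act \<gamma> \<delta>)"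
  unfolding pi3_def by (rule additive_lift3)

lemma balanced2_pi2: "balanced2 H (PH act)
  (\<lambda>a b. if g = \<gamma> + h then pure2 (\<alpha> (- \<gamma>) a) b (gact act h m) else 0)"
  by (cases "g = \<gamma> + h") (auto intro: balanced2_linear_map[OF balanced2_pure2 linear_map_alpha linear_map_id])

lemma balanced3_pi3: "balanced3 H (QH act)
  (\<lambda>a b c. if g = \<gamma> + i \<and> h = \<delta> + i then pure3 (\<alpha> (- \<gamma>) a) (\<alpha> (- \<delta>) b) c (gact act i m) else 0)"
  by (cases "g = \<gamma> + i \<and> h = \<delta> + i")
    (auto intro: balanced3_linear_map[OF balanced3_pure3 linear_map_alpha linear_map_alpha linear_map_id])

text \<open>
  For the action of \<open>u t\<close> on \<open>m\<close> the degree \<open>g h\<inverse>\<close> is unchanged because \<open>g\<close> and \<open>h\<close> are both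
  multiplied by \<open>t\<close> on the right; the twist by \<open>\<gamma>\<inverse>\<close> turns \<open>a (g \<cdot> h1)\<close> into
  \<open>(\<gamma>\<inverse> \<cdot> a) (h \<cdot> h1)\<close>, which matches the second factor \<open>b (h \<cdot> h2)\<close>, so that both are multiplied by
  \<open>\<Delta>(h \<cdot> u)\<close>.
\<close>

lemma hom_pi2:
  fixes act :: "('g \<Rightarrow>\<^sub>0 'h) \<Rightarrow> 'm::ab_group_add \<Rightarrow> 'm"
  assumes M: "left_module K act"
  shows "hom_mod (PK act) (PH act) (pi2 act \<gamma>)"
  unfolding pi2_def
proof (intro hom_mod_P2 balanced_mod2_bigraded_sum[OF M] balanced2_pi2)
  fix g h a b
  show "additive_mod (PH act) (\<lambda>m. if g = \<gamma> + h then pure2 (\<alpha> (- \<gamma>) a) b (gact act h m) else 0)"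
    using additive_mod_pure2[of H "act_H act"] by (simp add: additive_mod_def gact_add[OF M])
next
  fix g h t a b u and m :: 'm
  show "(if g = \<gamma> + h then pure2 (\<alpha> (- \<gamma>) a) b (gact act h (act (sg t u) m)) else 0) \<simeq>[PH act]
    ext2 (\<lambda>h1 h2. if g + t = \<gamma> + (h + t)
      then pure2 (\<alpha> (- \<gamma>) (a \<cdot> \<alpha> g h1)) (b \<cdot> \<alpha> h h2) (gact act (h + t) m) else 0) (cop H u)"
  proof (cases "g = \<gamma> + h")
    case True
    let ?f = "\<lambda>x y. pure2 (\<alpha> (- \<gamma>) a \<cdot> x) (b \<cdot> y) (gact act (h + t) m)"
    have f: "balanced2 H (PH act) ?f" by (rule Hb.balanced2_mul_left[OF balanced2_pure2])
    have "pure2 (\<alpha> (- \<gamma>) a) b (gact act h (act (sg t u) m)) =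
        pure2 (\<alpha> (- \<gamma>) a) b (act_H act (\<alpha> h u) (gact act (h + t) m))"
      by (simp add: M act_single[OF M, of "h + t"])
    also have "\<dots> \<simeq>[PH act] ext2 ?f (cop H (\<alpha> h u))"
      by (rule pure2_act)
    also have "\<dots> \<simeq>[PH act] ext2 (\<lambda>x y. ?f (\<alpha> h x) (\<alpha> h y)) (cop H u)"
      by (rule ext2_cop_alpha[OF f])
    finally show ?thesis by (simp add: True add.assoc)
  qed (simp add: add.assoc[symmetric])
qed

lemma hom_pi3:
  fixes act :: "('g \<Rightarrow>\<^sub>0 'h) \<Rightarrow> 'm::ab_group_add \<Rightarrow> 'm"
  assumes M: "left_module K act"
  shows "hom_mod (QK act) (QH act) (pi3 act \<gamma> \<delta>)"
  unfolding pi3_def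
proof (intro hom_mod_P3 balanced_mod3_trigraded_sum[OF M] balanced3_pi3)
  fix g h i a b c
  show "additive_mod (QH act) (\<lambda>m. if g = \<gamma> + i \<and> h = \<delta> + i
      then pure3 (\<alpha> (- \<gamma>) a) (\<alpha> (- \<delta>) b) c (gact act i m) else 0)"
    using additive_mod_pure3[of H "act_H act"]
    by (cases "g = \<gamma> + i \<and> h = \<delta> + i") (auto simp: additive_mod_def gact_add[OF M])
next
  fix g h i t a b c u and m :: 'm
  show "(if g = \<gamma> + i \<and> h = \<delta> + i
      then pure3 (\<alpha> (- \<gamma>) a) (\<alpha> (- \<delta>) b) c (gact act i (act (sg t u) m)) else 0) \<simeq>[QH act]
    ext2 (\<lambda>h' h3. ext2 (\<lambda>h1 h2. if g + t = \<gamma> + (i + t) \<and> h + t = \<delta> + (i + t)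
      then pure3 (\<alpha> (- \<gamma>) (a \<cdot> \<alpha> g h1)) (\<alpha> (- \<delta>) (b \<cdot> \<alpha> h h2)) (c \<cdot> \<alpha> i h3) (gact act (i + t) m)
      else 0) (cop H h')) (cop H u)"
  proof (cases "g = \<gamma> + i \<and> h = \<delta> + i")
    case True
    let ?f = "\<lambda>x y z. pure3 (\<alpha> (- \<gamma>) a \<cdot> x) (\<alpha> (- \<delta>) b \<cdot> y) (c \<cdot> z) (gact act (i + t) m)"
    have f: "balanced3 H (QH act) ?f" by (rule Hb.balanced3_mul_left[OF balanced3_pure3])
    then have f2: "balanced2 H (QH act) (\<lambda>x y. ?f x y z)" for z
      by (simp add: balanced2_def balanced3_def biadd_def triadd_def)
    have "pure3 (\<alpha> (- \<gamma>) a) (\<alpha> (- \<delta>) b) c (gact act i (act (sg t u) m)) =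
        pure3 (\<alpha> (- \<gamma>) a) (\<alpha> (- \<delta>) b) c (act_H act (\<alpha> i u) (gact act (i + t) m))"
      by (simp add: M act_single[OF M, of "i + t"])
    also have "\<dots> \<simeq>[QH act] ext2 (\<lambda>h' z. ext2 (\<lambda>x y. ?f x y z) (cop H h')) (cop H (\<alpha> i u))"
      by (rule pure3_act)
    also have "\<dots> \<simeq>[QH act] ext2 (\<lambda>h' z. ext2 (\<lambda>x y. ?f x y (\<alpha> i z)) (cop H (\<alpha> i h'))) (cop H u)"
      by (rule ext2_cop_alpha[OF Hb.balanced2_cop_left[OF f]])
    also have "\<dots> \<simeq>[QH act]
        ext2 (\<lambda>h' z. ext2 (\<lambda>x y. ?f (\<alpha> i x) (\<alpha> i y) (\<alpha> i z)) (cop H h')) (cop H u)"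
      by (intro ext2_cong ext2_cop_alpha[OF f2])
    finally show ?thesis by (simp add: True add.assoc)
  qed (auto simp: add.assoc[symmetric])
qed

lemma pi2_pure: "pi2 act \<gamma> (pure2 (sg g a) (sg h b) m) \<simeq>[PH act]
    (if g = \<gamma> + h then pure2 (\<alpha> (- \<gamma>) a) b (gact act h m) else 0)"
  unfolding pi2_def lift2_simps by (rule bigraded_sum_single[OF balanced2_biadd[OF balanced2_pi2]])

lemma pi3_pure: "pi3 act \<gamma> \<delta> (pure3 (sg g a) (sg h b) (sg i c) m) \<simeq>[QH act]
    (if g = \<gamma> + i \<and> h = \<delta> + i then pure3 (\<alpha> (- \<gamma>) a) (\<alpha> (- \<delta>) b) c (gact act i m) else 0)"
  unfolding pi3_def lift3_simps by (rule trigraded_sum_single[OF balanced3_triadd[OF balanced3_pi3]])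

lemma hom_iota2:
  fixes act :: "('g \<Rightarrow>\<^sub>0 'h) \<Rightarrow> 'm::ab_group_add \<Rightarrow> 'm"
  shows "hom_mod (PH act) (PK act) (iota2 \<gamma>)"
  unfolding iota2_def
proof (rule hom_mod_P2, unfold balanced_mod2_def, intro conjI allI)
  show "balanced2 H (PK act) (\<lambda>a b. pure2 (sg \<gamma> (\<alpha> \<gamma> a)) (sg 0 b) m)" for m
    by (intro balanced2_linear_map[OF balanced2_pure2] linear_map_sg linear_map_comp[OF linear_map_alpha])
  show "additive_mod (PK act) (pure2 (sg \<gamma> (\<alpha> \<gamma> a)) (sg 0 b))" for a b
    by (rule additive_mod_pure2)
  fix a b h and m :: 'm
  let ?f = "\<lambda>x y. pure2 (hmul K (sg \<gamma> (\<alpha> \<gamma> a)) x) (hmul K (sg 0 b) y) m"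
  have "pure2 (sg \<gamma> (\<alpha> \<gamma> a)) (sg 0 b) (act_H act h m) \<simeq>[PK act] ext2 ?f (cop K (sg 0 h))"
    unfolding act_H_def by (rule pure2_act)
  also have "\<dots> \<simeq>[PK act] ext2 (\<lambda>x y. ?f (sg 0 x) (sg 0 y)) (cop H h)"
    by (intro ext2_cop_K_single Kb.balanced2_mul_left balanced2_pure2)
  finally show "pure2 (sg \<gamma> (\<alpha> \<gamma> a)) (sg 0 b) (act_H act h m) \<simeq>[PK act]
      ext2 (\<lambda>h1 h2. pure2 (sg \<gamma> (\<alpha> \<gamma> (a \<cdot> h1))) (sg 0 (b \<cdot> h2)) m) (cop H h)"
    by simp
qed

lemma hom_iota3:
  fixes act :: "('g \<Rightarrow>\<^sub>0 'h) \<Rightarrow> 'm::ab_group_add \<Rightarrow> 'm"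
  shows "hom_mod (QH act) (QK act) (iota3 \<gamma> \<delta>)"
  unfolding iota3_def
proof (rule hom_mod_P3, unfold balanced_mod3_def, intro conjI allI)
  show "balanced3 H (QK act) (\<lambda>a b c. pure3 (sg \<gamma> (\<alpha> \<gamma> a)) (sg \<delta> (\<alpha> \<delta> b)) (sg 0 c) m)" for m
    by (intro balanced3_linear_map[OF balanced3_pure3] linear_map_sg linear_map_comp[OF linear_map_alpha])
  show "additive_mod (QK act) (pure3 (sg \<gamma> (\<alpha> \<gamma> a)) (sg \<delta> (\<alpha> \<delta> b)) (sg 0 c))" for a b c
    by (rule additive_mod_pure3)
  fix a b c h and m :: 'm
  let ?f = "\<lambda>x y z. pure3 (hmul K (sg \<gamma> (\<alpha> \<gamma> a)) x) (hmul K (sg \<delta> (\<alpha> \<delta> b)) y) (hmul K (sg 0 c) z) m"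
  have "pure3 (sg \<gamma> (\<alpha> \<gamma> a)) (sg \<delta> (\<alpha> \<delta> b)) (sg 0 c) (act_H act h m) \<simeq>[QK act]
      ext2 (\<lambda>h' z. ext2 (\<lambda>x y. ?f x y z) (cop K h')) (cop K (sg 0 h))"
    unfolding act_H_def by (rule pure3_act)
  also have "\<dots> \<simeq>[QK act] ext2 (\<lambda>h' z. ext2 (\<lambda>x y. ?f (sg 0 x) (sg 0 y) (sg 0 z)) (cop H h')) (cop H h)"
    by (intro ext2_cop_cop_K_single Kb.balanced3_mul_left balanced3_pure3)
  finally show "pure3 (sg \<gamma> (\<alpha> \<gamma> a)) (sg \<delta> (\<alpha> \<delta> b)) (sg 0 c) (act_H act h m) \<simeq>[QK act]
      ext2 (\<lambda>h' h3. ext2 (\<lambda>h1 h2. pure3 (sg \<gamma> (\<alpha> \<gamma> (a \<cdot> h1))) (sg \<delta> (\<alpha> \<delta> (b \<cdot> h2))) (sg 0 (c \<cdot> h3)) m)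
        (cop H h')) (cop H h)"
    by simp
qed

lemma iota2_pi2_pure:
  assumes M: "left_module K act"
  shows "iota2 \<gamma> (pi2 act \<gamma> (pure2 (sg g a) (sg h b) m)) \<simeq>[PK act]
    (if g = \<gamma> + h then pure2 (sg g a) (sg h b) m else 0)"
proof -
  have "iota2 \<gamma> (pi2 act \<gamma> (pure2 (sg g a) (sg h b) m)) \<simeq>[PK act]
      iota2 \<gamma> (if g = \<gamma> + h then pure2 (\<alpha> (- \<gamma>) a) b (gact act h m) else 0)"
    by (rule hom_modD[OF hom_iota2 pi2_pure])
  also have "\<dots> = (if g = \<gamma> + h then pure2 (sg \<gamma> a) (sg 0 b) (gact act h m) else 0)"
    by (auto simp: iota2_def)
  also have "\<dots> \<simeq>[PK act] (if g = \<gamma> + h then pure2 (sg g a) (sg h b) m else 0)"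
    using pure2_gact[OF M, of \<gamma> a 0 b h m] by auto
  finally show ?thesis .
qed

lemma iota3_pi3_pure:
  assumes M: "left_module K act"
  shows "iota3 \<gamma> \<delta> (pi3 act \<gamma> \<delta> (pure3 (sg g a) (sg h b) (sg i c) m)) \<simeq>[QK act]
    (if g = \<gamma> + i \<and> h = \<delta> + i then pure3 (sg g a) (sg h b) (sg i c) m else 0)"
proof -
  have "iota3 \<gamma> \<delta> (pi3 act \<gamma> \<delta> (pure3 (sg g a) (sg h b) (sg i c) m)) \<simeq>[QK act]
      iota3 \<gamma> \<delta> (if g = \<gamma> + i \<and> h = \<delta> + i then pure3 (\<alpha> (- \<gamma>) a) (\<alpha> (- \<delta>) b) c (gact act i m) else 0)"
    by (rule hom_modD[OF hom_iota3 pi3_pure])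
  also have "\<dots> = (if g = \<gamma> + i \<and> h = \<delta> + i then pure3 (sg \<gamma> a) (sg \<delta> b) (sg 0 c) (gact act i m) else 0)"
    by (auto simp: iota3_def)
  also have "\<dots> \<simeq>[QK act] (if g = \<gamma> + i \<and> h = \<delta> + i then pure3 (sg g a) (sg h b) (sg i c) m else 0)"
    using pure3_gact[OF M, of \<gamma> a \<delta> b 0 c i m] by auto
  finally show ?thesis .
qed

lemma decomposed_components2:
  assumes M: "left_module K act"
  shows "decomposed (PK act) (\<lambda>\<gamma> x. iota2 \<gamma> (pi2 act \<gamma> x)) x"
proof (rule frag2_induct_single[where A = K and act = act])
  have h: "hom_mod (PK act) (PK act) (\<lambda>x. iota2 \<gamma> (pi2 act \<gamma> x))" for \<gamma>
    by (rule hom_mod_comp[OF hom_pi2[OF M] hom_iota2])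
  show "decomposed (PK act) (\<lambda>\<gamma> x. iota2 \<gamma> (pi2 act \<gamma> x)) y"
    if "x \<simeq>[PK act] y" "decomposed (PK act) (\<lambda>\<gamma> x. iota2 \<gamma> (pi2 act \<gamma> x)) x" for x y
    by (rule decomposed_eqv[OF h that])
  show "decomposed (PK act) (\<lambda>\<gamma> x. iota2 \<gamma> (pi2 act \<gamma> x)) (x - y)"
    if "decomposed (PK act) (\<lambda>\<gamma> x. iota2 \<gamma> (pi2 act \<gamma> x)) x"
      "decomposed (PK act) (\<lambda>\<gamma> x. iota2 \<gamma> (pi2 act \<gamma> x)) y" for x y
    by (rule decomposed_diff[OF hom_mod_additive[OF h] that])
  show "decomposed (PK act) (\<lambda>\<gamma> x. iota2 \<gamma> (pi2 act \<gamma> x)) (pure2 (sg g a) (sg h b) m)" for g a h b m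
    by (rule decomposed_single[where r = "g - h"]) (use iota2_pi2_pure[OF M] in \<open>simp add: eq_diff_eq eq_commute\<close>)
qed

lemma decomposed_components3:
  assumes M: "left_module K act"
  shows "decomposed (QK act) (\<lambda>(\<gamma>, \<delta>) x. iota3 \<gamma> \<delta> (pi3 act \<gamma> \<delta> x)) x"
proof (rule frag3_induct_single[where A = K and act = act])
  have h: "hom_mod (QK act) (QK act) ((\<lambda>(\<gamma>, \<delta>) x. iota3 \<gamma> \<delta> (pi3 act \<gamma> \<delta> x)) s)" for s
    by (cases s) (simp add: hom_mod_comp[OF hom_pi3[OF M] hom_iota3])
  show "decomposed (QK act) (\<lambda>(\<gamma>, \<delta>) x. iota3 \<gamma> \<delta> (pi3 act \<gamma> \<delta> x)) y"
    if "x \<simeq>[QK act] y" "decomposed (QK act) (\<lambda>(\<gamma>, \<delta>) x. iota3 \<gamma> \<delta> (pi3 act \<gamma> \<delta> x)) x" for x y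
    by (rule decomposed_eqv[OF h that])
  show "decomposed (QK act) (\<lambda>(\<gamma>, \<delta>) x. iota3 \<gamma> \<delta> (pi3 act \<gamma> \<delta> x)) (x - y)"
    if "decomposed (QK act) (\<lambda>(\<gamma>, \<delta>) x. iota3 \<gamma> \<delta> (pi3 act \<gamma> \<delta> x)) x"
      "decomposed (QK act) (\<lambda>(\<gamma>, \<delta>) x. iota3 \<gamma> \<delta> (pi3 act \<gamma> \<delta> x)) y" for x y
    by (rule decomposed_diff[OF hom_mod_additive[OF h] that])
  show "decomposed (QK act) (\<lambda>(\<gamma>, \<delta>) x. iota3 \<gamma> \<delta> (pi3 act \<gamma> \<delta> x)) (pure3 (sg g a) (sg h b) (sg i c) m)"
    for g a h b i c m
  proof (rule decomposed_single[where r = "(g - i, h - i)"])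
    fix s :: "'g \<times> 'g"
    obtain \<gamma> \<delta> where s: "s = (\<gamma>, \<delta>)" by fastforce
    have "s = (g - i, h - i) \<longleftrightarrow> g = \<gamma> + i \<and> h = \<delta> + i"
      by (auto simp: s eq_diff_eq)
    then show "(\<lambda>(\<gamma>, \<delta>) x. iota3 \<gamma> \<delta> (pi3 act \<gamma> \<delta> x)) s (pure3 (sg g a) (sg h b) (sg i c) m)
        \<simeq>[QK act] (if s = (g - i, h - i) then pure3 (sg g a) (sg h b) (sg i c) m else 0)"
      using iota3_pi3_pure[OF M, of \<gamma> \<delta> g a h b i c m] by (simp only: s prod.case)
  qed
qed

text \<open>
  The components together are injective, since an element is the sum of the images of its
  components under \<open>iota2\<close>.
\<close>

lemma pi2_eqv_iff:
  assumes M: "left_module K act"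
  shows "x \<simeq>[PK act] y \<longleftrightarrow> (\<forall>\<gamma>. pi2 act \<gamma> x \<simeq>[PH act] pi2 act \<gamma> y)"
proof
  assume r: "\<forall>\<gamma>. pi2 act \<gamma> x \<simeq>[PH act] pi2 act \<gamma> y"
  have "iota2 \<gamma> (pi2 act \<gamma> (x - y)) \<simeq>[PK act] 0" for \<gamma>
  proof -
    have "pi2 act \<gamma> (x - y) \<simeq>[PH act] 0"
      using r by (simp add: additive.diff[OF additive_pi2] flip: eqv_diff_zero)
    from hom_modD[OF hom_iota2 this] show ?thesis by (simp add: iota2_def)
  qed
  from decomposed_eqv_zero[OF decomposed_components2[OF M] this] show "x \<simeq>[PK act] y"
    by (simp flip: eqv_diff_zero)
qed (auto intro: hom_modD[OF hom_pi2[OF M]])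

lemma pi3_eqv_iff:
  assumes M: "left_module K act"
  shows "x \<simeq>[QK act] y \<longleftrightarrow> (\<forall>\<gamma> \<delta>. pi3 act \<gamma> \<delta> x \<simeq>[QH act] pi3 act \<gamma> \<delta> y)"
proof
  assume r: "\<forall>\<gamma> \<delta>. pi3 act \<gamma> \<delta> x \<simeq>[QH act] pi3 act \<gamma> \<delta> y"
  have "iota3 \<gamma> \<delta> (pi3 act \<gamma> \<delta> (x - y)) \<simeq>[QK act] 0" for \<gamma> \<delta>
  proof -
    have "pi3 act \<gamma> \<delta> (x - y) \<simeq>[QH act] 0"
      using r by (simp add: additive.diff[OF additive_pi3] flip: eqv_diff_zero)
    from hom_modD[OF hom_iota3 this] show ?thesis by (simp add: iota3_def)
  qed
  then have "(case s of (\<gamma>, \<delta>) \<Rightarrow> \<lambda>x. iota3 \<gamma> \<delta> (pi3 act \<gamma> \<delta> x)) (x - y) \<simeq>[QK act] 0" for s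
    by (cases s) simp
  from decomposed_eqv_zero[OF decomposed_components3[OF M] this] show "x \<simeq>[QK act] y"
    by (simp flip: eqv_diff_zero)
qed (auto intro: hom_modD[OF hom_pi3[OF M]])

lemma pi2_iota2: 
  assumes M: "left_module K act"
  shows "pi2 act \<gamma> (iota2 \<delta> y) \<simeq>[PH act] (if \<gamma> = \<delta> then y else 0)"
proof -
  have "hom_mod (PH act) (PH act) (\<lambda>y. if \<gamma> = \<delta> then y else 0)"
    by (cases "\<gamma> = \<delta>") (auto simp: hom_mod_def additive_def eqv_def gen_subgroup.zero)
  moreover have "pi2 act \<gamma> (pure2 (sg \<delta> (\<alpha> \<delta> a)) (sg 0 b) m) \<simeq>[PH act]
      (if \<gamma> = \<delta> then pure2 a b m else 0)" for a b m
    using pi2_pure[of act \<gamma> \<delta> "\<alpha> \<delta> a" 0 b m] by (cases "\<gamma> = \<delta>") (simp_all add: M)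
  ultimately show ?thesis
    unfolding iota2_def additive_apply_lift2[OF additive_pi2]
    by (rule lift2_eqv_hom)
qed

lemma finite_pi2:
  assumes M: "left_module K act"
  shows "finite {\<gamma>. \<not> pi2 act \<gamma> x \<simeq>[PH act] 0}"
proof -
  obtain S where S: "finite S" "\<And>\<gamma>. \<gamma> \<notin> S \<Longrightarrow> iota2 \<gamma> (pi2 act \<gamma> x) \<simeq>[PK act] 0"
    using decomposed_components2[OF M, of x] unfolding decomposed_def by auto
  have "pi2 act \<gamma> x \<simeq>[PH act] 0" if "\<gamma> \<notin> S" for \<gamma>
  proof -
    have "pi2 act \<gamma> x \<simeq>[PH act] pi2 act \<gamma> (iota2 \<gamma> (pi2 act \<gamma> x))"
      using pi2_iota2[OF M, of \<gamma> \<gamma>] by (simp add: eqv_sym)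
    also have "\<dots> \<simeq>[PH act] pi2 act \<gamma> 0"
      by (rule hom_modD[OF hom_pi2[OF M] S(2)[OF that]])
    finally show ?thesis by (simp add: pi2_def)
  qed
  then show ?thesis using S(1) by (auto intro: finite_subset)
qed

subsection \<open>Compatibility of the components with the module operations\<close>

text \<open>
  Homomorphisms out of a tensor product over the smash product are compared on homogeneous pure
  tensors.
\<close>

lemma lift2_eqv_hom_single:
  assumes "hom_mod (PK act) N F" "\<And>m. biadd N (\<lambda>x y. f x y m)"
    and "\<And>g a h b m. f (sg g a) (sg h b) m \<simeq>[N] F (pure2 (sg g a) (sg h b) m)"
  shows "lift2 f x \<simeq>[N] F x"
  by (rule lift2_eqv_hom[OF assms(1)], rule biadd_ext_single[OF assms(2) _ assms(3)])
    (rule biadd_hom[OF balanced2_biadd[OF balanced2_pure2] assms(1)])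

lemma lift3_eqv_hom_single:
  assumes "hom_mod (QK act) N F" "\<And>m. triadd N (\<lambda>x y z. f x y z m)"
    and "\<And>g a h b i c m. f (sg g a) (sg h b) (sg i c) m \<simeq>[N] F (pure3 (sg g a) (sg h b) (sg i c) m)"
  shows "lift3 f x \<simeq>[N] F x"
  by (rule lift3_eqv_hom[OF assms(1)], rule triadd_ext_single[OF assms(2) _ assms(3)])
    (rule triadd_hom[OF balanced3_triadd[OF balanced3_pure3] assms(1)])

text \<open>
  The action of \<open>\<Gamma>\<close> on \<open>(H \<otimes> H) \<otimes>\<^sub>H M\<close>.
\<close>

definition diag_act where "diag_act act t = lift2 (\<lambda>a b m. pure2 (\<alpha> t a) (\<alpha> t b) (gact act t m))"

lemma hom_diag_act:
  fixes act :: "('g \<Rightarrow>\<^sub>0 'h) \<Rightarrow> 'm::ab_group_add \<Rightarrow> 'm"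
  assumes M: "left_module K act"
  shows "hom_mod (PH act) (PH act) (diag_act act t)"
  unfolding diag_act_def
proof (rule hom_mod_P2, unfold balanced_mod2_def, intro conjI allI)
  show "balanced2 H (PH act) (\<lambda>a b. pure2 (\<alpha> t a) (\<alpha> t b) (gact act t m))" for m
    by (rule balanced2_linear_map[OF balanced2_pure2 linear_map_alpha linear_map_alpha])
  show "additive_mod (PH act) (\<lambda>m. pure2 (\<alpha> t a) (\<alpha> t b) (gact act t m))" for a b
    by (rule additive_mod_additive[OF additive_mod_pure2]) (simp add: additive_def gact_add[OF M])
  fix a b h and m :: 'm
  let ?f = "\<lambda>x y. pure2 (\<alpha> t a \<cdot> x) (\<alpha> t b \<cdot> y) (gact act t m)"
  have "pure2 (\<alpha> t a) (\<alpha> t b) (gact act t (act_H act h m)) \<simeq>[PH act] ext2 ?f (cop H (\<alpha> t h))"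
    unfolding gact_act_H[OF M] by (rule pure2_act)
  also have "\<dots> \<simeq>[PH act] ext2 (\<lambda>x y. ?f (\<alpha> t x) (\<alpha> t y)) (cop H h)"
    by (intro ext2_cop_alpha Hb.balanced2_mul_left balanced2_pure2)
  finally show "pure2 (\<alpha> t a) (\<alpha> t b) (gact act t (act_H act h m)) \<simeq>[PH act]
      ext2 (\<lambda>h1 h2. pure2 (\<alpha> t (a \<cdot> h1)) (\<alpha> t (b \<cdot> h2)) (gact act t m)) (cop H h)"
    by simp
qed

lemma hom_left_mult: "hom_mod (P2 H act) (P2 H act) (left_mult H f g)"
  unfolding left_mult_def
proof (rule hom_mod_P2, unfold balanced_mod2_def, intro conjI allI)
  show "balanced2 H (P2 H act) (\<lambda>a b. pure2 (f \<cdot> a) (g \<cdot> b) m)" for m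
    by (rule Hb.balanced2_mul_left[OF balanced2_pure2])
  show "additive_mod (P2 H act) (pure2 (f \<cdot> a) (g \<cdot> b))" for a b
    by (rule additive_mod_pure2)
  show "pure2 (f \<cdot> a) (g \<cdot> b) (act h m) \<simeq>[P2 H act]
      ext2 (\<lambda>h1 h2. pure2 (f \<cdot> (a \<cdot> h1)) (g \<cdot> (b \<cdot> h2)) m) (cop H h)" for a b h m
    using pure2_act[of "f \<cdot> a" "g \<cdot> b" act h m H] by (simp add: hopf.mul_assoc)
qed

lemma balanced2_flip: "balanced2 A N f \<Longrightarrow> balanced2 A N (\<lambda>a b. f b a)"
  unfolding balanced2_def biadd_def by (blast intro: eqv_sym)

text \<open>
  The flip respects the relations because \<open>H\<close> is cocommutative.
\<close>

lemma hom_flip2: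
  fixes act :: "'h \<Rightarrow> 'm::ab_group_add \<Rightarrow> 'm"
  shows "hom_mod (P2 H act) (P2 H act) flip2"
  unfolding flip2_def
proof (rule hom_mod_P2, unfold balanced_mod2_def, intro conjI allI)
  show "balanced2 H (P2 H act) (\<lambda>a b. pure2 b a m)" for m
    by (rule balanced2_flip[OF balanced2_pure2])
  show "additive_mod (P2 H act) (pure2 b a)" for a b
    by (rule additive_mod_pure2)
  fix a b h and m :: 'm
  have "pure2 b a (act h m) \<simeq>[P2 H act] ext2 (\<lambda>x y. pure2 (b \<cdot> x) (a \<cdot> y) m) (cop H h)"
    by (rule pure2_act)
  also have "\<dots> \<simeq>[P2 H act] ext2 (\<lambda>x y. pure2 (b \<cdot> y) (a \<cdot> x) m) (cop H h)"
    by (intro ext2_cop_swap Hb.balanced2_mul_left balanced2_pure2)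
  finally show "pure2 b a (act h m) \<simeq>[P2 H act] ext2 (\<lambda>x y. pure2 (b \<cdot> y) (a \<cdot> x) m) (cop H h)" .
qed

text \<open>
  Cocommutativity is applied to the inner coproduct of \<open>(\<Delta> \<otimes> id) \<Delta>(h)\<close>.
\<close>

lemma hom_flip12:
  fixes act :: "'h \<Rightarrow> 'm::ab_group_add \<Rightarrow> 'm"
  shows "hom_mod (P3 H act) (P3 H act) flip12"
  unfolding flip12_def
proof (rule hom_mod_P3, unfold balanced_mod3_def, intro conjI allI)
  have f: "balanced3 H (P3 H act) (\<lambda>a b c. pure3 a b c m)" for m
    by (rule balanced3_pure3)
  show "balanced3 H (P3 H act) (\<lambda>a b c. pure3 b a c m)" for m
    using f[of m] unfolding balanced3_def triadd_def by (blast intro: eqv_sym eqv_trans)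
  show "additive_mod (P3 H act) (pure3 b a c)" for a b c
    by (rule additive_mod_pure3)
  fix a b c h and m :: 'm
  let ?f = "\<lambda>x y z. pure3 (b \<cdot> x) (a \<cdot> y) (c \<cdot> z) m"
  have "balanced2 H (P3 H act) (\<lambda>x y. ?f x y z)" for z
    using Hb.balanced3_mul_left[OF f, of b a c m]
    by (simp add: balanced2_def balanced3_def biadd_def triadd_def)
  then have "ext2 (\<lambda>h' z. ext2 (\<lambda>x y. ?f x y z) (cop H h')) (cop H h) \<simeq>[P3 H act]
      ext2 (\<lambda>h' z. ext2 (\<lambda>x y. ?f y x z) (cop H h')) (cop H h)"
    by (intro ext2_cong ext2_cop_swap)
  from eqv_trans[OF pure3_act this]
  show "pure3 b a c (act h m) \<simeq>[P3 H act]
      ext2 (\<lambda>h' z. ext2 (\<lambda>x y. ?f y x z) (cop H h')) (cop H h)" .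
qed

text \<open>
  On \<open>(a g \<otimes> b h) \<otimes> m\<close>, multiplication by \<open>u s \<otimes> v t\<close> changes the degree from \<open>g h\<inverse>\<close> to
  \<open>s g h\<inverse> t\<inverse>\<close>; so the component of degree \<open>\<gamma>\<close> comes from the one of degree \<open>s\<inverse> \<gamma> t\<close>.  Normalising
  the product moves \<open>t\<close> to the right of both factors, which produces the action of \<open>t\<close>.
\<close>

lemma pi2_left_mult:
  assumes M: "left_module K act"
  shows "pi2 act \<gamma> (left_mult K (sg s u) (sg t v) x) \<simeq>[PH act]
    left_mult H (\<alpha> (- \<gamma>) u) v (diag_act act t (pi2 act (- s + \<gamma> + t) x))"
  unfolding left_mult_def[of K] additive_apply_lift2[OF additive_pi2]
proof (rule lift2_eqv_hom_single)
  have h: "hom_mod (PH act) (PH act) (\<lambda>y. left_mult H (\<alpha> (- \<gamma>) u) v (diag_act act t y))"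
    by (rule hom_mod_comp[OF hom_diag_act[OF M] hom_left_mult])
  then show "hom_mod (PK act) (PH act) (\<lambda>x. left_mult H (\<alpha> (- \<gamma>) u) v (diag_act act t (pi2 act (- s + \<gamma> + t) x)))"
    by (rule hom_mod_comp[OF hom_pi2[OF M]])
  show "biadd (PH act) (\<lambda>x y. pi2 act \<gamma> (pure2 (hmul K (sg s u) x) (hmul K (sg t v) y) m))" for m
    by (rule biadd_hom[OF balanced2_biadd[OF Kb.balanced2_mul_left[OF balanced2_pure2]] hom_pi2[OF M]])
  have eq: "t + (- t - \<gamma> + s) = - \<gamma> + s"
    by (metis add.assoc diff_conv_add_uminus add_minus_cancel)
  fix g a h' b m
  have "pi2 act \<gamma> (pure2 (hmul K (sg s u) (sg g a)) (hmul K (sg t v) (sg h' b)) m) \<simeq>[PH act]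
      (if s + g = \<gamma> + (t + h') then pure2 (\<alpha> (- \<gamma>) (u \<cdot> \<alpha> s a)) (v \<cdot> \<alpha> t b) (gact act (t + h') m) else 0)"
    unfolding hmul_K_single by (rule pi2_pure)
  also have "\<dots> = left_mult H (\<alpha> (- \<gamma>) u) v (diag_act act t
      (if g = - s + \<gamma> + t + h' then pure2 (\<alpha> (- (- s + \<gamma> + t)) a) b (gact act h' m) else 0))"
    by (simp add: left_mult_def diag_act_def M group_simps eq)
  also have "\<dots> \<simeq>[PH act] left_mult H (\<alpha> (- \<gamma>) u) v (diag_act act t
      (pi2 act (- s + \<gamma> + t) (pure2 (sg g a) (sg h' b) m)))"
    by (rule hom_modD[OF h eqv_sym[OF pi2_pure]])
  finally show "pi2 act \<gamma> (pure2 (hmul K (sg s u) (sg g a)) (hmul K (sg t v) (sg h' b)) m) \<simeq>[PH act]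
      left_mult H (\<alpha> (- \<gamma>) u) v (diag_act act t (pi2 act (- s + \<gamma> + t) (pure2 (sg g a) (sg h' b) m)))" .
qed

text \<open>
  The flip inverts degrees: after it, \<open>(f' \<otimes> f \<gamma>\<inverse>) \<otimes> m\<close> has to be normalised again by moving
  \<open>\<gamma>\<inverse>\<close> to \<open>m\<close>.
\<close>

lemma pi2_flip2:
  assumes M: "left_module K act"
  shows "pi2 act \<gamma> (flip2 x) \<simeq>[PH act] diag_act act (- \<gamma>) (flip2 (pi2 act (- \<gamma>) x))"
proof -
  have h: "hom_mod (PH act) (PH act) (\<lambda>y. diag_act act (- \<gamma>) (flip2 y))"
    by (rule hom_mod_comp[OF hom_flip2 hom_diag_act[OF M]])
  have b: "biadd (PH act) (\<lambda>x y. pi2 act \<gamma> (pure2 y x m))" for m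
    by (rule biadd_hom[OF balanced2_biadd[OF balanced2_flip[OF balanced2_pure2]] hom_pi2[OF M]])
  have s: "pi2 act \<gamma> (pure2 (sg h b) (sg g a) m) \<simeq>[PH act]
      diag_act act (- \<gamma>) (flip2 (pi2 act (- \<gamma>) (pure2 (sg g a) (sg h b) m)))" for g a h b m
  proof -
    have "pi2 act \<gamma> (pure2 (sg h b) (sg g a) m) \<simeq>[PH act]
        (if h = \<gamma> + g then pure2 (\<alpha> (- \<gamma>) b) a (gact act g m) else 0)"
      by (rule pi2_pure)
    also have "\<dots> = diag_act act (- \<gamma>) (flip2
        (if g = - \<gamma> + h then pure2 (\<alpha> (- (- \<gamma>)) a) b (gact act h m) else 0))"
      by (auto simp: flip2_def diag_act_def M)
    also have "\<dots> \<simeq>[PH act] diag_act act (- \<gamma>) (flip2 (pi2 act (- \<gamma>) (pure2 (sg g a) (sg h b) m)))"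
      by (rule hom_modD[OF h eqv_sym[OF pi2_pure]])
    finally show ?thesis .
  qed
  have "pi2 act \<gamma> (flip2 x) = lift2 (\<lambda>a b m. pi2 act \<gamma> (pure2 b a m)) x"
    unfolding flip2_def by (rule additive_apply_lift2[OF additive_pi2])
  also have "\<dots> \<simeq>[PH act] diag_act act (- \<gamma>) (flip2 (pi2 act (- \<gamma>) x))"
    by (rule lift2_eqv_hom_single[OF hom_mod_comp[OF hom_pi2[OF M] h] b s])
  finally show ?thesis .
qed

lemma pi3_flip12:
  assumes M: "left_module K act"
  shows "pi3 act \<gamma> \<delta> (flip12 x) \<simeq>[QH act] flip12 (pi3 act \<delta> \<gamma> x)"
proof -
  have h: "hom_mod (QK act) (QH act) (\<lambda>x. flip12 (pi3 act \<delta> \<gamma> x))"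
    by (rule hom_mod_comp[OF hom_pi3[OF M] hom_flip12])
  have t: "triadd (QH act) (\<lambda>x y z. pi3 act \<gamma> \<delta> (pure3 y x z m))" for m
  proof -
    have "triadd (QK act) (\<lambda>x y z. pure3 y x z m)"
      using balanced3_pure3[of K act m] unfolding balanced3_def triadd_def by blast
    then show ?thesis by (rule triadd_hom[OF _ hom_pi3[OF M]])
  qed
  have s: "pi3 act \<gamma> \<delta> (pure3 (sg h b) (sg g a) (sg i c) m) \<simeq>[QH act]
      flip12 (pi3 act \<delta> \<gamma> (pure3 (sg g a) (sg h b) (sg i c) m))" for g a h b i c m
  proof -
    have "pi3 act \<gamma> \<delta> (pure3 (sg h b) (sg g a) (sg i c) m) \<simeq>[QH act]
      (if h = \<gamma> + i \<and> g = \<delta> + i then pure3 (\<alpha> (- \<gamma>) b) (\<alpha> (- \<delta>) a) c (gact act i m) else 0)"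
      by (rule pi3_pure)
    also have "\<dots> = flip12
      (if g = \<delta> + i \<and> h = \<gamma> + i then pure3 (\<alpha> (- \<delta>) a) (\<alpha> (- \<gamma>) b) c (gact act i m) else 0)"
      by (auto simp: flip12_def)
    also have "\<dots> \<simeq>[QH act] flip12 (pi3 act \<delta> \<gamma> (pure3 (sg g a) (sg h b) (sg i c) m))"
      by (rule hom_modD[OF hom_flip12 eqv_sym[OF pi3_pure]])
    finally show ?thesis .
  qed
  have "pi3 act \<gamma> \<delta> (flip12 x) = lift3 (\<lambda>a b c m. pi3 act \<gamma> \<delta> (pure3 b a c m)) x"
    unfolding flip12_def by (rule additive_apply_lift3[OF additive_pi3])
  also have "\<dots> \<simeq>[QH act] flip12 (pi3 act \<delta> \<gamma> x)"
    by (rule lift3_eqv_hom_single[OF h t s])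
  finally show ?thesis .
qed

end

section \<open>The triple products\<close>

text \<open>
  The contribution of \<open>h1 \<otimes> h2\<close> in \<open>b * c\<close> and \<open>a \<otimes> b\<close> in \<open>a * d\<close> to \<open>a * (b * c)\<close>.
\<close>

definition right_term where
  "right_term A h1 h2 a b n = ext2 (\<lambda>b1 b2. pure3 a (hmul A h1 b1) (hmul A h2 b2) n) (cop A b)"

text \<open>
  The contribution of \<open>g1 \<otimes> g2\<close> in \<open>a * b\<close> and \<open>a \<otimes> b\<close> in \<open>e * c\<close> to \<open>(a * b) * c\<close>.
\<close>

definition left_term where
  "left_term A g1 g2 a b n = ext2 (\<lambda>a1 a2. pure3 (hmul A g1 a1) (hmul A g2 a2) b n) (cop A a)"

text \<open>
  The triple product \<open>a * (b * c)\<close> with the choices of representatives made explicit: \<open>r d\<close>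
  represents \<open>a * d\<close>, and \<open>x\<close> represents \<open>b * c\<close>.
\<close>

definition right_triple where "right_triple A r x = lift2 (\<lambda>h1 h2 d. lift2 (right_term A h1 h2) (r d)) x"

text \<open>
  The triple product \<open>(a * b) * c\<close>: \<open>r e\<close> represents \<open>e * c\<close>, and \<open>x\<close> represents \<open>a * b\<close>.
\<close>

definition left_triple where "left_triple A r x = lift2 (\<lambda>g1 g2 e. lift2 (left_term A g1 g2) (r e)) x"

lemma additive_tmul3: "additive (tmul3 A x)"
  by (simp add: additive_def tmul3_ext3 ext3_plus)

lemma additive_comp: "additive f \<Longrightarrow> additive g \<Longrightarrow> additive (\<lambda>x. f (g x))"
  by (simp add: additive_def)

lemma frag_of_ext2_eqv:
  "frag_of (ext2 z X, m) \<simeq>[tensor_rel N ra la] ext2 (\<lambda>a b. frag_of (z a b, m)) X"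
  by (rule additive_mod_apply_ext2[OF additive_mod_frag_of_left])

lemma comp_right_eqv:
  assumes one: "\<And>a. hmul A (hone A) a = a"
  shows "comp_right A q X \<simeq>[P3 A act] right_triple A (\<lambda>d. rep (q d)) (rep X)"
proof -
  have "tmap (\<lambda>x. tmul3 A (ext2 (\<lambda>h1 h2. frag_of (hone A, h1, h2)) h) (id_cop A x)) id y
      \<simeq>[P3 A act] ext2 (\<lambda>h1 h2. lift2 (right_term A h1 h2) y) h" for h y
  proof -
    let ?\<phi> = "\<lambda>x. tmul3 A (ext2 (\<lambda>h1 h2. frag_of (hone A, h1, h2)) h) (id_cop A x)"
    have "additive (id_cop A)" by (simp add: id_cop_ext2)
    then have "additive ?\<phi>" by (intro additive_comp[OF additive_tmul3])
    from tmap_eqv_ext2[OF this, of id y "T3 A"]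
    have "tmap ?\<phi> id y \<simeq>[P3 A act] lift2 (\<lambda>a b m. frag_of (?\<phi> (frag_of (a, b)), m)) y"
      by (simp add: P3_def lift2_def)
    also have "\<dots> \<simeq>[P3 A act] lift2 (\<lambda>a b m. ext2 (\<lambda>h1 h2. right_term A h1 h2 a b m) h) y"
    proof (rule lift2_cong)
      fix a b m
      have e: "?\<phi> (frag_of (a, b)) =
          ext2 (\<lambda>h1 h2. ext2 (\<lambda>b1 b2. frag_of (a, hmul A h1 b1, hmul A h2 b2)) (cop A b)) h"
        by (simp add: tmul3_ext3 one)
      have "frag_of (?\<phi> (frag_of (a, b)), m) \<simeq>[P3 A act]
          ext2 (\<lambda>h1 h2. frag_of (ext2 (\<lambda>b1 b2. frag_of (a, hmul A h1 b1, hmul A h2 b2)) (cop A b), m)) h"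
        unfolding e P3_def by (rule frag_of_ext2_eqv)
      also have "\<dots> \<simeq>[P3 A act] ext2 (\<lambda>h1 h2. right_term A h1 h2 a b m) h"
        unfolding right_term_def pure3_def P3_def by (intro ext2_cong frag_of_ext2_eqv)
      finally show "frag_of (?\<phi> (frag_of (a, b)), m) \<simeq>[P3 A act] ext2 (\<lambda>h1 h2. right_term A h1 h2 a b m) h" .
    qed
    also have "\<dots> = ext2 (\<lambda>h1 h2. lift2 (right_term A h1 h2) y) h"
      by (rule lift2_ext2)
    finally show ?thesis .
  qed
  then show ?thesis
    unfolding comp_right_def right_triple_def lift2_def[of "\<lambda>h1 h2 d. lift2 (right_term A h1 h2) (rep (q d))"]
    unfolding ext2_def[symmetric] by (intro ext2_cong)
qed

lemma comp_left_eqv: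
  assumes one: "\<And>a. hmul A (hone A) a = a"
  shows "comp_left A X q \<simeq>[P3 A act] left_triple A (\<lambda>e. rep (q e)) (rep X)"
proof -
  have "tmap (\<lambda>x. tmul3 A (ext2 (\<lambda>g1 g2. frag_of (g1, g2, hone A)) g) (cop_id A x)) id y
      \<simeq>[P3 A act] ext2 (\<lambda>g1 g2. lift2 (left_term A g1 g2) y) g" for g y
  proof -
    let ?\<phi> = "\<lambda>x. tmul3 A (ext2 (\<lambda>g1 g2. frag_of (g1, g2, hone A)) g) (cop_id A x)"
    have "additive (cop_id A)" by (simp add: cop_id_ext2)
    then have "additive ?\<phi>" by (intro additive_comp[OF additive_tmul3])
    from tmap_eqv_ext2[OF this, of id y "T3 A"]
    have "tmap ?\<phi> id y \<simeq>[P3 A act] lift2 (\<lambda>a b m. frag_of (?\<phi> (frag_of (a, b)), m)) y"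
      by (simp add: P3_def lift2_def)
    also have "\<dots> \<simeq>[P3 A act] lift2 (\<lambda>a b m. ext2 (\<lambda>g1 g2. left_term A g1 g2 a b m) g) y"
    proof (rule lift2_cong)
      fix a b m
      have e: "?\<phi> (frag_of (a, b)) =
          ext2 (\<lambda>g1 g2. ext2 (\<lambda>a1 a2. frag_of (hmul A g1 a1, hmul A g2 a2, b)) (cop A a)) g"
        by (simp add: tmul3_ext3 one)
      have "frag_of (?\<phi> (frag_of (a, b)), m) \<simeq>[P3 A act]
          ext2 (\<lambda>g1 g2. frag_of (ext2 (\<lambda>a1 a2. frag_of (hmul A g1 a1, hmul A g2 a2, b)) (cop A a), m)) g"
        unfolding e P3_def by (rule frag_of_ext2_eqv)
      also have "\<dots> \<simeq>[P3 A act] ext2 (\<lambda>g1 g2. left_term A g1 g2 a b m) g"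
        unfolding left_term_def pure3_def P3_def by (intro ext2_cong frag_of_ext2_eqv)
      finally show "frag_of (?\<phi> (frag_of (a, b)), m) \<simeq>[P3 A act] ext2 (\<lambda>g1 g2. left_term A g1 g2 a b m) g" .
    qed
    also have "\<dots> = ext2 (\<lambda>g1 g2. lift2 (left_term A g1 g2) y) g"
      by (rule lift2_ext2)
    finally show ?thesis .
  qed
  then show ?thesis
    unfolding comp_left_def left_triple_def lift2_def[of "\<lambda>g1 g2 e. lift2 (left_term A g1 g2) (rep (q e))"]
    unfolding ext2_def[symmetric] by (intro ext2_cong)
qed

lemma balanced2_ext2:
  "(\<And>c d. balanced2 A N (\<lambda>a b. f a b c d)) \<Longrightarrow> balanced2 A N (\<lambda>a b. ext2 (f a b) z)"
  unfolding balanced2_def biadd_def by (auto intro!: additive_mod_ext2 ext2_cong)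

lemma balanced2_lift2:
  "(\<And>c d m. balanced2 A N (\<lambda>a b. f a b c d m)) \<Longrightarrow> balanced2 A N (\<lambda>a b. lift2 (f a b) z)"
  unfolding balanced2_def biadd_def by (auto intro!: additive_mod_lift2 lift2_cong)

context prebialgebra begin

lemma linear_map_mul_left: "linear_map H H (\<lambda>a. hmul H u a)"
  by (simp add: linear_map_def additive_def hmul_add_right hmul_smul_right)

lemma linear_map_mul_right: "linear_map H H (\<lambda>a. hmul H a u)"
  by (simp add: linear_map_def additive_def hmul_add_left hmul_smul_left)

lemma balanced3_23: "balanced3 H N f \<Longrightarrow> balanced2 H N (\<lambda>b c. f a b c)"
  by (simp add: balanced2_def balanced3_def biadd_def triadd_def)

lemma balanced3_12: "balanced3 H N f \<Longrightarrow> balanced2 H N (\<lambda>a b. f a b c)"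
  by (simp add: balanced2_def balanced3_def biadd_def triadd_def)

lemma balanced2_right_term: "balanced2 H (P3 H act) (\<lambda>a b. right_term H h1 h2 a b n)"
  unfolding right_term_def
  by (rule balanced2_cop_right[OF balanced3_linear_map[OF balanced3_pure3 linear_map_id linear_map_mul_left linear_map_mul_left]])

lemma balanced2_left_term: "balanced2 H (P3 H act) (\<lambda>a b. left_term H h1 h2 a b n)"
  unfolding left_term_def
  by (rule balanced2_cop_left[OF balanced3_linear_map[OF balanced3_pure3 linear_map_mul_left linear_map_mul_left linear_map_id]])

lemma balanced2_lift_right_term: "balanced2 H (P3 H act) (\<lambda>h1 h2. lift2 (right_term H h1 h2) y)"
  unfolding right_term_def[abs_def]
  by (intro balanced2_lift2 balanced2_ext2
      balanced2_linear_map[OF balanced3_23[OF balanced3_pure3] linear_map_mul_right linear_map_mul_right])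

lemma balanced2_lift_left_term: "balanced2 H (P3 H act) (\<lambda>g1 g2. lift2 (left_term H g1 g2) y)"
  unfolding left_term_def[abs_def]
  by (intro balanced2_lift2 balanced2_ext2
      balanced2_linear_map[OF balanced3_12[OF balanced3_pure3] linear_map_mul_right linear_map_mul_right])

end

context smash_setting begin

lemma hmul_K_one: "hmul K (hone K) x = x"
proof -
  have "hmul K (hone K) x \<simeq>[{0}] x"
    by (rule additive_mod_ext_single[where f = "hmul K (hone K)" and g = "\<lambda>x. x"])
      (simp_all add: additive_mod_def hmul_K_add smash_def[THEN arg_cong[where f = hone]] Let_def)
  then show ?thesis by simp
qed

text \<open>
  The coproduct of \<open>b\<close> is multiplicative, which yields the factors \<open>h1 b1 h'\<close>, \<open>h2 b2 h''\<close>;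
  coassociativity brings the action of \<open>h\<close> on three factors into the form \<open>(id \<otimes> \<Delta>) \<Delta>(h)\<close> that is
  required for this.
\<close>

lemma hom_right_term:
  fixes act :: "'h \<Rightarrow> 'm::ab_group_add \<Rightarrow> 'm"
  shows "hom_mod (P2 H act) (P3 H act) (lift2 (right_term H h1 h2))"
proof (rule hom_mod_P2, unfold balanced_mod2_def, intro conjI allI)
  show "balanced2 H (P3 H act) (\<lambda>a b. right_term H h1 h2 a b m)" for m
    by (rule Hb.balanced2_right_term)
  show "additive_mod (P3 H act) (right_term H h1 h2 a b)" for a b
    unfolding right_term_def[abs_def] by (intro additive_mod_ext2 additive_mod_pure3)
  fix a b h and m :: 'm
  let ?f = "\<lambda>b1 b2 u v w. pure3 (a \<cdot> u) (h1 \<cdot> b1 \<cdot> v) (h2 \<cdot> b2 \<cdot> w) m"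
  have "right_term H h1 h2 a b (act h m) \<simeq>[P3 H act]
      ext2 (\<lambda>b1 b2. ext2 (\<lambda>h' w. ext2 (\<lambda>u v. ?f b1 b2 u v w) (cop H h')) (cop H h)) (cop H b)"
    unfolding right_term_def by (intro ext2_cong pure3_act)
  also have "\<dots> \<simeq>[P3 H act]
      ext2 (\<lambda>b1 b2. ext2 (\<lambda>u h'. ext2 (\<lambda>v w. ?f b1 b2 u v w) (cop H h')) (cop H h)) (cop H b)"
    by (intro ext2_cong ext2_coassoc Hb.balanced3_mul_left balanced3_pure3)
  also have "\<dots> = ext2 (\<lambda>u h'. ext2 (\<lambda>b1 b2. ext2 (\<lambda>v w. ?f b1 b2 u v w) (cop H h')) (cop H b)) (cop H h)"
    by (rule ext2_commute)
  also have "\<dots> = ext2 (\<lambda>u h'. ext2 (\<lambda>b1 b2. ext2 (\<lambda>v w.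
      pure3 (a \<cdot> u) (h1 \<cdot> (b1 \<cdot> v)) (h2 \<cdot> (b2 \<cdot> w)) m) (cop H h')) (cop H b)) (cop H h)"
    by (simp only: hopf.mul_assoc)
  also have "\<dots> \<simeq>[P3 H act] ext2 (\<lambda>u h'. right_term H h1 h2 (a \<cdot> u) (b \<cdot> h') m) (cop H h)"
    unfolding right_term_def
    by (intro ext2_cong eqv_sym[OF ext2_cop_mul[where f = "\<lambda>c d. pure3 x (h1 \<cdot> c) (h2 \<cdot> d) m" for x]]
        Hb.balanced2_mul_left Hb.balanced3_23 balanced3_pure3)
  finally show "right_term H h1 h2 a b (act h m) \<simeq>[P3 H act]
      ext2 (\<lambda>u v. right_term H h1 h2 (a \<cdot> u) (b \<cdot> v) m) (cop H h)" .
qed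

text \<open>
  Here the coproduct is taken in the first factor, and the action of \<open>h\<close> on three factors is already
  of the form \<open>(\<Delta> \<otimes> id) \<Delta>(h)\<close>.
\<close>

lemma hom_left_term:
  fixes act :: "'h \<Rightarrow> 'm::ab_group_add \<Rightarrow> 'm"
  shows "hom_mod (P2 H act) (P3 H act) (lift2 (left_term H g1 g2))"
proof (rule hom_mod_P2, unfold balanced_mod2_def, intro conjI allI)
  show "balanced2 H (P3 H act) (\<lambda>a b. left_term H g1 g2 a b m)" for m
    by (rule Hb.balanced2_left_term)
  show "additive_mod (P3 H act) (left_term H g1 g2 a b)" for a b
    unfolding left_term_def[abs_def] by (intro additive_mod_ext2 additive_mod_pure3)
  fix a b h and m :: 'm
  let ?f = "\<lambda>a1 a2 u v w. pure3 (g1 \<cdot> a1 \<cdot> u) (g2 \<cdot> a2 \<cdot> v) (b \<cdot> w) m"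
  have "left_term H g1 g2 a b (act h m) \<simeq>[P3 H act]
      ext2 (\<lambda>a1 a2. ext2 (\<lambda>h' w. ext2 (\<lambda>u v. ?f a1 a2 u v w) (cop H h')) (cop H h)) (cop H a)"
    unfolding left_term_def by (intro ext2_cong pure3_act)
  also have "\<dots> = ext2 (\<lambda>h' w. ext2 (\<lambda>a1 a2. ext2 (\<lambda>u v. ?f a1 a2 u v w) (cop H h')) (cop H a)) (cop H h)"
    by (rule ext2_commute)
  also have "\<dots> = ext2 (\<lambda>h' w. ext2 (\<lambda>a1 a2. ext2 (\<lambda>u v.
      pure3 (g1 \<cdot> (a1 \<cdot> u)) (g2 \<cdot> (a2 \<cdot> v)) (b \<cdot> w) m) (cop H h')) (cop H a)) (cop H h)"
    by (simp only: hopf.mul_assoc)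
  also have "\<dots> \<simeq>[P3 H act] ext2 (\<lambda>h' w. left_term H g1 g2 (a \<cdot> h') (b \<cdot> w) m) (cop H h)"
    unfolding left_term_def
    by (intro ext2_cong eqv_sym[OF ext2_cop_mul[where f = "\<lambda>c d. pure3 (g1 \<cdot> c) (g2 \<cdot> d) x m" for x]]
        Hb.balanced2_mul_left Hb.balanced3_12 balanced3_pure3)
  finally show "left_term H g1 g2 a b (act h m) \<simeq>[P3 H act]
      ext2 (\<lambda>u v. left_term H g1 g2 (a \<cdot> u) (b \<cdot> v) m) (cop H h)" .
qed

text \<open>
  This makes the triple product independent of the representative of \<open>b * c\<close>: the two conditions on
  \<open>r\<close> are the linearity of \<open>d \<mapsto> a * d\<close>.
\<close>

lemma hom_right_triple:
  fixes act :: "'h \<Rightarrow> 'm::ab_group_add \<Rightarrow> 'm" and actD :: "'h \<Rightarrow> 'd::ab_group_add \<Rightarrow> 'd"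
  assumes r: "additive_mod (P2 H act) r" "\<And>h d. r (actD h d) \<simeq>[P2 H act] left_mult H one h (r d)"
  shows "hom_mod (P2 H actD) (P3 H act) (right_triple H r)"
  unfolding right_triple_def[abs_def]
proof (rule hom_mod_P2, unfold balanced_mod2_def, intro conjI allI)
  show "balanced2 H (P3 H act) (\<lambda>a b. lift2 (right_term H a b) (r d))" for d
    by (rule Hb.balanced2_lift_right_term)
  show "additive_mod (P3 H act) (\<lambda>d. lift2 (right_term H a b) (r d))" for a b
    by (rule hom_mod_additive_mod[OF hom_right_term r(1)])
  fix h1 h2 h d
  have f: "balanced2 H (P3 H act) (\<lambda>c d. pure3 x (h1 \<cdot> c) (h2 \<cdot> d) m)" for x and m :: 'm
    by (intro Hb.balanced2_mul_left Hb.balanced3_23 balanced3_pure3)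
  have "lift2 (right_term H h1 h2) (r (actD h d)) \<simeq>[P3 H act] lift2 (right_term H h1 h2) (left_mult H one h (r d))"
    by (rule hom_modD[OF hom_right_term r(2)])
  also have "\<dots> = lift2 (\<lambda>a b m. right_term H h1 h2 a (h \<cdot> b) m) (r d)"
    by (simp add: left_mult_def additive_apply_lift2[OF additive_lift2])
  also have "\<dots> \<simeq>[P3 H act] lift2 (\<lambda>a b m. ext2 (\<lambda>u v. right_term H (h1 \<cdot> u) (h2 \<cdot> v) a b m) (cop H h)) (r d)"
  proof (rule lift2_cong)
    fix a b m
    have "right_term H h1 h2 a (h \<cdot> b) m \<simeq>[P3 H act]
        ext2 (\<lambda>u v. ext2 (\<lambda>b1 b2. pure3 a (h1 \<cdot> (u \<cdot> b1)) (h2 \<cdot> (v \<cdot> b2)) m) (cop H b)) (cop H h)"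
      unfolding right_term_def by (rule ext2_cop_mul[OF f])
    then show "right_term H h1 h2 a (h \<cdot> b) m \<simeq>[P3 H act] ext2 (\<lambda>u v. right_term H (h1 \<cdot> u) (h2 \<cdot> v) a b m) (cop H h)"
      by (simp add: right_term_def hopf.mul_assoc)
  qed
  also have "\<dots> = ext2 (\<lambda>u v. lift2 (right_term H (h1 \<cdot> u) (h2 \<cdot> v)) (r d)) (cop H h)"
    by (rule lift2_ext2)
  finally show "lift2 (right_term H h1 h2) (r (actD h d)) \<simeq>[P3 H act]
      ext2 (\<lambda>u v. lift2 (right_term H (h1 \<cdot> u) (h2 \<cdot> v)) (r d)) (cop H h)" .
qed

lemma hom_left_triple:
  fixes act :: "'h \<Rightarrow> 'm::ab_group_add \<Rightarrow> 'm" and actD :: "'h \<Rightarrow> 'd::ab_group_add \<Rightarrow> 'd"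
  assumes r: "additive_mod (P2 H act) r" "\<And>h d. r (actD h d) \<simeq>[P2 H act] left_mult H h one (r d)"
  shows "hom_mod (P2 H actD) (P3 H act) (left_triple H r)"
  unfolding left_triple_def[abs_def]
proof (rule hom_mod_P2, unfold balanced_mod2_def, intro conjI allI)
  show "balanced2 H (P3 H act) (\<lambda>a b. lift2 (left_term H a b) (r d))" for d
    by (rule Hb.balanced2_lift_left_term)
  show "additive_mod (P3 H act) (\<lambda>d. lift2 (left_term H a b) (r d))" for a b
    by (rule hom_mod_additive_mod[OF hom_left_term r(1)])
  fix h1 h2 h d
  have f: "balanced2 H (P3 H act) (\<lambda>c d. pure3 (h1 \<cdot> c) (h2 \<cdot> d) x m)" for x and m :: 'm
    by (intro Hb.balanced2_mul_left Hb.balanced3_12 balanced3_pure3)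
  have "lift2 (left_term H h1 h2) (r (actD h d)) \<simeq>[P3 H act] lift2 (left_term H h1 h2) (left_mult H h one (r d))"
    by (rule hom_modD[OF hom_left_term r(2)])
  also have "\<dots> = lift2 (\<lambda>a b m. left_term H h1 h2 (h \<cdot> a) b m) (r d)"
    by (simp add: left_mult_def additive_apply_lift2[OF additive_lift2])
  also have "\<dots> \<simeq>[P3 H act] lift2 (\<lambda>a b m. ext2 (\<lambda>u v. left_term H (h1 \<cdot> u) (h2 \<cdot> v) a b m) (cop H h)) (r d)"
  proof (rule lift2_cong)
    fix a b m
    have "left_term H h1 h2 (h \<cdot> a) b m \<simeq>[P3 H act]
        ext2 (\<lambda>u v. ext2 (\<lambda>a1 a2. pure3 (h1 \<cdot> (u \<cdot> a1)) (h2 \<cdot> (v \<cdot> a2)) b m) (cop H a)) (cop H h)"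
      unfolding left_term_def by (rule ext2_cop_mul[OF f])
    then show "left_term H h1 h2 (h \<cdot> a) b m \<simeq>[P3 H act] ext2 (\<lambda>u v. left_term H (h1 \<cdot> u) (h2 \<cdot> v) a b m) (cop H h)"
      by (simp add: left_term_def hopf.mul_assoc)
  qed
  also have "\<dots> = ext2 (\<lambda>u v. lift2 (left_term H (h1 \<cdot> u) (h2 \<cdot> v)) (r d)) (cop H h)"
    by (rule lift2_ext2)
  finally show "lift2 (left_term H h1 h2) (r (actD h d)) \<simeq>[P3 H act]
      ext2 (\<lambda>u v. lift2 (left_term H (h1 \<cdot> u) (h2 \<cdot> v)) (r d)) (cop H h)" .
qed

lemma hom_mod_if: "hom_mod N N' F \<Longrightarrow> hom_mod N N' (\<lambda>x. if c then F x else 0)"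
  by (cases c) (auto simp: hom_mod_def additive_def)

text \<open>
  With \<open>y = (a g \<otimes> b h) \<otimes> m\<close>, the product is \<open>(a g \<otimes> u s b1 h \<otimes> v t b2 h) \<otimes> m\<close>.  Its second degree
  is \<open>s h (t h)\<inverse> = s t\<inverse>\<close>, and its first degree is \<open>g h\<inverse> t\<inverse>\<close>.
\<close>

lemma pi3_right_term:
  assumes M: "left_module K act"
  shows "pi3 act \<gamma> \<delta> (lift2 (right_term K (sg s u) (sg t v)) y) \<simeq>[QH act]
    (if s = \<delta> + t then lift2 (right_term H (\<alpha> (- \<delta>) u) v) (diag_act act t (pi2 act (\<gamma> + t) y)) else 0)"
proof -
  let ?F = "\<lambda>z. if s = \<delta> + t then lift2 (right_term H (\<alpha> (- \<delta>) u) v) (diag_act act t z) else 0"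
  have F: "hom_mod (PH act) (QH act) ?F"
    by (rule hom_mod_if[OF hom_mod_comp[OF hom_diag_act[OF M] hom_right_term]])
  have b: "biadd (QH act) (\<lambda>x y. pi3 act \<gamma> \<delta> (right_term K (sg s u) (sg t v) x y m))" for m
    by (rule biadd_hom[OF balanced2_biadd[OF Kb.balanced2_right_term] hom_pi3[OF M]])
  have e: "pi3 act \<gamma> \<delta> (right_term K (sg s u) (sg t v) (sg g a) (sg h b) m) \<simeq>[QH act]
      ?F (pi2 act (\<gamma> + t) (pure2 (sg g a) (sg h b) m))" for g a h b m
  proof -
    let ?f = "\<lambda>x y. pure3 (sg g a) (hmul K (sg s u) x) (hmul K (sg t v) y) m"
    let ?p = "\<lambda>x y. pure3 (\<alpha> (- \<gamma>) a) (\<alpha> (- \<delta>) u \<cdot> x) (v \<cdot> y) (gact act (t + h) m)"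
    have f: "balanced2 K (QK act) ?f"
      by (intro Kb.balanced2_mul_left Kb.balanced3_23 balanced3_pure3)
    have p: "balanced2 H (QH act) ?p"
      by (intro Hb.balanced2_mul_left Hb.balanced3_23 balanced3_pure3)
    have tg: "t + (- t - \<gamma>) = - \<gamma>"
      by (simp add: diff_conv_add_uminus del: add_uminus_conv_diff)
    have "pi3 act \<gamma> \<delta> (right_term K (sg s u) (sg t v) (sg g a) (sg h b) m) \<simeq>[QH act]
        pi3 act \<gamma> \<delta> (ext2 (\<lambda>x y. ?f (sg h x) (sg h y)) (cop H b))"
      unfolding right_term_def by (rule hom_modD[OF hom_pi3[OF M] ext2_cop_K_single[OF f]])
    also have "\<dots> = ext2 (\<lambda>x y. pi3 act \<gamma> \<delta> (?f (sg h x) (sg h y))) (cop H b)"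
      by (rule additive_apply_ext2[OF additive_pi3])
    also have "\<dots> \<simeq>[QH act] ext2 (\<lambda>x y. if g = \<gamma> + (t + h) \<and> s + h = \<delta> + (t + h)
        then pure3 (\<alpha> (- \<gamma>) a) (\<alpha> (- \<delta>) (u \<cdot> \<alpha> s x)) (v \<cdot> \<alpha> t y) (gact act (t + h) m) else 0) (cop H b)"
      unfolding hmul_K_single by (intro ext2_cong pi3_pure)
    also have "\<dots> = (if g = \<gamma> + (t + h) \<and> s = \<delta> + t then
        ext2 (\<lambda>x y. ?p (\<alpha> t x) (\<alpha> t y)) (cop H b) else 0)"
      by (auto simp: add.assoc[symmetric])
    also have "\<dots> \<simeq>[QH act] (if g = \<gamma> + (t + h) \<and> s = \<delta> + t then ext2 ?p (cop H (\<alpha> t b)) else 0)"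
      using eqv_sym[OF ext2_cop_alpha[OF p]] by simp
    also have "\<dots> = ?F (if g = \<gamma> + t + h then pure2 (\<alpha> (- (\<gamma> + t)) a) b (gact act h m) else 0)"
      using tg by (auto simp: diag_act_def right_term_def M minus_add add.assoc)
    also have "\<dots> \<simeq>[QH act] ?F (pi2 act (\<gamma> + t) (pure2 (sg g a) (sg h b) m))"
      by (rule hom_modD[OF F eqv_sym[OF pi2_pure]])
    finally show ?thesis .
  qed
  show ?thesis
    unfolding additive_apply_lift2[OF additive_pi3]
    by (rule lift2_eqv_hom_single[OF hom_mod_comp[OF hom_pi2[OF M] F] b e])
qed

text \<open>
  With \<open>y = (a g \<otimes> b h) \<otimes> m\<close>, the product is \<open>(u s a1 g \<otimes> v t a2 g \<otimes> b h) \<otimes> m\<close>, of degrees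
  \<open>s g h\<inverse>\<close> and \<open>t g h\<inverse>\<close>.  So the degree of \<open>y\<close> is \<open>t\<inverse> \<delta>\<close>, and \<open>s t\<inverse> = \<gamma> \<delta>\<inverse>\<close>.
\<close>

lemma pi3_left_term:
  assumes M: "left_module K act"
  shows "pi3 act \<gamma> \<delta> (lift2 (left_term K (sg s u) (sg t v)) y) \<simeq>[QH act]
    (if s = \<gamma> - \<delta> + t then lift2 (left_term H (\<alpha> (- \<gamma>) u) (\<alpha> (- \<delta>) v)) (pi2 act (- t + \<delta>) y) else 0)"
proof -
  let ?F = "\<lambda>z. if s = \<gamma> - \<delta> + t then lift2 (left_term H (\<alpha> (- \<gamma>) u) (\<alpha> (- \<delta>) v)) z else 0"
  have F: "hom_mod (PH act) (QH act) ?F"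
    by (rule hom_mod_if[OF hom_left_term])
  have b: "biadd (QH act) (\<lambda>x y. pi3 act \<gamma> \<delta> (left_term K (sg s u) (sg t v) x y m))" for m
    by (rule biadd_hom[OF balanced2_biadd[OF Kb.balanced2_left_term] hom_pi3[OF M]])
  have e: "pi3 act \<gamma> \<delta> (left_term K (sg s u) (sg t v) (sg g a) (sg h b) m) \<simeq>[QH act]
      ?F (pi2 act (- t + \<delta>) (pure2 (sg g a) (sg h b) m))" for g a h b m
  proof -
    let ?f = "\<lambda>x y. pure3 (hmul K (sg s u) x) (hmul K (sg t v) y) (sg h b) m"
    let ?p = "\<lambda>x y. pure3 (\<alpha> (- \<gamma>) u \<cdot> x) (\<alpha> (- \<delta>) v \<cdot> y) b (gact act h m)"
    let ?c = "g = - t + \<delta> + h \<and> s = \<gamma> - \<delta> + t"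
    \<comment> \<open>The degree condition of \<open>pi3\<close>, solved for the degree of \<open>y\<close>.\<close>
    have c: "s + g = \<gamma> + h \<and> t + g = \<delta> + h \<longleftrightarrow> ?c"
    proof
      assume a: "s + g = \<gamma> + h \<and> t + g = \<delta> + h"
      then have g: "g = - t + \<delta> + h" by (metis left_diff_eq add.assoc)
      have "s = \<gamma> + h - g" using a by (metis add_diff_cancel)
      then show ?c using g by (simp add: minus_add diff_conv_add_uminus add.assoc del: add_uminus_conv_diff)
    qed (simp add: diff_conv_add_uminus add.assoc del: add_uminus_conv_diff)
    have d: "- \<gamma> + s = - \<delta> + t" if ?c
      using that by (simp add: diff_conv_add_uminus add.assoc del: add_uminus_conv_diff)
    have f: "balanced2 K (QK act) ?f"
      by (intro Kb.balanced2_mul_left Kb.balanced3_12 balanced3_pure3)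
    have p: "balanced2 H (QH act) ?p"
      by (intro Hb.balanced2_mul_left Hb.balanced3_12 balanced3_pure3)
    have "pi3 act \<gamma> \<delta> (left_term K (sg s u) (sg t v) (sg g a) (sg h b) m) \<simeq>[QH act]
        pi3 act \<gamma> \<delta> (ext2 (\<lambda>x y. ?f (sg g x) (sg g y)) (cop H a))"
      unfolding left_term_def by (rule hom_modD[OF hom_pi3[OF M] ext2_cop_K_single[OF f]])
    also have "\<dots> = ext2 (\<lambda>x y. pi3 act \<gamma> \<delta> (?f (sg g x) (sg g y))) (cop H a)"
      by (rule additive_apply_ext2[OF additive_pi3])
    also have "\<dots> \<simeq>[QH act] ext2 (\<lambda>x y. if s + g = \<gamma> + h \<and> t + g = \<delta> + h
        then pure3 (\<alpha> (- \<gamma>) (u \<cdot> \<alpha> s x)) (\<alpha> (- \<delta>) (v \<cdot> \<alpha> t y)) b (gact act h m) else 0) (cop H a)"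
      unfolding hmul_K_single by (intro ext2_cong pi3_pure)
    also have "\<dots> = (if ?c then ext2 (\<lambda>x y. ?p (\<alpha> (- \<delta> + t) x) (\<alpha> (- \<delta> + t) y)) (cop H a) else 0)"
      unfolding c using d by (cases ?c)
        (simp_all only: refl simp_thms if_True if_False alpha_mul alpha_alpha ext2_const_zero)
    also have "\<dots> \<simeq>[QH act] (if ?c then ext2 ?p (cop H (\<alpha> (- \<delta> + t) a)) else 0)"
      using eqv_sym[OF ext2_cop_alpha[OF p]] by simp
    also have "\<dots> = ?F (if g = - t + \<delta> + h then pure2 (\<alpha> (- (- t + \<delta>)) a) b (gact act h m) else 0)"
      by (auto simp: left_term_def minus_add)
    also have "\<dots> \<simeq>[QH act] ?F (pi2 act (- t + \<delta>) (pure2 (sg g a) (sg h b) m))"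
      by (rule hom_modD[OF F eqv_sym[OF pi2_pure]])
    finally show ?thesis .
  qed
  show ?thesis
    unfolding additive_apply_lift2[OF additive_pi3]
    by (rule lift2_eqv_hom_single[OF hom_mod_comp[OF hom_pi2[OF M] F] b e])
qed

text \<open>
  The hypothesis on \<open>r'\<close> will hold with \<open>r' d\<close> and \<open>r d\<close> representing \<open>a * d\<close> over the smash product
  and \<open>(\<gamma>\<inverse> a) * d\<close> over \<open>H\<close>.
\<close>

lemma pi3_right_triple:
  assumes M: "left_module K act" and D: "left_module K actD"
    and r: "additive_mod (PH act) r" "\<And>h d. r (act_H actD h d) \<simeq>[PH act] left_mult H one h (r d)"
    and r': "\<And>t d. diag_act act t (pi2 act (\<gamma> + t) (r' d)) \<simeq>[PH act] r (gact actD t d)"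
  shows "pi3 act \<gamma> \<delta> (right_triple K r' x) \<simeq>[QH act] right_triple H r (pi2 actD \<delta> x)"
proof -
  note F = hom_right_triple[OF r]
  have b: "biadd (QH act) (\<lambda>x y. pi3 act \<gamma> \<delta> (lift2 (right_term K x y) (r' d)))" for d
    by (rule biadd_hom[OF balanced2_biadd[OF Kb.balanced2_lift_right_term] hom_pi3[OF M]])
  have e: "pi3 act \<gamma> \<delta> (lift2 (right_term K (sg s u) (sg t v)) (r' d)) \<simeq>[QH act]
      right_triple H r (pi2 actD \<delta> (pure2 (sg s u) (sg t v) d))" for s u t v d
  proof -
    note pi3_right_term[OF M]
    also have "(if s = \<delta> + t then lift2 (right_term H (\<alpha> (- \<delta>) u) v) (diag_act act t (pi2 act (\<gamma> + t) (r' d))) else 0)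
        \<simeq>[QH act] (if s = \<delta> + t then lift2 (right_term H (\<alpha> (- \<delta>) u) v) (r (gact actD t d)) else 0)"
      using hom_modD[OF hom_right_term r'] by simp
    also have "\<dots> = right_triple H r (if s = \<delta> + t then pure2 (\<alpha> (- \<delta>) u) v (gact actD t d) else 0)"
      by (simp add: right_triple_def)
    also have "\<dots> \<simeq>[QH act] right_triple H r (pi2 actD \<delta> (pure2 (sg s u) (sg t v) d))"
      by (rule hom_modD[OF F eqv_sym[OF pi2_pure]])
    finally show ?thesis .
  qed
  have "pi3 act \<gamma> \<delta> (right_triple K r' x) = lift2 (\<lambda>x y d. pi3 act \<gamma> \<delta> (lift2 (right_term K x y) (r' d))) x"
    unfolding right_triple_def by (rule additive_apply_lift2[OF additive_pi3])
  also note lift2_eqv_hom_single[OF hom_mod_comp[OF hom_pi2[OF D] F] b e]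
  finally show ?thesis .
qed

text \<open>
  The hypothesis on \<open>r'\<close> will hold with \<open>r' e\<close> and \<open>r e\<close> representing \<open>e * c\<close> over the smash product
  and over \<open>H\<close>.  For \<open>x = (u s \<otimes> v t) \<otimes> e\<close>, dropping the degrees \<open>\<gamma>\<close> and \<open>\<delta>\<close> of the first two
  factors twists \<open>u\<close> by \<open>\<gamma>\<inverse>\<close> and \<open>v\<close> by \<open>\<delta>\<inverse>\<close>; the result is the component of \<open>x\<close> of degree
  \<open>\<gamma> \<delta>\<inverse>\<close>, acted upon by \<open>\<delta>\<inverse>\<close>.
\<close>

lemma pi3_left_triple:
  assumes M: "left_module K act" and D: "left_module K actD"
    and r: "additive_mod (PH act) r" "\<And>h d. r (act_H actD h d) \<simeq>[PH act] left_mult H h one (r d)"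
    and r': "\<And>t d. pi2 act (- t + \<delta>) (r' d) \<simeq>[PH act] r (gact actD (- \<delta> + t) d)"
  shows "pi3 act \<gamma> \<delta> (left_triple K r' x) \<simeq>[QH act] left_triple H r (diag_act actD (- \<delta>) (pi2 actD (\<gamma> - \<delta>) x))"
proof -
  have F: "hom_mod (PH actD) (QH act) (\<lambda>z. left_triple H r (diag_act actD (- \<delta>) z))"
    by (rule hom_mod_comp[OF hom_diag_act[OF D] hom_left_triple[OF r]])
  have b: "biadd (QH act) (\<lambda>x y. pi3 act \<gamma> \<delta> (lift2 (left_term K x y) (r' d)))" for d
    by (rule biadd_hom[OF balanced2_biadd[OF Kb.balanced2_lift_left_term] hom_pi3[OF M]])
  have e: "pi3 act \<gamma> \<delta> (lift2 (left_term K (sg s u) (sg t v)) (r' d)) \<simeq>[QH act]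
      left_triple H r (diag_act actD (- \<delta>) (pi2 actD (\<gamma> - \<delta>) (pure2 (sg s u) (sg t v) d)))" for s u t v d
  proof -
    have g: "- \<delta> + - (\<gamma> - \<delta>) = - \<gamma>"
      by (metis add.assoc add.right_neutral diff_conv_add_uminus minus_add minus_minus right_minus)
    note pi3_left_term[OF M]
    also have "(if s = \<gamma> - \<delta> + t then lift2 (left_term H (\<alpha> (- \<gamma>) u) (\<alpha> (- \<delta>) v)) (pi2 act (- t + \<delta>) (r' d)) else 0)
        \<simeq>[QH act] (if s = \<gamma> - \<delta> + t then
          lift2 (left_term H (\<alpha> (- \<gamma>) u) (\<alpha> (- \<delta>) v)) (r (gact actD (- \<delta> + t) d)) else 0)"
      using hom_modD[OF hom_left_term r'] by simp
    also have "\<dots> = left_triple H r (diag_act actD (- \<delta>)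
        (if s = \<gamma> - \<delta> + t then pure2 (\<alpha> (- (\<gamma> - \<delta>)) u) v (gact actD t d) else 0))"
      using g by (auto simp: left_triple_def diag_act_def D simp del: minus_diff_eq)
    also have "\<dots> \<simeq>[QH act] left_triple H r (diag_act actD (- \<delta>) (pi2 actD (\<gamma> - \<delta>) (pure2 (sg s u) (sg t v) d)))"
      by (rule hom_modD[OF F eqv_sym[OF pi2_pure]])
    finally show ?thesis .
  qed
  have "pi3 act \<gamma> \<delta> (left_triple K r' x) = lift2 (\<lambda>x y d. pi3 act \<gamma> \<delta> (lift2 (left_term K x y) (r' d))) x"
    unfolding left_triple_def by (rule additive_apply_lift2[OF additive_pi3])
  also note lift2_eqv_hom_single[OF hom_mod_comp[OF hom_pi2[OF D] F] b e]
  finally show ?thesis .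
qed

end

section \<open>Pseudoproducts\<close>

lemma eq_coset_iff:
  assumes "gen_subgroup N = N" "X \<in> quot N"
  shows "X = coset N y \<longleftrightarrow> rep X \<simeq>[N] y"
  by (metis assms coset_eq_iff coset_rep)

lemma tmap_tmul2_eqv: "tmap (tmul2 A (frag_of (f, g))) id y \<simeq>[P2 A act] left_mult A f g y"
proof -
  have e: "tmul2 A (frag_of (f, g)) = ext2 (\<lambda>a b. frag_of (hmul A f a, hmul A g b))"
    by (simp add: fun_eq_iff tmul2_ext2)
  have "tmap (ext2 (\<lambda>a b. frag_of (hmul A f a, hmul A g b))) id y \<simeq>[P2 A act]
      lift2 (\<lambda>a b m. pure2 (hmul A f a) (hmul A g b) (id m)) y"
    by (rule tmap_eqv_lift2) simp_all
  then show ?thesis by (simp add: e left_mult_def)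
qed

lemma tmap_swap2_eqv: "tmap swap2 id y \<simeq>[P2 A act] flip2 y"
proof -
  have "tmap (ext2 (\<lambda>a b. frag_of (b, a))) id y \<simeq>[P2 A act]
      ext2 (\<lambda>X m. ext2 (\<lambda>a b. frag_of (ext2 (\<lambda>a b. frag_of (b, a)) (frag_of (a, b)), id m)) X) y"
    unfolding P2_def by (rule tmap_eqv_ext2) simp
  then show ?thesis by (simp add: swap2_ext2 flip2_def lift2_def pure2_def)
qed

lemma tmap_swap12_eqv: "tmap swap12 id y \<simeq>[P3 A act] flip12 y"
proof -
  have "tmap (ext3 (\<lambda>a b c. frag_of (b, a, c))) id y \<simeq>[P3 A act]
      ext2 (\<lambda>X m. ext3 (\<lambda>a b c. frag_of (ext3 (\<lambda>a b c. frag_of (b, a, c)) (frag_of (a, b, c)), id m)) X) y"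
    unfolding P3_def by (rule tmap_eqv_ext3) simp
  then show ?thesis by (simp add: swap12_ext3 flip12_def lift3_def pure3_def)
qed

text \<open>
  The axioms in terms of representatives, where they become congruences.
\<close>

lemma pseudoproduct_iff:
  "pseudoproduct A actL actM p \<longleftrightarrow> left_module A actL \<and> left_module A actM \<and>
    (\<forall>a m. p a m \<in> quot (P2 A actM)) \<and>
    (\<forall>m. additive_mod (P2 A actM) (\<lambda>a. rep (p a m))) \<and> (\<forall>a. additive_mod (P2 A actM) (\<lambda>m. rep (p a m))) \<and>
    (\<forall>f a g m. rep (p (actL f a) (actM g m)) \<simeq>[P2 A actM] left_mult A f g (rep (p a m)))"
proof -
  have e: "rep X \<simeq>[P2 A actM] tmap (tmul2 A (frag_of (f, g))) id y \<longleftrightarrow>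
      rep X \<simeq>[P2 A actM] left_mult A f g y" for X f g y
    using eqv_trans[OF _ tmap_tmul2_eqv] eqv_trans[OF _ eqv_sym[OF tmap_tmul2_eqv]] by blast
  show ?thesis
  proof (cases "\<forall>a m. p a m \<in> quot (P2 A actM)")
    case True
    then have c: "p a m = coset (P2 A actM) y \<longleftrightarrow> rep (p a m) \<simeq>[P2 A actM] y" for a m y
      by (simp add: eq_coset_iff)
    show ?thesis
      unfolding pseudoproduct_def additive_mod_def c e using True
      by (intro iffI; elim conjE; intro conjI allI) simp_all
  next
    case False
    then show ?thesis unfolding pseudoproduct_def by argo
  qed
qed

context smash_setting begin

lemma G_equivariant_iff:
  assumes "\<And>a m. p a m \<in> quot (PH actM)"
  shows "G_equivariant H \<alpha> actL actM p \<longleftrightarrow>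
    (\<forall>g a m. rep (p (gact actL g a) (gact actM g m)) \<simeq>[PH actM] diag_act actM g (rep (p a m)))"
proof -
  have t: "tmap (tmap (\<alpha> g) (\<alpha> g)) (gact actM g) y \<simeq>[PH actM] diag_act actM g y" for g y
  proof -
    have "tmap (ext2 (\<lambda>a b. frag_of (\<alpha> g a, \<alpha> g b))) (gact actM g) y \<simeq>[PH actM]
        lift2 (\<lambda>a b m. pure2 (\<alpha> g a) (\<alpha> g b) (gact actM g m)) y"
      by (rule tmap_eqv_lift2) simp_all
    then show ?thesis by (simp add: diag_act_def tmap_ext2[of "\<alpha> g"])
  qed
  have e: "rep X \<simeq>[PH actM] tmap (tmap (\<alpha> g) (\<alpha> g)) (gact actM g) y \<longleftrightarrow>
      rep X \<simeq>[PH actM] diag_act actM g y" for X g y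
    using eqv_trans[OF _ t] eqv_trans[OF _ eqv_sym[OF t]] by blast
  show ?thesis
    unfolding G_equivariant_def by (simp add: eq_coset_iff assms e)
qed

lemma G_support_eq:
  assumes "\<And>a m. p a m \<in> quot (PH actM)"
  shows "G_support H actL actM p a m = {g. \<not> rep (p (gact actL g a) m) \<simeq>[PH actM] 0}"
  by (simp add: G_support_def eq_coset_iff assms)

lemma smash_term_eqv:
  "tmap (tmul2 K (frag_of (sg g one, sg 0 one))) id (nat_map y) \<simeq>[PK act] iota2 g y"
proof -
  have "tmap (tmul2 K (frag_of (sg g one, sg 0 one))) id (nat_map y) =
      tmap (ext2 (\<lambda>a b. frag_of (sg g (\<alpha> g a), sg 0 b))) id y"
    by (simp add: nat_map_def tmap_ext2 tmul2_ext2)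
  also have "\<dots> \<simeq>[PK act]
      ext2 (\<lambda>X m. ext2 (\<lambda>a b. frag_of (ext2 (\<lambda>a b. frag_of (sg g (\<alpha> g a), sg 0 b)) (frag_of (a, b)), id m)) X) y"
    unfolding P2_def by (rule tmap_eqv_ext2) simp
  finally show ?thesis by (simp add: iota2_def lift2_def pure2_def)
qed

lemma diag_act_zero: "left_module K act \<Longrightarrow> diag_act act 0 y \<simeq>[PH act] y"
  using lift2_pure2 by (simp add: diag_act_def)

lemma left_mult_one: "left_mult H one one y \<simeq>[P2 H act] y"
  using lift2_pure2 by (simp add: left_mult_def)

definition equiv_prod where
  "equiv_prod actL actM p \<longleftrightarrow> pseudoproduct H (act_H actL) (act_H actM) p \<and> G_equivariant H \<alpha> actL actM p"

text \<open>
  The relation between a product over \<open>H\<close> and one over the smash product that the summation formula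
  defines, without the sum.
\<close>

definition corresponding where
  "corresponding actL actM p p' \<longleftrightarrow>
    (\<forall>a m \<gamma>. pi2 actM \<gamma> (rep (p' a m)) \<simeq>[PH actM] rep (p (gact actL (- \<gamma>) a) m))"

lemma equiv_prodD:
  assumes "equiv_prod actL actM p"
  shows "p a m \<in> quot (PH actM)"
    and "additive_mod (PH actM) (\<lambda>a. rep (p a m))" "additive_mod (PH actM) (\<lambda>m. rep (p a m))"
    and "rep (p (act_H actL f a) (act_H actM h m)) \<simeq>[PH actM] left_mult H f h (rep (p a m))"
    and "rep (p (gact actL g a) (gact actM g m)) \<simeq>[PH actM] diag_act actM g (rep (p a m))"
proof -
  have p: "pseudoproduct H (act_H actL) (act_H actM) p" and e: "G_equivariant H \<alpha> actL actM p"
    using assms by (auto simp: equiv_prod_def)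
  have q: "p a m \<in> quot (PH actM)" for a m using p by (simp add: pseudoproduct_iff)
  show "p a m \<in> quot (PH actM)" by (rule q)
  show "additive_mod (PH actM) (\<lambda>a. rep (p a m))" "additive_mod (PH actM) (\<lambda>m. rep (p a m))"
    "rep (p (act_H actL f a) (act_H actM h m)) \<simeq>[PH actM] left_mult H f h (rep (p a m))"
    using p by (simp_all add: pseudoproduct_iff)
  show "rep (p (gact actL g a) (gact actM g m)) \<simeq>[PH actM] diag_act actM g (rep (p a m))"
    using e unfolding G_equivariant_iff[of p, OF q] by blast
qed

text \<open>
  Only the term \<open>g = \<gamma>\<inverse>\<close> of the sum lies in degree \<open>\<gamma>\<close>; if it is missing from the sum, then it is zero.
\<close>

lemma corresponding_smash_prod:
  assumes L: "left_module K actL" and M: "left_module K actM"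
    and p: "equiv_prod actL actM p" and fin: "G_finite H actL actM p"
  shows "corresponding actL actM p (smash_prod H \<alpha> actL actM p)"
  unfolding corresponding_def
proof (intro allI)
  fix a m \<gamma>
  let ?S = "G_support H actL actM p a m"
  let ?r = "\<lambda>g. rep (p (gact actL g a) m)"
  have S: "finite ?S" using fin by (simp add: G_finite_def)
  have "rep (smash_prod H \<alpha> actL actM p a m) \<simeq>[PK actM] (\<Sum>g\<in>?S. iota2 (- g) (?r g))"
    unfolding smash_prod_def
    by (rule eqv_trans[OF rep_coset eqv_sum]) (simp, rule smash_term_eqv)
  from hom_modD[OF hom_pi2[OF M] this]
  have "pi2 actM \<gamma> (rep (smash_prod H \<alpha> actL actM p a m)) \<simeq>[PH actM]
      pi2 actM \<gamma> (\<Sum>g\<in>?S. iota2 (- g) (?r g))" .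
  also have "\<dots> = (\<Sum>g\<in>?S. pi2 actM \<gamma> (iota2 (- g) (?r g)))"
    by (rule additive.sum[OF additive_pi2])
  also have "\<dots> \<simeq>[PH actM] (\<Sum>g\<in>?S. if \<gamma> = - g then ?r g else 0)"
    by (intro eqv_sum pi2_iota2[OF M])
  also have "\<dots> = (\<Sum>g\<in>?S. if - \<gamma> = g then ?r g else 0)"
    by (intro sum.cong refl) (auto simp: minus_equation_iff)
  also have "\<dots> = (if - \<gamma> \<in> ?S then ?r (- \<gamma>) else 0)"
    using S by (simp add: sum.delta)
  also have "\<dots> \<simeq>[PH actM] ?r (- \<gamma>)"
    unfolding G_support_eq[of p, OF equiv_prodD(1)[OF p]] by (auto intro: eqv_sym)
  finally show "pi2 actM \<gamma> (rep (smash_prod H \<alpha> actL actM p a m)) \<simeq>[PH actM] ?r (- \<gamma>)" .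
qed

text \<open>
  Each axiom is checked in all degrees.  For bilinearity, a homogeneous element \<open>u s\<close> acts as \<open>s\<close>
  followed by \<open>u\<close>; the elements of \<open>\<Gamma>\<close> are absorbed by equivariance, and those of \<open>H\<close> by
  bilinearity over \<open>H\<close>.
\<close>

lemma pseudoproduct_smash_prod:
  assumes L: "left_module K actL" and M: "left_module K actM"
    and p: "equiv_prod actL actM p" and fin: "G_finite H actL actM p"
  shows "pseudoproduct K actL actM (smash_prod H \<alpha> actL actM p)"
proof -
  let ?q = "\<lambda>a m. rep (smash_prod H \<alpha> actL actM p a m)"
  have c: "pi2 actM \<gamma> (?q a m) \<simeq>[PH actM] rep (p (gact actL (- \<gamma>) a) m)" for \<gamma> a m
    using corresponding_smash_prod[OF assms] by (simp add: corresponding_def)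
  note add = additive.add[OF additive_pi2]
  have l: "additive_mod (PK actM) (\<lambda>a. ?q a m)" for m
    unfolding additive_mod_def pi2_eqv_iff[OF M] add
  proof (intro allI)
    fix a a' \<gamma>
    note c
    also have "rep (p (gact actL (- \<gamma>) (a + a')) m) \<simeq>[PH actM]
        rep (p (gact actL (- \<gamma>) a) m) + rep (p (gact actL (- \<gamma>) a') m)"
      unfolding gact_add[OF L] by (rule additive_mod_add[OF equiv_prodD(2)[OF p]])
    also have "\<dots> \<simeq>[PH actM] pi2 actM \<gamma> (?q a m) + pi2 actM \<gamma> (?q a' m)"
      by (intro eqv_add eqv_sym[OF c])
    finally show "pi2 actM \<gamma> (?q (a + a') m) \<simeq>[PH actM] pi2 actM \<gamma> (?q a m) + pi2 actM \<gamma> (?q a' m)" .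
  qed
  have r: "additive_mod (PK actM) (?q a)" for a
    unfolding additive_mod_def pi2_eqv_iff[OF M] add
  proof (intro allI)
    fix m m' \<gamma>
    note c
    also have "rep (p (gact actL (- \<gamma>) a) (m + m')) \<simeq>[PH actM]
        rep (p (gact actL (- \<gamma>) a) m) + rep (p (gact actL (- \<gamma>) a) m')"
      by (rule additive_mod_add[OF equiv_prodD(3)[OF p]])
    also have "\<dots> \<simeq>[PH actM] pi2 actM \<gamma> (?q a m) + pi2 actM \<gamma> (?q a m')"
      by (intro eqv_add eqv_sym[OF c])
    finally show "pi2 actM \<gamma> (?q a (m + m')) \<simeq>[PH actM] pi2 actM \<gamma> (?q a m) + pi2 actM \<gamma> (?q a m')" .
  qed
  have "pi2 actM \<gamma> (?q (actL f a) (actM g m)) \<simeq>[PH actM] pi2 actM \<gamma> (left_mult K f g (?q a m))" for f a g m \<gamma>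
  proof (rule biadd_ext_single[where f = "\<lambda>f g. pi2 actM \<gamma> (?q (actL f a) (actM g m))"
        and g = "\<lambda>f g. pi2 actM \<gamma> (left_mult K f g (?q a m))"])
    have "biadd (PK actM) (\<lambda>f g. ?q (actL f a) (actM g m))"
      using l r by (simp add: biadd_def additive_mod_def left_module.act_add_left[OF L] left_module.act_add_left[OF M])
    then show "biadd (PH actM) (\<lambda>f g. pi2 actM \<gamma> (?q (actL f a) (actM g m)))"
      by (rule biadd_hom[OF _ hom_pi2[OF M]])
    have "balanced2 K (PK actM) (\<lambda>f g. left_mult K f g (?q a m))"
      unfolding left_mult_def
      by (intro balanced2_lift2 balanced2_linear_map[OF balanced2_pure2 Kb.linear_map_mul_right Kb.linear_map_mul_right])
    then show "biadd (PH actM) (\<lambda>f g. pi2 actM \<gamma> (left_mult K f g (?q a m)))"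
      by (rule biadd_hom[OF balanced2_biadd hom_pi2[OF M]])
    fix s u t v
    \<comment> \<open>The component of degree \<open>s\<inverse> \<gamma> t\<close> in \<open>pi2_left_mult\<close> is \<open>p(b, m)\<close> for this translate \<open>b\<close>.\<close>
    let ?b = "gact actL (- (- s + \<gamma> + t)) a"
    have tb: "gact actL t ?b = gact actL (- \<gamma> + s) a"
      by (simp add: L minus_add diff_conv_add_uminus add.assoc del: add_uminus_conv_diff)
    have "pi2 actM \<gamma> (?q (actL (sg s u) a) (actM (sg t v) m)) \<simeq>[PH actM]
        rep (p (gact actL (- \<gamma>) (actL (sg s u) a)) (actM (sg t v) m))"
      by (rule c)
    also have "\<dots> = rep (p (act_H actL (\<alpha> (- \<gamma>) u) (gact actL t ?b)) (act_H actM v (gact actM t m)))"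
      unfolding tb gact_act[OF L] act_single[OF L, of "- \<gamma> + s"] act_single[OF M] ..
    also have "\<dots> \<simeq>[PH actM] left_mult H (\<alpha> (- \<gamma>) u) v (rep (p (gact actL t ?b) (gact actM t m)))"
      by (rule equiv_prodD(4)[OF p])
    also have "\<dots> \<simeq>[PH actM] left_mult H (\<alpha> (- \<gamma>) u) v (diag_act actM t (rep (p ?b m)))"
      by (rule hom_modD[OF hom_left_mult equiv_prodD(5)[OF p]])
    also have "\<dots> \<simeq>[PH actM] left_mult H (\<alpha> (- \<gamma>) u) v (diag_act actM t (pi2 actM (- s + \<gamma> + t) (?q a m)))"
      by (rule hom_modD[OF hom_left_mult hom_modD[OF hom_diag_act[OF M] eqv_sym[OF c]]])
    also have "\<dots> \<simeq>[PH actM] pi2 actM \<gamma> (left_mult K (sg s u) (sg t v) (?q a m))"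
      by (rule eqv_sym[OF pi2_left_mult[OF M]])
    finally show "pi2 actM \<gamma> (?q (actL (sg s u) a) (actM (sg t v) m)) \<simeq>[PH actM]
        pi2 actM \<gamma> (left_mult K (sg s u) (sg t v) (?q a m))" .
  qed
  then have "?q (actL f a) (actM g m) \<simeq>[PK actM] left_mult K f g (?q a m)" for f a g m
    by (simp add: pi2_eqv_iff[OF M])
  then show ?thesis
    using L M l r by (simp add: pseudoproduct_iff) (simp add: smash_prod_def)
qed

text \<open>
  The inverse of \<open>smash_prod\<close>: the component of degree \<open>1\<close>.
\<close>

definition unsmash where
  "unsmash actM p' a m = coset (PH actM) (pi2 actM 0 (rep (p' a m)))"

lemma rep_unsmash: "rep (unsmash actM p' a m) \<simeq>[PH actM] pi2 actM 0 (rep (p' a m))"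
  unfolding unsmash_def by (rule rep_coset) simp

lemma pi2_pseudoproduct:
  assumes M: "left_module K actM" and p: "pseudoproduct K actL actM p'"
  shows "pi2 actM \<gamma> (rep (p' (actL (sg s u) a) (actM (sg t v) m))) \<simeq>[PH actM]
    left_mult H (\<alpha> (- \<gamma>) u) v (diag_act actM t (pi2 actM (- s + \<gamma> + t) (rep (p' a m))))"
proof -
  have "rep (p' (actL (sg s u) a) (actM (sg t v) m)) \<simeq>[PK actM] left_mult K (sg s u) (sg t v) (rep (p' a m))"
    using p by (simp add: pseudoproduct_iff)
  from eqv_trans[OF hom_modD[OF hom_pi2[OF M] this] pi2_left_mult[OF M]] show ?thesis .
qed

text \<open>
  Bilinearity over the smash product, applied to \<open>\<gamma>\<inverse> \<otimes> 1\<close>, shifts the component of degree \<open>\<gamma>\<close> to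
  degree \<open>1\<close>.
\<close>

lemma corresponding_unsmash:
  assumes L: "left_module K actL" and M: "left_module K actM" and p: "pseudoproduct K actL actM p'"
  shows "corresponding actL actM (unsmash actM p') p'"
  unfolding corresponding_def
proof (intro allI)
  fix a m \<gamma>
  let ?y = "pi2 actM \<gamma> (rep (p' a m))"
  have "rep (unsmash actM p' (gact actL (- \<gamma>) a) m) \<simeq>[PH actM] pi2 actM 0 (rep (p' (gact actL (- \<gamma>) a) m))"
    by (rule rep_unsmash)
  also have "\<dots> = pi2 actM 0 (rep (p' (actL (sg (- \<gamma>) one) a) (actM (sg 0 one) m)))"
    using gact_zero[OF M, of m] by (simp add: act_G_def)
  also have "\<dots> \<simeq>[PH actM]
      left_mult H (\<alpha> (- 0) one) one (diag_act actM 0 (pi2 actM (- (- \<gamma>) + 0 + 0) (rep (p' a m))))"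
    by (rule pi2_pseudoproduct[OF M p])
  also have "\<dots> = left_mult H one one (diag_act actM 0 ?y)" by simp
  also have "\<dots> \<simeq>[PH actM] diag_act actM 0 ?y" by (rule left_mult_one)
  also have "\<dots> \<simeq>[PH actM] ?y" by (rule diag_act_zero[OF M])
  finally show "?y \<simeq>[PH actM] rep (unsmash actM p' (gact actL (- \<gamma>) a) m)" by (rule eqv_sym)
qed

text \<open>
  Multiplication by \<open>f \<otimes> g\<close> with \<open>f, g \<in> H\<close>, and by \<open>g \<otimes> g\<close> with \<open>g \<in> \<Gamma>\<close>, preserves degree \<open>1\<close>.
\<close>

lemma equiv_prod_unsmash:
  assumes L: "left_module K actL" and M: "left_module K actM" and p: "pseudoproduct K actL actM p'"
  shows "equiv_prod actL actM (unsmash actM p')"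
proof -
  let ?p = "unsmash actM p'"
  have q: "?p a m \<in> quot (PH actM)" for a m by (simp add: unsmash_def)
  have "additive_mod (PH actM) (\<lambda>a. pi2 actM 0 (rep (p' a m)))"
      "additive_mod (PH actM) (\<lambda>m. pi2 actM 0 (rep (p' a m)))" for a m
    using p by (auto simp: pseudoproduct_iff intro: hom_mod_additive_mod[OF hom_pi2[OF M]])
  then have add: "additive_mod (PH actM) (\<lambda>a. rep (?p a m))" "additive_mod (PH actM) (\<lambda>m. rep (?p a m))" for a m
    by (auto intro: additive_mod_eqv[OF _ eqv_sym[OF rep_unsmash]])
  have bil: "rep (?p (act_H actL f a) (act_H actM g m)) \<simeq>[PH actM] left_mult H f g (rep (?p a m))" for f a g m
  proof -
    have "rep (?p (act_H actL f a) (act_H actM g m)) \<simeq>[PH actM]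
        pi2 actM 0 (rep (p' (actL (sg 0 f) a) (actM (sg 0 g) m)))"
      by (simp only: act_H_def rep_unsmash)
    also have "\<dots> \<simeq>[PH actM] left_mult H (\<alpha> (- 0) f) g (diag_act actM 0 (pi2 actM (- 0 + 0 + 0) (rep (p' a m))))"
      by (rule pi2_pseudoproduct[OF M p])
    also have "\<dots> = left_mult H f g (diag_act actM 0 (pi2 actM 0 (rep (p' a m))))" by simp
    also have "\<dots> \<simeq>[PH actM] left_mult H f g (rep (?p a m))"
      by (rule hom_modD[OF hom_left_mult eqv_trans[OF diag_act_zero[OF M] eqv_sym[OF rep_unsmash]]])
    finally show ?thesis .
  qed
  have eq: "rep (?p (gact actL g a) (gact actM g m)) \<simeq>[PH actM] diag_act actM g (rep (?p a m))" for g a m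
  proof -
    have "rep (?p (gact actL g a) (gact actM g m)) \<simeq>[PH actM]
        pi2 actM 0 (rep (p' (actL (sg g one) a) (actM (sg g one) m)))"
      unfolding act_G_def by (rule rep_unsmash)
    also have "\<dots> \<simeq>[PH actM]
        left_mult H (\<alpha> (- 0) one) one (diag_act actM g (pi2 actM (- g + 0 + g) (rep (p' a m))))"
      by (rule pi2_pseudoproduct[OF M p])
    also have "\<dots> = left_mult H one one (diag_act actM g (pi2 actM 0 (rep (p' a m))))" by simp
    also have "\<dots> \<simeq>[PH actM] diag_act actM g (pi2 actM 0 (rep (p' a m)))" by (rule left_mult_one)
    also have "\<dots> \<simeq>[PH actM] diag_act actM g (rep (?p a m))"
      by (rule hom_modD[OF hom_diag_act[OF M] eqv_sym[OF rep_unsmash]])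
    finally show ?thesis .
  qed
  show ?thesis
    unfolding equiv_prod_def pseudoproduct_iff G_equivariant_iff[of ?p, OF q]
    using q add bil eq left_module_act_H[OF L] left_module_act_H[OF M] by blast
qed

text \<open>
  An element has finitely many nonzero components.
\<close>

lemma G_finite_unsmash:
  assumes L: "left_module K actL" and M: "left_module K actM" and p: "pseudoproduct K actL actM p'"
  shows "G_finite H actL actM (unsmash actM p')"
  unfolding G_finite_def
proof (intro allI)
  fix a m
  have q: "unsmash actM p' a m \<in> quot (PH actM)" for a m by (simp add: unsmash_def)
  have c: "pi2 actM (- g) (rep (p' a m)) \<simeq>[PH actM] rep (unsmash actM p' (gact actL g a) m)" for g
    using corresponding_unsmash[OF assms] unfolding corresponding_def by (metis minus_minus)
  have "G_support H actL actM (unsmash actM p') a m \<subseteq>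
      uminus ` {\<gamma>. \<not> pi2 actM \<gamma> (rep (p' a m)) \<simeq>[PH actM] 0}"
  proof
    fix g assume "g \<in> G_support H actL actM (unsmash actM p') a m"
    then have "\<not> rep (unsmash actM p' (gact actL g a) m) \<simeq>[PH actM] 0"
      by (simp add: G_support_eq[of "unsmash actM p'", OF q])
    then have "\<not> pi2 actM (- g) (rep (p' a m)) \<simeq>[PH actM] 0"
      using eqv_trans[OF eqv_sym[OF c]] by blast
    then show "g \<in> uminus ` {\<gamma>. \<not> pi2 actM \<gamma> (rep (p' a m)) \<simeq>[PH actM] 0}"
      by (intro image_eqI[of _ _ "- g"]) simp_all
  qed
  then show "finite (G_support H actL actM (unsmash actM p') a m)"
    by (rule finite_subset) (rule finite_imageI[OF finite_pi2[OF M]])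
qed

lemma bij_betw_pseudoproducts:
  assumes L: "left_module K actL" and M: "left_module K actM"
  shows "bij_betw (smash_prod H \<alpha> actL actM)
    {p. equiv_prod actL actM p \<and> G_finite H actL actM p} {p'. pseudoproduct K actL actM p'}"
proof (rule bij_betw_byWitness[where f' = "unsmash actM"], safe)
  show "pseudoproduct K actL actM (smash_prod H \<alpha> actL actM p)"
    if "equiv_prod actL actM p" "G_finite H actL actM p" for p
    by (rule pseudoproduct_smash_prod[OF L M that])
  show "equiv_prod actL actM (unsmash actM p')" "G_finite H actL actM (unsmash actM p')"
    if "pseudoproduct K actL actM p'" for p'
    by (rule equiv_prod_unsmash[OF L M that], rule G_finite_unsmash[OF L M that])
next
  fix p assume p: "equiv_prod actL actM p" "G_finite H actL actM p"
  show "unsmash actM (smash_prod H \<alpha> actL actM p) = p"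
  proof (intro ext)
    fix a m
    have "pi2 actM 0 (rep (smash_prod H \<alpha> actL actM p a m)) \<simeq>[PH actM] rep (p (gact actL (- 0) a) m)"
      using corresponding_smash_prod[OF L M p] unfolding corresponding_def by blast
    then have "rep (p a m) \<simeq>[PH actM] pi2 actM 0 (rep (smash_prod H \<alpha> actL actM p a m))"
      by (simp add: L eqv_sym)
    with eq_coset_iff[OF gen_subgroup_P2 equiv_prodD(1)[OF p(1)]]
    show "unsmash actM (smash_prod H \<alpha> actL actM p) a m = p a m"
      unfolding unsmash_def by metis
  qed
next
  fix p' assume p': "pseudoproduct K actL actM p'"
  let ?p = "unsmash actM p'"
  show "smash_prod H \<alpha> actL actM ?p = p'"
  proof (intro ext)
    fix a m
    have "rep (p' a m) \<simeq>[PK actM] rep (smash_prod H \<alpha> actL actM ?p a m)"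
      unfolding pi2_eqv_iff[OF M]
    proof
      fix \<gamma>
      have a: "pi2 actM \<gamma> (rep (p' a m)) \<simeq>[PH actM] rep (?p (gact actL (- \<gamma>) a) m)"
        using corresponding_unsmash[OF L M p'] unfolding corresponding_def by blast
      have b: "pi2 actM \<gamma> (rep (smash_prod H \<alpha> actL actM ?p a m)) \<simeq>[PH actM]
          rep (?p (gact actL (- \<gamma>) a) m)"
        using corresponding_smash_prod[OF L M equiv_prod_unsmash[OF L M p'] G_finite_unsmash[OF L M p']]
        unfolding corresponding_def by blast
      show "pi2 actM \<gamma> (rep (p' a m)) \<simeq>[PH actM] pi2 actM \<gamma> (rep (smash_prod H \<alpha> actL actM ?p a m))"
        by (rule eqv_trans[OF a eqv_sym[OF b]])
    qed
    moreover have "p' a m \<in> quot (PK actM)" using p' by (simp add: pseudoproduct_iff)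
    moreover have "smash_prod H \<alpha> actL actM ?p a m \<in> quot (PK actM)" by (simp add: smash_prod_def)
    ultimately show "smash_prod H \<alpha> actL actM ?p a m = p' a m"
      by (metis eq_coset_iff[OF gen_subgroup_P2] coset_rep[OF gen_subgroup_P2])
  qed
qed

end

section \<open>Identities compared component by component\<close>

lemma bij_betw_restrict:
  assumes "bij_betw f A B" "\<And>x. x \<in> A \<Longrightarrow> Q x \<longleftrightarrow> R (f x)"
  shows "bij_betw f {x \<in> A. Q x} {y \<in> B. R y}"
  using assms by (fastforce simp: bij_betw_def inj_on_def)

context smash_setting begin

lemma corresponding_at_zero:
  assumes L: "left_module K actL" and c: "corresponding actL actM p p'"
  shows "pi2 actM 0 (rep (p' a m)) \<simeq>[PH actM] rep (p a m)"
proof -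
  have "pi2 actM 0 (rep (p' a m)) \<simeq>[PH actM] rep (p (gact actL (- 0) a) m)"
    using c unfolding corresponding_def by blast
  then show ?thesis by (simp add: L)
qed

text \<open>
  In degree \<open>\<gamma>\<close>, skew-symmetry for \<open>b, a\<close> over the smash product is skew-symmetry over \<open>H\<close> for
  \<open>\<gamma>\<inverse> b, a\<close>.
\<close>

lemma skew_iff:
  assumes L: "left_module K act" and p: "equiv_prod act act p" and p': "pseudoproduct K act act p'"
    and c: "corresponding act act p p'"
  shows "(\<forall>a b. p b a = coset (PH act) (- tmap swap2 id (rep (p a b)))) \<longleftrightarrow>
    (\<forall>a b. p' b a = coset (PK act) (- tmap swap2 id (rep (p' a b))))"
proof -
  have q': "p' a b \<in> quot (PK act)" for a b using p' by (simp add: pseudoproduct_iff)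
  have H: "p b a = coset (PH act) (- tmap swap2 id (rep (p a b))) \<longleftrightarrow>
      rep (p b a) \<simeq>[PH act] - flip2 (rep (p a b))" for a b
    unfolding eq_coset_iff[OF gen_subgroup_P2 equiv_prodD(1)[OF p]]
    using eqv_trans[OF _ eqv_minus[OF tmap_swap2_eqv]] eqv_trans[OF _ eqv_minus[OF eqv_sym[OF tmap_swap2_eqv]]]
    by blast
  have K: "p' b a = coset (PK act) (- tmap swap2 id (rep (p' a b))) \<longleftrightarrow>
      rep (p' b a) \<simeq>[PK act] - flip2 (rep (p' a b))" for a b
    unfolding eq_coset_iff[OF gen_subgroup_P2 q']
    using eqv_trans[OF _ eqv_minus[OF tmap_swap2_eqv]] eqv_trans[OF _ eqv_minus[OF eqv_sym[OF tmap_swap2_eqv]]]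
    by blast
  have c': "pi2 act \<gamma> (rep (p' a b)) \<simeq>[PH act] rep (p (gact act (- \<gamma>) a) b)" for \<gamma> a b
    using c unfolding corresponding_def by blast
  have flip: "pi2 act \<gamma> (- flip2 (rep (p' a b))) \<simeq>[PH act] - flip2 (rep (p a (gact act (- \<gamma>) b)))" for \<gamma> a b
  proof -
    have "pi2 act \<gamma> (flip2 (rep (p' a b))) \<simeq>[PH act] diag_act act (- \<gamma>) (flip2 (pi2 act (- \<gamma>) (rep (p' a b))))"
      by (rule pi2_flip2[OF L])
    also have "\<dots> \<simeq>[PH act] diag_act act (- \<gamma>) (flip2 (rep (p (gact act (- (- \<gamma>)) a) b)))"
      by (rule hom_modD[OF hom_diag_act[OF L] hom_modD[OF hom_flip2 c']])
    also have "\<dots> = flip2 (diag_act act (- \<gamma>) (rep (p (gact act \<gamma> a) b)))"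
      by (simp add: flip2_def diag_act_def additive_apply_lift2[OF additive_lift2])
    also have "\<dots> \<simeq>[PH act] flip2 (rep (p (gact act (- \<gamma>) (gact act \<gamma> a)) (gact act (- \<gamma>) b)))"
      by (rule hom_modD[OF hom_flip2 eqv_sym[OF equiv_prodD(5)[OF p]]])
    finally have "pi2 act \<gamma> (flip2 (rep (p' a b))) \<simeq>[PH act] flip2 (rep (p a (gact act (- \<gamma>) b)))"
      by (simp add: L)
    from eqv_minus[OF this] show ?thesis
      by (simp add: additive.minus[OF additive_pi2])
  qed
  show ?thesis
    unfolding H K
  proof
    assume h: "\<forall>a b. rep (p b a) \<simeq>[PH act] - flip2 (rep (p a b))"
    show "\<forall>a b. rep (p' b a) \<simeq>[PK act] - flip2 (rep (p' a b))"
      unfolding pi2_eqv_iff[OF L]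
      using eqv_trans[OF eqv_trans[OF c' h[rule_format]] eqv_sym[OF flip]] by blast
  next
    assume k: "\<forall>a b. rep (p' b a) \<simeq>[PK act] - flip2 (rep (p' a b))"
    show "\<forall>a b. rep (p b a) \<simeq>[PH act] - flip2 (rep (p a b))"
    proof (intro allI)
      fix a b
      have "rep (p b a) \<simeq>[PH act] pi2 act 0 (rep (p' b a))"
        by (rule eqv_sym[OF corresponding_at_zero[OF L c]])
      also have "\<dots> \<simeq>[PH act] pi2 act 0 (- flip2 (rep (p' a b)))"
        using k by (intro hom_modD[OF hom_pi2[OF L]]) blast
      also have "\<dots> \<simeq>[PH act] - flip2 (rep (p a (gact act (- 0) b)))"
        by (rule flip)
      finally show "rep (p b a) \<simeq>[PH act] - flip2 (rep (p a b))"
        by (simp add: L)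
    qed
  qed
qed

lemma pi3_comp_right:
  assumes L: "left_module K actL" and M: "left_module K actM"
    and p: "equiv_prod actL actM p" and c: "corresponding actL actM p p'"
  shows "pi3 actM \<gamma> \<delta> (comp_right K (p' a) (p' b m)) \<simeq>[QH actM]
    comp_right H (p (gact actL (- \<gamma>) a)) (p (gact actL (- \<delta>) b) m)"
proof -
  let ?a = "gact actL (- \<gamma>) a" and ?b = "gact actL (- \<delta>) b"
  let ?r = "\<lambda>d. rep (p ?a d)"
  have c': "pi2 actM \<gamma> (rep (p' a m)) \<simeq>[PH actM] rep (p (gact actL (- \<gamma>) a) m)" for \<gamma> a m
    using c unfolding corresponding_def by blast
  have one: "act_H actL one x = x" for x
    by (rule left_module.act_one[OF left_module_act_H[OF L]])
  have r: "additive_mod (PH actM) ?r" "?r (act_H actM h d) \<simeq>[PH actM] left_mult H one h (?r d)" for h d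
    using equiv_prodD(3)[OF p] equiv_prodD(4)[OF p, of one ?a h d] by (simp_all add: one)
  have r': "diag_act actM t (pi2 actM (\<gamma> + t) (rep (p' a d))) \<simeq>[PH actM] ?r (gact actM t d)" for t d
  proof -
    have "diag_act actM t (pi2 actM (\<gamma> + t) (rep (p' a d))) \<simeq>[PH actM]
        diag_act actM t (rep (p (gact actL (- (\<gamma> + t)) a) d))"
      by (rule hom_modD[OF hom_diag_act[OF M] c'])
    also have "\<dots> \<simeq>[PH actM] rep (p (gact actL t (gact actL (- (\<gamma> + t)) a)) (gact actM t d))"
      by (rule eqv_sym[OF equiv_prodD(5)[OF p]])
    also have "gact actL t (gact actL (- (\<gamma> + t)) a) = ?a"
      by (simp add: L minus_add diff_conv_add_uminus del: add_uminus_conv_diff)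
    finally show ?thesis .
  qed
  have "pi3 actM \<gamma> \<delta> (comp_right K (p' a) (p' b m)) \<simeq>[QH actM]
      pi3 actM \<gamma> \<delta> (right_triple K (\<lambda>d. rep (p' a d)) (rep (p' b m)))"
    by (rule hom_modD[OF hom_pi3[OF M] comp_right_eqv[OF hmul_K_one]])
  also have "\<dots> \<simeq>[QH actM] right_triple H ?r (pi2 actM \<delta> (rep (p' b m)))"
    by (rule pi3_right_triple[OF M M r r'])
  also have "\<dots> \<simeq>[QH actM] right_triple H ?r (rep (p ?b m))"
    by (rule hom_modD[OF hom_right_triple[OF r] c'])
  also have "\<dots> \<simeq>[QH actM] comp_right H (p ?a) (p ?b m)"
    by (rule eqv_sym[OF comp_right_eqv[OF hopf.mul_one_left]])
  finally show ?thesis .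
qed

lemma pi3_comp_left:
  assumes L: "left_module K actL" and M: "left_module K actM"
    and br: "equiv_prod actL actL br" and cbr: "corresponding actL actL br br'"
    and p: "equiv_prod actL actM p" and c: "corresponding actL actM p p'"
  shows "pi3 actM \<gamma> \<delta> (comp_left K (br' a b) (\<lambda>e. p' e m)) \<simeq>[QH actM]
    comp_left H (br (gact actL (- \<gamma>) a) (gact actL (- \<delta>) b)) (\<lambda>e. p e m)"
proof -
  let ?r = "\<lambda>e. rep (p e m)"
  have one: "act_H actM one x = x" for x
    by (rule left_module.act_one[OF left_module_act_H[OF M]])
  have r: "additive_mod (PH actM) ?r" "?r (act_H actL h e) \<simeq>[PH actM] left_mult H h one (?r e)" for h e
    using equiv_prodD(2)[OF p] equiv_prodD(4)[OF p, of h e one m] by (simp_all add: one)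
  have r': "pi2 actM (- t + \<delta>) (rep (p' e m)) \<simeq>[PH actM] ?r (gact actL (- \<delta> + t) e)" for t e
  proof -
    have "pi2 actM (- t + \<delta>) (rep (p' e m)) \<simeq>[PH actM] ?r (gact actL (- (- t + \<delta>)) e)"
      using c unfolding corresponding_def by blast
    then show ?thesis by (simp add: minus_add)
  qed
  have g: "- \<delta> + - (\<gamma> - \<delta>) = - \<gamma>"
    by (metis add.assoc add.right_neutral diff_conv_add_uminus minus_add minus_minus right_minus)
  have "diag_act actL (- \<delta>) (pi2 actL (\<gamma> - \<delta>) (rep (br' a b))) \<simeq>[PH actL]
      diag_act actL (- \<delta>) (rep (br (gact actL (- (\<gamma> - \<delta>)) a) b))"
    using cbr unfolding corresponding_def by (intro hom_modD[OF hom_diag_act[OF L]]) blast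
  also have "\<dots> \<simeq>[PH actL] rep (br (gact actL (- \<delta>) (gact actL (- (\<gamma> - \<delta>)) a)) (gact actL (- \<delta>) b))"
    by (rule eqv_sym[OF equiv_prodD(5)[OF br]])
  also have "gact actL (- \<delta>) (gact actL (- (\<gamma> - \<delta>)) a) = gact actL (- \<gamma>) a"
    unfolding gact_gact[OF L] g ..
  finally have b: "diag_act actL (- \<delta>) (pi2 actL (\<gamma> - \<delta>) (rep (br' a b))) \<simeq>[PH actL]
      rep (br (gact actL (- \<gamma>) a) (gact actL (- \<delta>) b))" .
  have "pi3 actM \<gamma> \<delta> (comp_left K (br' a b) (\<lambda>e. p' e m)) \<simeq>[QH actM]
      pi3 actM \<gamma> \<delta> (left_triple K (\<lambda>e. rep (p' e m)) (rep (br' a b)))"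
    by (rule hom_modD[OF hom_pi3[OF M] comp_left_eqv[OF hmul_K_one]])
  also have "\<dots> \<simeq>[QH actM] left_triple H ?r (diag_act actL (- \<delta>) (pi2 actL (\<gamma> - \<delta>) (rep (br' a b))))"
    by (rule pi3_left_triple[OF M L r r'])
  also have "\<dots> \<simeq>[QH actM] left_triple H ?r (rep (br (gact actL (- \<gamma>) a) (gact actL (- \<delta>) b)))"
    by (rule hom_modD[OF hom_left_triple[OF r] b])
  also have "\<dots> \<simeq>[QH actM] comp_left H (br (gact actL (- \<gamma>) a) (gact actL (- \<delta>) b)) (\<lambda>e. p e m)"
    by (rule eqv_sym[OF comp_left_eqv[OF hopf.mul_one_left]])
  finally show ?thesis .
qed

text \<open>
  The identity over the smash product for \<open>a, b, m\<close> consists of the identities over \<open>H\<close> for all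
  translates of \<open>a\<close> and \<open>b\<close>; degree \<open>(1, 1)\<close> gives back the identity for \<open>a, b, m\<close> itself.
\<close>

lemma componentwise_identity:
  assumes L: "left_module K actL" and M: "left_module K actM"
    and A: "\<And>\<gamma> \<delta> a b m. pi3 actM \<gamma> \<delta> (A' a b m) \<simeq>[QH actM] A (gact actL (- \<gamma>) a) (gact actL (- \<delta>) b) m"
    and B: "\<And>\<gamma> \<delta> a b m. pi3 actM \<gamma> \<delta> (B' a b m) \<simeq>[QH actM] B (gact actL (- \<gamma>) a) (gact actL (- \<delta>) b) m"
  shows "(\<forall>a b m. A a b m \<simeq>[QH actM] B a b m) \<longleftrightarrow> (\<forall>a b m. A' a b m \<simeq>[QK actM] B' a b m)"
proof
  assume h: "\<forall>a b m. A a b m \<simeq>[QH actM] B a b m"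
  show "\<forall>a b m. A' a b m \<simeq>[QK actM] B' a b m"
    unfolding pi3_eqv_iff[OF M]
  proof (intro allI)
    fix a b m \<gamma> \<delta>
    show "pi3 actM \<gamma> \<delta> (A' a b m) \<simeq>[QH actM] pi3 actM \<gamma> \<delta> (B' a b m)"
      by (rule eqv_trans[OF A eqv_trans[OF h[rule_format] eqv_sym[OF B]]])
  qed
next
  assume k: "\<forall>a b m. A' a b m \<simeq>[QK actM] B' a b m"
  show "\<forall>a b m. A a b m \<simeq>[QH actM] B a b m"
  proof (intro allI)
    fix a b m
    have "A (gact actL (- 0) a) (gact actL (- 0) b) m \<simeq>[QH actM] B (gact actL (- 0) a) (gact actL (- 0) b) m"
      by (rule eqv_trans[OF eqv_sym[OF A] eqv_trans[OF hom_modD[OF hom_pi3[OF M] k[rule_format]] B]])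
    then show "A a b m \<simeq>[QH actM] B a b m" by (simp add: L)
  qed
qed

lemma assoc_id_iff:
  assumes L: "left_module K actL" and M: "left_module K actM"
    and br: "equiv_prod actL actL br" and cbr: "corresponding actL actL br br'"
    and p: "equiv_prod actL actM p" and c: "corresponding actL actM p p'"
  shows "assoc_id H (act_H actM) br p \<longleftrightarrow> assoc_id K actM br' p'"
  unfolding assoc_id_def coset_eq_iff[OF gen_subgroup_P3]
  by (rule componentwise_identity[OF L M]) (rule pi3_comp_right[OF L M p c], rule pi3_comp_left[OF assms])

lemma jacobi_id_iff:
  assumes L: "left_module K actL" and M: "left_module K actM"
    and br: "equiv_prod actL actL br" and cbr: "corresponding actL actL br br'"
    and p: "equiv_prod actL actM p" and c: "corresponding actL actM p p'"
  shows "jacobi_id H (act_H actM) br p \<longleftrightarrow> jacobi_id K actM br' p'"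
  unfolding jacobi_id_def coset_eq_iff[OF gen_subgroup_P3]
proof (rule componentwise_identity[OF L M _ pi3_comp_left[OF assms]])
  fix \<gamma> \<delta> a b m
  let ?a = "gact actL (- \<gamma>) a" and ?b = "gact actL (- \<delta>) b"
  have "pi3 actM \<gamma> \<delta> (tmap swap12 id (comp_right K (p' b) (p' a m))) \<simeq>[QH actM]
      pi3 actM \<gamma> \<delta> (flip12 (comp_right K (p' b) (p' a m)))"
    by (rule hom_modD[OF hom_pi3[OF M] tmap_swap12_eqv])
  also have "\<dots> \<simeq>[QH actM] flip12 (pi3 actM \<delta> \<gamma> (comp_right K (p' b) (p' a m)))"
    by (rule pi3_flip12[OF M])
  also have "\<dots> \<simeq>[QH actM] flip12 (comp_right H (p ?b) (p ?a m))"
    by (rule hom_modD[OF hom_flip12 pi3_comp_right[OF L M p c]])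
  also have "\<dots> \<simeq>[QH actM] tmap swap12 id (comp_right H (p ?b) (p ?a m))"
    by (rule eqv_sym[OF tmap_swap12_eqv])
  finally show "pi3 actM \<gamma> \<delta> (comp_right K (p' a) (p' b m) - tmap swap12 id (comp_right K (p' b) (p' a m)))
      \<simeq>[QH actM] comp_right H (p ?a) (p ?b m) - tmap swap12 id (comp_right H (p ?b) (p ?a m))"
    unfolding additive.diff[OF additive_pi3]
    by (intro eqv_diff pi3_comp_right[OF L M p c])
qed

lemma bij_betw_pseudoproducts_with:
  assumes L: "left_module K actL" and M: "left_module K actM"
    and QR: "\<And>p. equiv_prod actL actM p \<Longrightarrow> pseudoproduct K actL actM (smash_prod H \<alpha> actL actM p) \<Longrightarrow>
      corresponding actL actM p (smash_prod H \<alpha> actL actM p) \<Longrightarrow> Q p \<longleftrightarrow> R (smash_prod H \<alpha> actL actM p)"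
  shows "bij_betw (smash_prod H \<alpha> actL actM)
    {p. equiv_prod actL actM p \<and> G_finite H actL actM p \<and> Q p} {p'. pseudoproduct K actL actM p' \<and> R p'}"
  using bij_betw_restrict[OF bij_betw_pseudoproducts[OF L M], of Q R]
    QR[OF _ pseudoproduct_smash_prod[OF L M] corresponding_smash_prod[OF L M]]
  by simp

lemma bij_betw_lie_pseudoalgebras:
  assumes L: "left_module K actL"
  shows "bij_betw (smash_prod H \<alpha> actL actL)
    {br. lie_pseudoalgebra H (act_H actL) br \<and> G_equivariant H \<alpha> actL actL br \<and> G_finite H actL actL br}
    {br. lie_pseudoalgebra K actL br}"
proof -
  let ?Q = "\<lambda>br. (\<forall>a b. br b a = coset (PH actL) (- tmap swap2 id (rep (br a b)))) \<and>
      jacobi_id H (act_H actL) br br"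
  let ?R = "\<lambda>br. (\<forall>a b. br b a = coset (PK actL) (- tmap swap2 id (rep (br a b)))) \<and>
      jacobi_id K actL br br"
  have "?Q br \<longleftrightarrow> ?R br'"
    if "equiv_prod actL actL br" "pseudoproduct K actL actL br'" "corresponding actL actL br br'" for br br'
    using skew_iff[OF L that] jacobi_id_iff[OF L L that(1,3) that(1,3)] by argo
  then have "bij_betw (smash_prod H \<alpha> actL actL)
      {br. equiv_prod actL actL br \<and> G_finite H actL actL br \<and> ?Q br} {br. pseudoproduct K actL actL br \<and> ?R br}"
    by (rule bij_betw_pseudoproducts_with[OF L L])
  then show ?thesis
    by (simp add: lie_pseudoalgebra_def equiv_prod_def conj_ac)
qed

lemma bij_betw_assoc_pseudoalgebras:
  assumes L: "left_module K actL"
  shows "bij_betw (smash_prod H \<alpha> actL actL)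
    {pr. assoc_pseudoalgebra H (act_H actL) pr \<and> G_equivariant H \<alpha> actL actL pr \<and> G_finite H actL actL pr}
    {pr. assoc_pseudoalgebra K actL pr}"
proof -
  have "bij_betw (smash_prod H \<alpha> actL actL)
    {pr. equiv_prod actL actL pr \<and> G_finite H actL actL pr \<and> assoc_id H (act_H actL) pr pr}
    {pr. pseudoproduct K actL actL pr \<and> assoc_id K actL pr pr}"
    by (rule bij_betw_pseudoproducts_with[OF L L]) (rule assoc_id_iff[OF L L], assumption+)
  then show ?thesis
    by (simp add: assoc_pseudoalgebra_def equiv_prod_def conj_ac)
qed

lemma bij_betw_lie_representations:
  assumes L: "left_module K actL" and M: "left_module K actM"
    and br: "lie_pseudoalgebra H (act_H actL) br" "G_equivariant H \<alpha> actL actL br" "G_finite H actL actL br"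
  shows "bij_betw (smash_prod H \<alpha> actL actM)
    {p. lie_representation H (act_H actL) br (act_H actM) p \<and>
       G_equivariant H \<alpha> actL actM p \<and> G_finite H actL actM p}
    {p. lie_representation K actL (smash_prod H \<alpha> actL actL br) actM p}"
proof -
  let ?br = "smash_prod H \<alpha> actL actL br"
  have br': "lie_pseudoalgebra K actL ?br"
    using bij_betwE[OF bij_betw_lie_pseudoalgebras[OF L]] br by blast
  have e: "equiv_prod actL actL br"
    using br by (simp add: equiv_prod_def lie_pseudoalgebra_def)
  have "bij_betw (smash_prod H \<alpha> actL actM)
    {p. equiv_prod actL actM p \<and> G_finite H actL actM p \<and> jacobi_id H (act_H actM) br p}
    {p. pseudoproduct K actL actM p \<and> jacobi_id K actM ?br p}"
    by (intro bij_betw_pseudoproducts_with L M jacobi_id_iff[OF L M e corresponding_smash_prod[OF L L e br(3)]])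
  then show ?thesis
    by (simp add: lie_representation_def br(1) br' equiv_prod_def conj_ac)
qed

lemma bij_betw_assoc_representations:
  assumes L: "left_module K actL" and M: "left_module K actM"
    and pr: "assoc_pseudoalgebra H (act_H actL) pr" "G_equivariant H \<alpha> actL actL pr" "G_finite H actL actL pr"
  shows "bij_betw (smash_prod H \<alpha> actL actM)
    {p. assoc_representation H (act_H actL) pr (act_H actM) p \<and>
       G_equivariant H \<alpha> actL actM p \<and> G_finite H actL actM p}
    {p. assoc_representation K actL (smash_prod H \<alpha> actL actL pr) actM p}"
proof -
  let ?pr = "smash_prod H \<alpha> actL actL pr"
  have pr': "assoc_pseudoalgebra K actL ?pr"
    using bij_betwE[OF bij_betw_assoc_pseudoalgebras[OF L]] pr by blast
  have e: "equiv_prod actL actL pr"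
    using pr by (simp add: equiv_prod_def assoc_pseudoalgebra_def)
  have "bij_betw (smash_prod H \<alpha> actL actM)
    {p. equiv_prod actL actM p \<and> G_finite H actL actM p \<and> assoc_id H (act_H actM) pr p}
    {p. pseudoproduct K actL actM p \<and> assoc_id K actM ?pr p}"
    by (intro bij_betw_pseudoproducts_with L M assoc_id_iff[OF L M e corresponding_smash_prod[OF L L e pr(3)]])
  then show ?thesis
    by (simp add: assoc_representation_def pr(1) pr' equiv_prod_def conj_ac)
qed

end

theorem corollary5p3:
  fixes H :: "('k::{alg_closed_field, field_char_0}, 'h::ab_group_add) hopf_data"
    and \<alpha> :: "'g::group_add \<Rightarrow> 'h \<Rightarrow> 'h"
    and actL :: "('g \<Rightarrow>\<^sub>0 'h) \<Rightarrow> 'l::ab_group_add \<Rightarrow> 'l"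
    and actM :: "('g \<Rightarrow>\<^sub>0 'h) \<Rightarrow> 'm::ab_group_add \<Rightarrow> 'm"
  assumes "cocommutative_hopf_algebra H"
    and "hopf_action H \<alpha>"
    and "left_module (smash H \<alpha>) actL"
  shows
    "bij_betw (smash_prod H \<alpha> actL actL)
       {br. lie_pseudoalgebra H (act_H actL) br \<and>
          G_equivariant H \<alpha> actL actL br \<and> G_finite H actL actL br}
       {br. lie_pseudoalgebra (smash H \<alpha>) actL br} \<and>
     bij_betw (smash_prod H \<alpha> actL actL)
       {pr. assoc_pseudoalgebra H (act_H actL) pr \<and>
          G_equivariant H \<alpha> actL actL pr \<and> G_finite H actL actL pr}
       {pr. assoc_pseudoalgebra (smash H \<alpha>) actL pr} \<and>
     (left_module (smash H \<alpha>) actM \<longrightarrow>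
       (\<forall>br. lie_pseudoalgebra H (act_H actL) br \<longrightarrow>
          G_equivariant H \<alpha> actL actL br \<longrightarrow> G_finite H actL actL br \<longrightarrow>
          bij_betw (smash_prod H \<alpha> actL actM)
            {p. lie_representation H (act_H actL) br (act_H actM) p \<and>
               G_equivariant H \<alpha> actL actM p \<and> G_finite H actL actM p}
            {p. lie_representation (smash H \<alpha>) actL (smash_prod H \<alpha> actL actL br) actM p}) \<and>
       (\<forall>pr. assoc_pseudoalgebra H (act_H actL) pr \<longrightarrow>
          G_equivariant H \<alpha> actL actL pr \<longrightarrow> G_finite H actL actL pr \<longrightarrow>
          bij_betw (smash_prod H \<alpha> actL actM)
            {p. assoc_representation H (act_H actL) pr (act_H actM) p \<and>
               G_equivariant H \<alpha> actL actM p \<and> G_finite H actL actM p}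
            {p. assoc_representation (smash H \<alpha>) actL (smash_prod H \<alpha> actL actL pr) actM p}))"
proof -
  interpret smash_setting H \<alpha>
    using assms(1,2) by (simp add: smash_setting_def)
  show ?thesis
    using bij_betw_lie_pseudoalgebras[OF assms(3)] bij_betw_assoc_pseudoalgebras[OF assms(3)]
      bij_betw_lie_representations[OF assms(3)]
      bij_betw_assoc_representations[OF assms(3)]
    by blast
qed

end
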